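(* For every $k\ge1$, the periodic Toda lattice $V_{2k}$ of dimension $2k$ is a bihamiltonian structure which is generically Kronecker of type $(2k-1,1)$; that is, on an open dense subset of $V_{2k}$ it is a Kronecker bihamiltonian structure of type $(2k-1,1)$.
   Context: A bihamiltonian structure is a manifold with two Poisson brackets $\{,\}_1,\{,\}_2$ such that $\lambda_1\{,\}_1+\lambda_2\{,\}_2$ is Poisson for all $\lambda_1,\lambda_2$. The infinite Toda lattice has complex coordinates $v_l$, $l\in\mathbb Z$, and the brackets (on functions of finitely many coordinates): $\{v_i,v_j\}_1=0$ for $|i-j|>1$, $\{v_{2l},v_{2l\pm1}\}_1=\mp v_{2l\pm1}$; $\{v_i,v_j\}_2=0$ for $|i-j|>2$, $$\{v_{2l},v_{2l\pm1}\}_2=\mp v_{2l}v_{2l\pm1},\quad \{v_{2l},v_{2l+2}\}_2=-2v_{2l+1}^2,\quad \{v_{2l-1},v_{2l+1}\}_2=-\tfrac12 v_{2l-1}v_{2l+1}.$$ Restricting to sequences $v_l$ with period $2k$ one obtains two compatible Poisson brackets on the $2k$-dimensional space $V_{2k}$ over $\mathbb C$ with coordinates $v_l$, $l\in\mathbb Z/2k$, called the periodic Toda lattice: the bracket $\{v_i,v_j\}_a$ on $V_{2k}$ is $\sum_{s\in\mathbb Z}\{v_i,v_{j+2ks}\}_a$ evaluated at the periodic sequence. For $k\ge3$ this just means that, with all indices taken modulo $2k$, $\{v_{2l},v_{2l\pm1}\}_1=\mp v_{2l\pm1}$, $\{v_{2l},v_{2l\pm1}\}_2=\mp v_{2l}v_{2l\pm1}$,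 $\{v_{2l},v_{2l+2}\}_2=-2v_{2l+1}^2$, $\{v_{2l-1},v_{2l+1}\}_2=-\tfrac12 v_{2l-1}v_{2l+1}$, and all brackets of coordinates not determined by these via skew-symmetry are zero. A bihamiltonian structure on a vector space is translation-invariant if both brackets are invariant under parallel translations. It is decomposable if it is isomorphic to a direct product of two bihamiltonian structures of positive dimension. A bihamiltonian structure is Kronecker of type $(d_1,\dots,d_s)$ if near each point it is isomorphic to an open subset of a direct product of translation-invariant indecomposable structures of odd dimensions $d_1,\dots,d_s$. The unique (up to isomorphism) translation-invariant indecomposable structure of dimension $2k-1$ has coordinates $x_0,\dots,x_{2k-2}$ with $\{x_{2l},x_{2l+1}\}_1=1$, $\{x_{2l+1},x_{2l+2}\}_2=1$, $0\le l\le k-2$, all other brackets of coordinates being zero (for $k=1$: a line with both brackets zero). Isomorphisms here are local biholomorphisms preserving both brackets. *)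

theory Defs
  imports "HOL-Analysis.Analysis" "HOL-Library.Numeral_Type"
begin

section \<open>Holomorphic functions on coordinate spaces\<close>

text \<open>
  Products of structures of different dimensions occur below, so dimensions cannot all be index
  types. The space of dimension \<open>card I\<close> with coordinates labelled by \<open>I\<close> is
  realised as the coordinate subspace \<open>cspace I\<close> of \<^typ>\<open>complex^'n\<close>; for
  \<open>I = UNIV\<close> it is the whole space.
\<close>

definition cspace :: "'n::finite set \<Rightarrow> (complex^'n) set" where
  "cspace I = {x. \<forall>i. i \<notin> I \<longrightarrow> x $ i = 0}"

definition cproj :: "'n::finite set \<Rightarrow> complex^'n \<Rightarrow> complex^'n" where
  "cproj I x = (\<chi> i. if i \<in> I then x $ i else 0)"

text \<open>
  Holomorphy in several variables: complex Frechet differentiability at each point. It is used for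
  relatively open subsets \<open>U\<close> of some \<open>cspace I\<close>, where the derivative is
  determined only along \<open>cspace I\<close>.
\<close>

definition mholomorphic_on :: "(complex^'n::finite) set \<Rightarrow> (complex^'n \<Rightarrow> complex) \<Rightarrow> bool" where
  "mholomorphic_on U f \<longleftrightarrow>
     (\<forall>x\<in>U. \<exists>D. (f has_derivative D) (at x within U) \<and> (\<forall>c v. D (c *s v) = c * D v))"

definition biholomorphic ::
    "(complex^'n::finite) set \<Rightarrow> (complex^'m::finite) set \<Rightarrow> (complex^'n \<Rightarrow> complex^'m) \<Rightarrow> bool" where
  "biholomorphic U W \<phi> \<longleftrightarrow>
     \<phi> ` U = W \<and> (\<forall>j. mholomorphic_on U (\<lambda>x. \<phi> x $ j)) \<and>
     (\<exists>\<psi>. \<psi> ` W = U \<and> (\<forall>i. mholomorphic_on W (\<lambda>y. \<psi> y $ i)) \<and>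
          (\<forall>x\<in>U. \<psi> (\<phi> x) = x) \<and> (\<forall>y\<in>W. \<phi> (\<psi> y) = y))"

definition partial :: "'n::finite \<Rightarrow> (complex^'n \<Rightarrow> complex) \<Rightarrow> complex^'n \<Rightarrow> complex" where
  "partial i f x = deriv (\<lambda>z. f (\<chi> j. if j = i then z else x $ j)) (x $ i)"


section \<open>Poisson and bihamiltonian structures\<close>

text \<open>
  A bracket is given by the brackets \<open>P i j\<close> of the coordinate functions; this is the
  biderivation of functions extending them, so bilinearity and the Leibniz rule are built in.
\<close>

definition bracket ::
    "'n::finite set \<Rightarrow> ('n \<Rightarrow> 'n \<Rightarrow> complex^'n \<Rightarrow> complex) \<Rightarrow>
     (complex^'n \<Rightarrow> complex) \<Rightarrow> (complex^'n \<Rightarrow> complex) \<Rightarrow> complex^'n \<Rightarrow> complex" where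
  "bracket I P f g x = (\<Sum>i\<in>I. \<Sum>j\<in>I. P i j x * partial i f x * partial j g x)"

definition poisson_on ::
    "'n::finite set \<Rightarrow> (complex^'n) set \<Rightarrow> ('n \<Rightarrow> 'n \<Rightarrow> complex^'n \<Rightarrow> complex) \<Rightarrow> bool" where
  "poisson_on I U P \<longleftrightarrow>
     (\<forall>i\<in>I. \<forall>j\<in>I. mholomorphic_on U (P i j)) \<and>
     (\<forall>f g. mholomorphic_on U f \<longrightarrow> mholomorphic_on U g \<longrightarrow>
        (\<forall>x\<in>U. bracket I P f g x = - bracket I P g f x)) \<and>
     (\<forall>f g h. mholomorphic_on U f \<longrightarrow> mholomorphic_on U g \<longrightarrow> mholomorphic_on U h \<longrightarrow>
        (\<forall>x\<in>U. bracket I P f (bracket I P g h) x + bracket I P g (bracket I P h f) x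
              + bracket I P h (bracket I P f g) x = 0))"

text \<open>
  A pair of brackets on a subset \<open>region\<close> of \<open>cspace coords\<close>. The values of
  \<open>brack1 i j\<close> and \<open>brack2 i j\<close> are irrelevant unless
  \<open>i, j \<in> coords\<close>.
\<close>

record ('n::finite) bistructure =
  coords :: "'n set"
  region :: "(complex^'n) set"
  brack1 :: "'n \<Rightarrow> 'n \<Rightarrow> complex^'n \<Rightarrow> complex"
  brack2 :: "'n \<Rightarrow> 'n \<Rightarrow> complex^'n \<Rightarrow> complex"

definition bihamiltonian :: "'n::finite bistructure \<Rightarrow> bool" where
  "bihamiltonian M \<longleftrightarrow>
     openin (top_of_set (cspace (coords M))) (region M) \<and>
     poisson_on (coords M) (region M) (brack1 M) \<and>
     poisson_on (coords M) (region M) (brack2 M) \<and>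
     (\<forall>a b. poisson_on (coords M) (region M) (\<lambda>i j x. a * brack1 M i j x + b * brack2 M i j x))"

definition restrict_bi :: "(complex^'n::finite) set \<Rightarrow> 'n bistructure \<Rightarrow> 'n bistructure" where
  "restrict_bi U M = M\<lparr>region := region M \<inter> U\<rparr>"

definition preserves_brackets ::
    "'n::finite bistructure \<Rightarrow> 'm::finite bistructure \<Rightarrow> (complex^'n \<Rightarrow> complex^'m) \<Rightarrow> bool" where
  "preserves_brackets M N \<phi> \<longleftrightarrow>
     (\<forall>f g. mholomorphic_on (region N) f \<longrightarrow> mholomorphic_on (region N) g \<longrightarrow>
        (\<forall>x\<in>region M.
           bracket (coords M) (brack1 M) (f \<circ> \<phi>) (g \<circ> \<phi>) x = bracket (coords N) (brack1 N) f g (\<phi> x) \<and>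
           bracket (coords M) (brack2 M) (f \<circ> \<phi>) (g \<circ> \<phi>) x = bracket (coords N) (brack2 N) f g (\<phi> x)))"

definition isomorphism_bi ::
    "'n::finite bistructure \<Rightarrow> 'm::finite bistructure \<Rightarrow> (complex^'n \<Rightarrow> complex^'m) \<Rightarrow> bool" where
  "isomorphism_bi M N \<phi> \<longleftrightarrow> biholomorphic (region M) (region N) \<phi> \<and> preserves_brackets M N \<phi>"

text \<open>Near \<open>p\<close>, \<open>M\<close> is isomorphic to an open subset of \<open>N\<close>.\<close>

definition isomorphic_near ::
    "complex^'n::finite \<Rightarrow> 'n bistructure \<Rightarrow> 'm::finite bistructure \<Rightarrow> bool" where
  "isomorphic_near p M N \<longleftrightarrow>
     (\<exists>U W \<phi>. p \<in> U \<and> U \<subseteq> region M \<and> openin (top_of_set (region M)) U \<and>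
        W \<subseteq> region N \<and> openin (top_of_set (region N)) W \<and>
        isomorphism_bi (restrict_bi U M) (restrict_bi W N) \<phi>)"

text \<open>
  Direct product; meaningful when the factors have pairwise disjoint coordinate sets.
  Coordinates of different factors have zero bracket.
\<close>

definition prod_bi :: "'n::finite bistructure list \<Rightarrow> 'n bistructure" where
  "prod_bi Ns = (let I = (\<Union>N\<in>set Ns. coords N) in
     \<lparr>coords = I,
      region = {x \<in> cspace I. \<forall>N\<in>set Ns. cproj (coords N) x \<in> region N},
      brack1 = (\<lambda>i j x. \<Sum>N\<leftarrow>Ns.
        if i \<in> coords N \<and> j \<in> coords N then brack1 N i j (cproj (coords N) x) else 0),
      brack2 = (\<lambda>i j x. \<Sum>N\<leftarrow>Ns.
        if i \<in> coords N \<and> j \<in> coords N then brack2 N i j (cproj (coords N) x) else 0)\<rparr>)"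

definition disjoint_coords :: "'n::finite bistructure list \<Rightarrow> bool" where
  "disjoint_coords Ns \<longleftrightarrow>
     (\<forall>a<length Ns. \<forall>b<length Ns. a \<noteq> b \<longrightarrow> coords (Ns ! a) \<inter> coords (Ns ! b) = {})"


section \<open>Kronecker structures\<close>

definition translation_invariant :: "'n::finite bistructure \<Rightarrow> bool" where
  "translation_invariant M \<longleftrightarrow>
     region M = cspace (coords M) \<and>
     (\<forall>a\<in>cspace (coords M). preserves_brackets M M (\<lambda>x. x + a))"

text \<open>
  Isomorphisms are local biholomorphisms, so being isomorphic to a product is required near each
  point. The factors may be sought inside the same ambient index type, because an isomorphism
  preserves the dimension.
\<close>

definition decomposable :: "'n::finite bistructure \<Rightarrow> bool" where
  "decomposable M \<longleftrightarrow>
     (\<exists>N1 N2 :: 'n bistructure. bihamiltonian N1 \<and> bihamiltonian N2 \<and>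
        coords N1 \<noteq> {} \<and> coords N2 \<noteq> {} \<and> disjoint_coords [N1, N2] \<and>
        (\<forall>p\<in>region M. isomorphic_near p M (prod_bi [N1, N2])))"

definition kronecker :: "nat list \<Rightarrow> 'n::finite bistructure \<Rightarrow> bool" where
  "kronecker ds M \<longleftrightarrow> bihamiltonian M \<and>
     (\<forall>p\<in>region M. \<exists>Ns :: 'n bistructure list.
        length Ns = length ds \<and> disjoint_coords Ns \<and>
        (\<forall>m<length ds. bihamiltonian (Ns ! m) \<and> translation_invariant (Ns ! m) \<and>
           \<not> decomposable (Ns ! m) \<and> card (coords (Ns ! m)) = ds ! m \<and> odd (ds ! m)) \<and>
        isomorphic_near p M (prod_bi Ns))"

definition generically_kronecker :: "nat list \<Rightarrow> 'n::finite bistructure \<Rightarrow> bool" where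
  "generically_kronecker ds M \<longleftrightarrow>
     (\<exists>U. U \<subseteq> region M \<and> openin (top_of_set (region M)) U \<and> region M \<subseteq> closure U \<and>
        kronecker ds (restrict_bi U M))"


section \<open>The Toda lattice\<close>

text \<open>
  The \<open>half\<close> functions list the nonzero brackets of \<open>v\<^sub>i\<close> and
  \<open>v\<^sub>j\<close> in one order of the arguments; no pair is listed in both orders.
\<close>

definition toda_half1 :: "int \<Rightarrow> int \<Rightarrow> (int \<Rightarrow> complex) \<Rightarrow> complex" where
  "toda_half1 i j v =
     (if even i \<and> j = i + 1 then - v j
      else if even i \<and> j = i - 1 then v j
      else 0)"

definition toda_half2 :: "int \<Rightarrow> int \<Rightarrow> (int \<Rightarrow> complex) \<Rightarrow> complex" where
  "toda_half2 i j v =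
     (if even i \<and> j = i + 1 then - (v i * v j)
      else if even i \<and> j = i - 1 then v i * v j
      else if even i \<and> j = i + 2 then - 2 * (v (i + 1))\<^sup>2
      else if odd i \<and> j = i + 2 then - (1/2) * v i * v j
      else 0)"

definition toda1 :: "int \<Rightarrow> int \<Rightarrow> (int \<Rightarrow> complex) \<Rightarrow> complex" where
  "toda1 i j v = toda_half1 i j v - toda_half1 j i v"

definition toda2 :: "int \<Rightarrow> int \<Rightarrow> (int \<Rightarrow> complex) \<Rightarrow> complex" where
  "toda2 i j v = toda_half2 i j v - toda_half2 j i v"

text \<open>
  The type \<^typ>\<open>'k bit0\<close> is the ring of integers modulo \<open>2 * CARD('k)\<close>,
  \<open>Rep_bit0\<close> chooses the representative in \<open>{0..<2 * CARD('k)}\<close>. The sum over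
  \<open>s\<close> has finitely many nonzero terms.
\<close>

definition periodic_seq :: "complex^('k::finite bit0) \<Rightarrow> int \<Rightarrow> complex" where
  "periodic_seq x l = x $ of_int l"

definition periodize ::
    "(int \<Rightarrow> int \<Rightarrow> (int \<Rightarrow> complex) \<Rightarrow> complex) \<Rightarrow>
     'k::finite bit0 \<Rightarrow> 'k bit0 \<Rightarrow> complex^('k bit0) \<Rightarrow> complex" where
  "periodize B i j x =
     (\<Sum>\<^sub>\<infinity>s::int. B (Rep_bit0 i) (Rep_bit0 j + 2 * int CARD('k) * s) (periodic_seq x))"

definition periodic_toda :: "'k::finite bit0 bistructure" where
  "periodic_toda =
     \<lparr>coords = UNIV, region = UNIV, brack1 = periodize toda1, brack2 = periodize toda2\<rparr>"

end

theory Submission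
  imports Defs "HOL-Complex_Analysis.Conformal_Mappings" "HOL-Computational_Algebra.Polynomial"
begin

text \<open>
  Write \<open>b l = v\<^bsub>2l\<^esub>\<close> and \<open>a l = v\<^bsub>2l+1\<^esub>\<close>. The bracket
  \<open>{,}\<^sub>2 + c {,}\<^sub>1\<close> is the pullback of \<open>{,}\<^sub>2\<close> under
  \<open>b \<mapsto> b + c\<close>, and a Casimir function of \<open>{,}\<^sub>2\<close> is the trace of the
  monodromy matrix of the periodic Jacobi matrix with entries \<open>b l\<close>, \<open>a l\<close>. Hence
  the coefficients \<open>H l\<close> of the trace as a polynomial in \<open>c\<close> form a Lenard chain
  \<open>{H (l+1), \<cdot>}\<^sub>2 = - {H l, \<cdot>}\<^sub>1\<close>, and \<open>A = \<Prod>l. a l\<close> is a Casimir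
  function of both brackets. The coefficients \<open>s q\<close> of the characteristic polynomial of the
  Jacobi matrix with one site removed commute in both brackets.

  Where \<open>A \<noteq> 0\<close> and the matrix of the brackets \<open>{H l, s q}\<^sub>1\<close> is invertible, the
  functions \<open>H\<close>, \<open>s\<close>, \<open>A\<close> are local coordinates. In them the commuting
  Hamiltonian vector fields of the \<open>H l\<close> are tangent to the directions of \<open>s\<close>, so that
  the dual forms are closed along these directions. Their primitives \<open>y p\<close>, normalised to vanish
  on a slice \<open>s = const\<close>, satisfy \<open>{H l, y p}\<^sub>1 = \<delta>\<close>. The brackets
  \<open>{y p, y q}\<close> are constant along the flows of the \<open>H l\<close> and vanish on the slice because
  the \<open>s q\<close> commute; thus \<open>H\<close>, \<open>y\<close>, \<open>A\<close> are flat coordinates. The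
  invertibility holds generically, since it holds when the chain is cut open.
\<close>

section \<open>Holomorphic functions of several variables\<close>

text \<open>The \<open>s q\<close> commute for a local reason. For the pencil member with parameter
  \<open>c\<close>, the Hamiltonian field of \<open>disc c\<close>, the determinant on the remaining
  sites, is confined to the removed site and its two adjacent edges, and no \<open>disc c'\<close>
  depends on these; two different parameters then separate the two brackets. The brackets of
  \<open>H l\<close> with \<open>s q\<close> are functions, not constants, so the \<open>s q\<close>
  have to be replaced by conjugate variables. Only the first bracket is normalised; the Lenard chain
  transfers the result to the second, so that no simultaneous Darboux theorem enters. For
  \<open>k = 1\<close> and \<open>k = 2\<close> neighbouring coordinates coincide. All formulas are
  therefore written on periodic sequences with integer indices, where these cases look like the
  others. Holomorphy is defined as mere complex differentiability, so the regularity of partial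
  derivatives has to come from Cauchy integrals. Indecomposability must exclude factors with
  arbitrary brackets; their values at a single point suffice for this.\<close>

lemma coordinate_line_eq:
  "(\<chi> j. if j = i then z else x $ j) = x + (z - x $ i) *s axis i (1::complex)"
  by (simp add: vec_eq_iff axis_def)

lemma has_derivative_vec:
  fixes f :: "'b::real_normed_vector \<Rightarrow> complex^'n::finite"
  assumes "\<And>i. ((\<lambda>x. f x $ i) has_derivative (\<lambda>h. f' h $ i)) (at x within S)"
  shows "(f has_derivative f') (at x within S)"
  unfolding has_derivative_componentwise_within[of f]
proof
  fix b :: "complex^'n" assume "b \<in> Basis"
  then obtain i c where b: "b = axis i c" "c \<in> Basis" by (auto simp: Basis_vec_def)
  show "((\<lambda>x. f x \<bullet> b) has_derivative (\<lambda>x. f' x \<bullet> b)) (at x within S)"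
    unfolding b inner_axis by (rule has_derivative_inner_left[OF assms])
qed

lemma coordinate_line_has_derivative:
  "((\<lambda>z. x + (z - a) *s axis i (1::complex)) has_derivative (\<lambda>h. h *s axis i 1)) (at w)"
  by (rule has_derivative_vec) (auto simp: axis_def intro!: derivative_eq_intros)

lemma mholomorphic_on_imp_continuous_on:
  "mholomorphic_on S f \<Longrightarrow> continuous_on S f"
  unfolding mholomorphic_on_def
  by (meson continuous_on_eq_continuous_within has_derivative_continuous)

lemma mholomorphic_on_subset:
  "mholomorphic_on S f \<Longrightarrow> T \<subseteq> S \<Longrightarrow> mholomorphic_on T f"
  unfolding mholomorphic_on_def by (meson has_derivative_subset subset_iff)

lemma complex_linear_expand:
  fixes D :: "complex^'n::finite \<Rightarrow> complex"
  assumes "linear D" "\<And>c v. D (c *s v) = c * D v"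
  shows "D v = (\<Sum>i\<in>UNIV. v $ i * D (axis i 1))"
proof -
  have "D v = D (\<Sum>i\<in>UNIV. v $ i *s axis i 1)" by (simp add: basis_expansion)
  also have "\<dots> = (\<Sum>i\<in>UNIV. D (v $ i *s axis i 1))" by (rule linear_sum[OF assms(1)])
  finally show ?thesis by (simp add: assms(2))
qed

lemma partial_eq:
  fixes f :: "complex^'n::finite \<Rightarrow> complex"
  assumes D: "(f has_derivative D) (at x)" and lin: "\<And>c v. D (c *s v) = c * D v"
  shows "((\<lambda>z. f (\<chi> j. if j = i then z else x $ j)) has_field_derivative D (axis i 1)) (at (x $ i))"
    and "partial i f x = D (axis i 1)"
proof -
  have "((\<lambda>z. f (x + (z - x $ i) *s axis i 1)) has_derivative (\<lambda>h. D (h *s axis i 1))) (at (x $ i))"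
    by (rule has_derivative_compose[OF coordinate_line_has_derivative]) (simp add: D)
  then show 1: "((\<lambda>z. f (\<chi> j. if j = i then z else x $ j)) has_field_derivative D (axis i 1)) (at (x $ i))"
    unfolding coordinate_line_eq has_field_derivative_def lin by (simp only: mult_commute_abs)
  then show "partial i f x = D (axis i 1)"
    unfolding partial_def by (rule DERIV_imp_deriv)
qed

lemma mholomorphic_on_has_derivative:
  assumes "open S" "x \<in> S" "mholomorphic_on S f"
  shows "(f has_derivative (\<lambda>v. \<Sum>i\<in>UNIV. v $ i * partial i f x)) (at x)"
proof -
  obtain D where D: "(f has_derivative D) (at x)" "\<And>c v. D (c *s v) = c * D v"
    using bspec[OF assms(3)[unfolded mholomorphic_on_def] assms(2)]
    unfolding at_within_open[OF assms(2,1)] by blast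
  have "D = (\<lambda>v. \<Sum>i\<in>UNIV. v $ i * partial i f x)"
    by (rule ext, subst complex_linear_expand[OF has_derivative_linear[OF D(1)] D(2)])
      (simp only: partial_eq(2)[OF D])
  with D show ?thesis by simp
qed

lemma mholomorphic_onI:
  assumes "\<And>x. x \<in> S \<Longrightarrow> (f has_derivative (\<lambda>v. \<Sum>i\<in>UNIV. v $ i * d x i)) (at x)"
  shows "mholomorphic_on S f"
  unfolding mholomorphic_on_def
proof (intro ballI exI conjI)
  fix x assume "x \<in> S"
  then show "(f has_derivative (\<lambda>v. \<Sum>i\<in>UNIV. v $ i * d x i)) (at x within S)"
    by (rule has_derivative_at_withinI[OF assms])
qed (auto simp: sum_distrib_left mult.assoc)

lemma partial_eqI:
  fixes f :: "complex^'n::finite \<Rightarrow> complex"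
  assumes "(f has_derivative (\<lambda>v. \<Sum>i\<in>UNIV. v $ i * d i)) (at x)"
  shows "partial i f x = d i"
proof -
  have "partial i f x = (\<Sum>j\<in>UNIV. axis i 1 $ j * d j)"
    by (rule partial_eq(2)[OF assms]) (auto simp: sum_distrib_left mult.assoc)
  also have "\<dots> = (\<Sum>j\<in>UNIV. if j = i then d j else 0)"
    by (intro sum.cong refl) (simp add: axis_def)
  finally show ?thesis by simp
qed

lemma partial_const [simp]: "partial i (\<lambda>x. c) x = 0"
  by (simp add: partial_def)

lemma partial_coordinate: "partial i (\<lambda>x. x $ j) x = (if i = j then 1 else 0)"
  by (cases "i = j") (auto simp: partial_def)

lemma partial_cong_open:
  assumes "open S" "x \<in> S" "\<And>y. y \<in> S \<Longrightarrow> f y = g y"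
  shows "partial i f x = partial i g x"
proof -
  have "isCont (\<lambda>z. x + (z - x $ i) *s axis i 1) (x $ i)"
    using coordinate_line_has_derivative has_derivative_continuous by blast
  then have "\<forall>\<^sub>F z in nhds (x $ i). x + (z - x $ i) *s axis i 1 \<in> S"
    unfolding isCont_def eventually_nhds_conv_at
    using assms(1,2) by (auto dest!: topological_tendstoD[where S=S] simp del: vector_sub_rdistrib)
  then have "\<forall>\<^sub>F z in nhds (x $ i). f (\<chi> j. if j = i then z else x $ j) = g (\<chi> j. if j = i then z else x $ j)"
    unfolding coordinate_line_eq by eventually_elim (use assms in auto)
  then show ?thesis unfolding partial_def by (rule deriv_cong_ev) simp
qed

lemma mholomorphic_on_const [simp]: "mholomorphic_on S (\<lambda>x. c)"
  unfolding mholomorphic_on_def by (auto intro!: exI[of _ "\<lambda>_. 0"])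

lemma mholomorphic_on_coordinate [simp]: "mholomorphic_on S (\<lambda>x. x $ i)"
  unfolding mholomorphic_on_def
  by (auto intro!: exI[of _ "\<lambda>v. v $ i"] bounded_linear_imp_has_derivative)

lemma mholomorphic_on_add:
  assumes "mholomorphic_on S f" "mholomorphic_on S g"
  shows "mholomorphic_on S (\<lambda>x. f x + g x)"
  unfolding mholomorphic_on_def
proof
  fix x assume "x \<in> S"
  then obtain D E where "(f has_derivative D) (at x within S)" "\<And>c v. D (c *s v) = c * D v"
    "(g has_derivative E) (at x within S)" "\<And>c v. E (c *s v) = c * E v"
    using assms unfolding mholomorphic_on_def by metis
  then show "\<exists>D. ((\<lambda>x. f x + g x) has_derivative D) (at x within S) \<and> (\<forall>c v. D (c *s v) = c * D v)"
    by (intro exI[of _ "\<lambda>v. D v + E v"]) (auto intro!: derivative_eq_intros simp: algebra_simps)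
qed

lemma mholomorphic_on_mult:
  assumes "mholomorphic_on S f" "mholomorphic_on S g"
  shows "mholomorphic_on S (\<lambda>x. f x * g x)"
  unfolding mholomorphic_on_def
proof
  fix x assume "x \<in> S"
  then obtain D E where "(f has_derivative D) (at x within S)" "\<And>c v. D (c *s v) = c * D v"
    "(g has_derivative E) (at x within S)" "\<And>c v. E (c *s v) = c * E v"
    using assms unfolding mholomorphic_on_def by metis
  then show "\<exists>D. ((\<lambda>x. f x * g x) has_derivative D) (at x within S) \<and> (\<forall>c v. D (c *s v) = c * D v)"
    by (intro exI[of _ "\<lambda>v. f x * E v + D v * g x"]) (auto intro!: derivative_eq_intros simp: algebra_simps)
qed

lemma mholomorphic_on_minus: "mholomorphic_on S f \<Longrightarrow> mholomorphic_on S (\<lambda>x. - f x)"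
  using mholomorphic_on_mult[OF mholomorphic_on_const[of S "-1"]] by simp

lemma mholomorphic_on_diff:
  "mholomorphic_on S f \<Longrightarrow> mholomorphic_on S g \<Longrightarrow> mholomorphic_on S (\<lambda>x. f x - g x)"
  using mholomorphic_on_add[OF _ mholomorphic_on_minus] by simp

lemma mholomorphic_on_sum:
  "(\<And>i. i \<in> A \<Longrightarrow> mholomorphic_on S (f i)) \<Longrightarrow> mholomorphic_on S (\<lambda>x. \<Sum>i\<in>A. f i x)"
  by (induction A rule: infinite_finite_induct) (auto intro: mholomorphic_on_add)

lemma mholomorphic_on_prod:
  "(\<And>i. i \<in> A \<Longrightarrow> mholomorphic_on S (f i)) \<Longrightarrow> mholomorphic_on S (\<lambda>x. \<Prod>i\<in>A. f i x)"
  by (induction A rule: infinite_finite_induct) (auto intro: mholomorphic_on_mult)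

lemma mholomorphic_on_power: "mholomorphic_on S f \<Longrightarrow> mholomorphic_on S (\<lambda>x. f x ^ n)"
  by (induction n) (auto intro: mholomorphic_on_mult)

lemma mholomorphic_on_inverse:
  assumes "mholomorphic_on S f" "\<And>x. x \<in> S \<Longrightarrow> f x \<noteq> 0"
  shows "mholomorphic_on S (\<lambda>x. inverse (f x))"
  unfolding mholomorphic_on_def
proof
  fix x assume x: "x \<in> S"
  then obtain D where "(f has_derivative D) (at x within S)" "\<And>c v. D (c *s v) = c * D v"
    using assms unfolding mholomorphic_on_def by metis
  then show "\<exists>D. ((\<lambda>x. inverse (f x)) has_derivative D) (at x within S) \<and> (\<forall>c v. D (c *s v) = c * D v)"
    using assms(2)[OF x]
    by (intro exI[of _ "\<lambda>v. - (inverse (f x) * D v * inverse (f x))"])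
      (auto intro!: derivative_eq_intros simp: algebra_simps)
qed

lemma mholomorphic_on_divide:
  "mholomorphic_on S f \<Longrightarrow> mholomorphic_on S g \<Longrightarrow> (\<And>x. x \<in> S \<Longrightarrow> g x \<noteq> 0)
    \<Longrightarrow> mholomorphic_on S (\<lambda>x. f x / g x)"
  unfolding divide_inverse by (intro mholomorphic_on_mult mholomorphic_on_inverse)

lemma mholomorphic_on_det:
  assumes "\<And>i j. mholomorphic_on S (\<lambda>x. M x $ i $ j)"
  shows "mholomorphic_on S (\<lambda>x. det (M x))"
  unfolding det_def by (intro mholomorphic_on_sum mholomorphic_on_mult mholomorphic_on_prod assms mholomorphic_on_const)

lemmas mholomorphic_intros = mholomorphic_on_const mholomorphic_on_coordinate mholomorphic_on_add
  mholomorphic_on_mult mholomorphic_on_minus mholomorphic_on_diff mholomorphic_on_sum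
  mholomorphic_on_prod mholomorphic_on_power

lemma mholomorphic_on_compose:
  assumes "mholomorphic_on W f" "\<And>i. mholomorphic_on S (\<lambda>x. \<phi> x $ i)" "\<phi> ` S \<subseteq> W"
  shows "mholomorphic_on S (f \<circ> \<phi>)"
  unfolding mholomorphic_on_def
proof
  fix x assume x: "x \<in> S"
  have "\<forall>i. \<exists>D. ((\<lambda>x. \<phi> x $ i) has_derivative D) (at x within S) \<and> (\<forall>c v. D (c *s v) = c * D v)"
    using assms(2) x unfolding mholomorphic_on_def by blast
  then obtain D where D: "\<And>i. ((\<lambda>x. \<phi> x $ i) has_derivative D i) (at x within S)"
    "\<And>i c v. D i (c *s v) = c * D i v" by metis
  have d: "(\<phi> has_derivative (\<lambda>v. \<chi> i. D i v)) (at x within S)"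
    by (rule has_derivative_vec) (simp add: D)
  obtain E where E: "(f has_derivative E) (at (\<phi> x) within W)" "\<And>c v. E (c *s v) = c * E v"
    using assms x unfolding mholomorphic_on_def by (metis image_subset_iff)
  have "(f \<circ> \<phi> has_derivative (E \<circ> (\<lambda>v. \<chi> i. D i v))) (at x within S)"
    using has_derivative_subset[OF E(1) assms(3)] d by (rule diff_chain_within[rotated])
  moreover have "(E \<circ> (\<lambda>v. \<chi> i. D i v)) (c *s v) = c * (E \<circ> (\<lambda>v. \<chi> i. D i v)) v" for c v
  proof -
    have "(\<chi> i. D i (c *s v)) = c *s (\<chi> i. D i v)" by (simp add: vec_eq_iff D)
    then show ?thesis by (simp add: E)
  qed
  ultimately show "\<exists>D. (f \<circ> \<phi> has_derivative D) (at x within S) \<and> (\<forall>c v. D (c *s v) = c * D v)" by blast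
qed


lemma norm_smult_axis: "norm (c *s axis i (1::complex)) = norm c"
  by (simp add: vector_scalar_mult_def axis_def if_distrib[of "\<lambda>u. _ * u"] norm_vec_def L2_set_def
    if_distrib[of norm] if_distrib[of "\<lambda>u. u ^ 2"] cong: if_cong)

section \<open>Cauchy integrals and the regularity of partial derivatives\<close>

definition circ :: "real \<Rightarrow> real \<Rightarrow> complex" where
  "circ r t = of_real r * exp (2 * of_real pi * \<i> * of_real t)"

text \<open>On the circle \<open>u = circ r t\<close> this is \<open>u' / (2 pi i u^2)\<close>, the
  kernel of Cauchy's formula for the first derivative after parametrisation over
  \<open>{0..1}\<close>.\<close>

definition cauchy_kernel :: "real \<Rightarrow> real \<Rightarrow> complex" where
  "cauchy_kernel r t = exp (- 2 * of_real pi * \<i> * of_real t) / of_real r"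

lemma norm_circ [simp]: "r \<ge> 0 \<Longrightarrow> norm (circ r t) = r"
  by (simp add: circ_def norm_mult norm_exp_eq_Re)

lemma continuous_on_circ [continuous_intros]: "continuous_on S f \<Longrightarrow> continuous_on S (\<lambda>x. circ r (f x))"
  unfolding circ_def by (intro continuous_intros)

lemma continuous_on_cauchy_kernel [continuous_intros]:
  "continuous_on S f \<Longrightarrow> continuous_on S (\<lambda>x. cauchy_kernel r (f x))"
  unfolding cauchy_kernel_def by (cases "r = 0") (auto intro!: continuous_intros)

lemma partial_cauchy_integral:
  fixes f :: "complex^'n::finite \<Rightarrow> complex"
  assumes f: "mholomorphic_on S f" and S: "open S" and r: "r > 0" "cball x r \<subseteq> S"
  shows "partial i f x =
    integral {0..1} (\<lambda>t. f (x + circ r t *s axis i 1) * cauchy_kernel r t)"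
proof -
  define F where "F = (\<lambda>z. f (x + (z - x $ i) *s axis i 1))"
  have mem: "x + (z - x $ i) *s axis i 1 \<in> S" if "z \<in> cball (x $ i) r" for z
  proof -
    have "dist x (x + (z - x $ i) *s axis i 1) = norm ((z - x $ i) *s axis i (1::complex))"
      by (subst dist_commute) (simp only: dist_norm add_diff_cancel_left')
    also have "\<dots> \<le> r"
      using that unfolding norm_smult_axis by (simp add: dist_norm norm_minus_commute)
    finally show ?thesis using r(2) by (auto simp del: vector_sub_rdistrib)
  qed
  have der: "(F has_field_derivative partial i f (x + (z - x $ i) *s axis i 1)) (at z)"
    if "z \<in> cball (x $ i) r" for z
  proof -
    let ?y = "x + (z - x $ i) *s axis i 1"
    have "((\<lambda>w. f (\<chi> j. if j = i then w else ?y $ j)) has_field_derivative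
      (\<Sum>j\<in>UNIV. axis i 1 $ j * partial j f ?y)) (at (?y $ i))"
      by (rule partial_eq(1)[OF mholomorphic_on_has_derivative[OF S mem[OF that] f]])
        (auto simp: sum_distrib_left mult.assoc)
    moreover have "(\<Sum>j\<in>UNIV. axis i 1 $ j * partial j f ?y) = partial i f ?y"
      by (simp add: axis_def if_distrib[of "\<lambda>u. u * _"] cong: if_cong)
    moreover have "?y $ i = z" by (simp add: axis_def)
    moreover have "(\<lambda>w. f (\<chi> j. if j = i then w else ?y $ j)) = F"
      unfolding F_def by (intro ext arg_cong[of _ _ f]) (simp add: vec_eq_iff axis_def)
    ultimately show ?thesis by simp
  qed
  have cont: "continuous_on (cball (x $ i) r) F"
    by (intro continuous_at_imp_continuous_on ballI DERIV_isCont[OF der])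
  have hol: "F holomorphic_on ball (x $ i) r"
    unfolding holomorphic_on_def field_differentiable_def
    using der by (meson ball_subset_cball has_field_derivative_at_within subsetD)
  have "(F has_field_derivative 1 / (2 * of_real pi * \<i>) *
      contour_integral (circlepath (x $ i) r) (\<lambda>u. F u / (u - x $ i)\<^sup>2)) (at (x $ i))"
    using Cauchy_derivative_integral_circlepath(2)[OF cont hol] r by simp
  moreover have "(F has_field_derivative partial i f x) (at (x $ i))"
    using der[of "x $ i"] r by simp
  ultimately have "partial i f x = 1 / (2 * of_real pi * \<i>) *
      contour_integral (circlepath (x $ i) r) (\<lambda>u. F u / (u - x $ i)\<^sup>2)"
    using DERIV_unique by blast
  also have "\<dots> = 1 / (2 * of_real pi * \<i>) *
      integral {0..1} (\<lambda>t. F (circlepath (x $ i) r t) / (circlepath (x $ i) r t - x $ i)\<^sup>2 *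
        vector_derivative (circlepath (x $ i) r) (at t))"
    by (simp only: contour_integral_integral)
  also have "\<dots> = integral {0..1} (\<lambda>t. 1 / (2 * of_real pi * \<i>) *
     (F (circlepath (x $ i) r t) / (circlepath (x $ i) r t - x $ i)\<^sup>2 *
        vector_derivative (circlepath (x $ i) r) (at t)))"
    by (rule integral_mult_right[symmetric])
  also have "\<dots> = integral {0..1} (\<lambda>t. f (x + circ r t *s axis i 1) * cauchy_kernel r t)"
  proof (rule integral_cong)
    fix t :: real assume t: "t \<in> {0..1}"
    show "1 / (2 * of_real pi * \<i>) *
     (F (circlepath (x $ i) r t) / (circlepath (x $ i) r t - x $ i)\<^sup>2 *
        vector_derivative (circlepath (x $ i) r) (at t)) =
      f (x + circ r t *s axis i 1) * cauchy_kernel r t"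
      using t r unfolding F_def vector_derivative_circlepath circ_def cauchy_kernel_def
      by (simp add: circlepath power2_eq_square exp_minus field_simps)
  qed
  finally show ?thesis .
qed


lemma cball_smult_axis:
  "0 \<le> r \<Longrightarrow> norm c \<le> r \<Longrightarrow> x + c *s axis i (1::complex) \<in> cball x r"
  by (subst mem_cball, subst dist_commute) (simp add: dist_norm norm_smult_axis)

lemma continuous_on_smult_axis [continuous_intros]:
  "continuous_on A f \<Longrightarrow> continuous_on A c \<Longrightarrow> continuous_on A (\<lambda>x. f x + c x *s axis i (1::complex))"
  unfolding vector_scalar_mult_def plus_vec_def by (auto intro!: continuous_intros)

lemma partial_continuous_on:
  fixes f :: "complex^'n::finite \<Rightarrow> complex"
  assumes S: "open S" and f: "mholomorphic_on S f"
  shows "continuous_on S (partial i f)"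
proof (rule continuous_at_imp_continuous_on, rule ballI)
  fix x assume "x \<in> S"
  then obtain e where e: "e > 0" "cball x e \<subseteq> S"
    using S open_contains_cball by blast
  \<comment> \<open>Half the radius: circles of this one radius around all centres in
    \<open>ball x r\<close> stay in \<open>S\<close>, so the centre enters the integral only as a
    parameter of the integrand.\<close>
  define r where "r = e / 2"
  have r: "r > 0" "2 * r = e" using e by (auto simp: r_def)
  have sub: "cball y r \<subseteq> S" if "y \<in> ball x r" for y
  proof
    fix z assume "z \<in> cball y r"
    then have "dist x z \<le> e" using that r dist_triangle[of x z y] by auto
    then show "z \<in> S" using e by auto
  qed
  have mem: "y + circ r t *s axis i 1 \<in> S" if "y \<in> ball x r" for y t
    using cball_smult_axis[of r "circ r t" y i] sub[OF that] r by auto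
  have "continuous_on (ball x r \<times> cbox 0 1) (\<lambda>p. f (fst p + circ r (snd p) *s axis i 1) * cauchy_kernel r (snd p))"
    by (intro continuous_intros continuous_on_compose2[OF mholomorphic_on_imp_continuous_on[OF f]])
      (use mem r in auto)
  then have "continuous_on (ball x r) (\<lambda>y. integral (cbox 0 1) (\<lambda>t. f (y + circ r t *s axis i 1) * cauchy_kernel r t))"
    by (intro integral_continuous_on_param) (simp add: split_def)
  moreover have "integral (cbox 0 1) (\<lambda>t. f (y + circ r t *s axis i 1) * cauchy_kernel r t) = partial i f y" if "y \<in> ball x r" for y
    using partial_cauchy_integral[OF f S r(1) sub[OF that]] by simp
  ultimately have "continuous_on (ball x r) (partial i f)"
    by (rule continuous_on_eq)
  then show "isCont (partial i f) x"
    using r by (simp add: continuous_on_eq_continuous_at)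
qed

text \<open>The Leibniz rule with the derivative packaged as a bounded linear function
  \<open>D\<close>, whose integral acts coefficient by coefficient. It serves the Cauchy integrals
  here and the segment integrals that define relative primitives.\<close>

lemma integral_has_complex_derivative:
  fixes g :: "complex^'n::finite \<Rightarrow> real \<Rightarrow> complex"
  assumes B: "open B" "convex B" "x \<in> B"
    and der: "\<And>y t. y \<in> B \<Longrightarrow> t \<in> {0..1} \<Longrightarrow> ((\<lambda>y. g y t) has_derivative (\<lambda>v. \<Sum>j\<in>UNIV. v $ j * d y t j)) (at y)"
    and int: "\<And>y. y \<in> B \<Longrightarrow> g y integrable_on {0..1}"
    and cont: "\<And>j. continuous_on (B \<times> {0..1}) (\<lambda>p. d (fst p) (snd p) j)"
  shows "((\<lambda>y. integral {0..1} (g y)) has_derivative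
    (\<lambda>v. \<Sum>j\<in>UNIV. v $ j * integral {0..1} (\<lambda>t. d x t j))) (at x)"
proof -
  define D where "D = (\<lambda>y t. Blinfun (\<lambda>v. \<Sum>j\<in>UNIV. v $ j * d y t j))"
  have D: "blinfun_apply (D y t) = (\<lambda>v. \<Sum>j\<in>UNIV. v $ j * d y t j)" for y t
    unfolding D_def
    by (intro bounded_linear_Blinfun_apply bounded_linear_sum bounded_linear_mult_const bounded_linear_vec_nth)
  have cd: "continuous_on {0..1} (\<lambda>t. d x t j)" for j
    using continuous_on_compose2[OF cont[of j] continuous_on_Pair[OF continuous_on_const[of _ x] continuous_on_id]]
      B(3) by auto
  have cD: "continuous_on (B \<times> cbox 0 1) (\<lambda>(y, t). D y t)"
    unfolding split_def
    by (rule continuous_on_blinfun_componentwise, simp only: D cbox_interval,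
        intro continuous_on_sum continuous_on_mult continuous_on_const cont)
  have cDx: "continuous_on {0..1} (D x)"
    by (rule continuous_on_blinfun_componentwise, simp only: D,
        intro continuous_on_sum continuous_on_mult continuous_on_const cd)
  have "((\<lambda>y. integral (cbox 0 1) (g y)) has_derivative blinfun_apply (integral (cbox 0 1) (D x))) (at x within B)"
    by (rule leibniz_rule[OF _ _ cD B(3,2)])
      (simp_all only: D cbox_interval der int has_derivative_at_withinI)
  then have "((\<lambda>y. integral {0..1} (g y)) has_derivative blinfun_apply (integral {0..1} (D x))) (at x)"
    by (simp add: at_within_open[OF B(3,1)])
  moreover have "blinfun_apply (integral {0..1} (D x)) v = (\<Sum>j\<in>UNIV. v $ j * integral {0..1} (\<lambda>t. d x t j))" for v
  proof -
    have "blinfun_apply (integral {0..1} (D x)) v = integral {0..1} (\<lambda>t. blinfun_apply (D x t) v)"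
      by (rule blinfun_apply_integral) (rule integrable_continuous_interval[OF cDx])
    also have "\<dots> = (\<Sum>j\<in>UNIV. integral {0..1} (\<lambda>t. v $ j * d x t j))"
      unfolding D by (rule integral_sum)
        (auto intro!: integrable_continuous_interval continuous_on_mult continuous_on_const cd)
    also have "\<dots> = (\<Sum>j\<in>UNIV. v $ j * integral {0..1} (\<lambda>t. d x t j))"
      by (simp only: integral_mult_right)
    finally show ?thesis .
  qed
  then have "blinfun_apply (integral {0..1} (D x)) =
      (\<lambda>v. \<Sum>j\<in>UNIV. v $ j * integral {0..1} (\<lambda>t. d x t j))" by (rule ext)
  ultimately show ?thesis by simp
qed

text \<open>Differentiating Cauchy's formula for \<open>partial i f\<close> under the integral sign
  leaves a Cauchy integral of \<open>partial j f\<close>. Keeping the coefficients in this explicit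
  form gives the symmetry of second derivatives as well as their existence.\<close>

lemma partial_has_derivative:
  fixes f :: "complex^'n::finite \<Rightarrow> complex"
  assumes S: "open S" and f: "mholomorphic_on S f" and x: "x \<in> S"
  obtains r where "r > 0" "cball x r \<subseteq> S"
   "(partial i f has_derivative (\<lambda>v. \<Sum>j\<in>UNIV. v $ j *
      integral {0..1} (\<lambda>t. partial j f (x + circ r t *s axis i 1) * cauchy_kernel r t))) (at x)"
proof -
  obtain e where e: "e > 0" "cball x e \<subseteq> S"
    using S x open_contains_cball by blast
  define r where "r = e / 2"
  have r: "r > 0" "2 * r = e" using e by (auto simp: r_def)
  have sub: "cball y r \<subseteq> S" if "y \<in> ball x r" for y
  proof
    fix z assume "z \<in> cball y r"
    then have "dist x z \<le> e" using that r dist_triangle[of x z y] by auto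
    then show "z \<in> S" using e by auto
  qed
  have mem: "y + circ r t *s axis i 1 \<in> S" if "y \<in> ball x r" for y t
    using cball_smult_axis[of r "circ r t" y i] sub[OF that] r by auto
  have "((\<lambda>y. integral {0..1} (\<lambda>t. f (y + circ r t *s axis i 1) * cauchy_kernel r t)) has_derivative
    (\<lambda>v. \<Sum>j\<in>UNIV. v $ j * integral {0..1} (\<lambda>t. partial j f (x + circ r t *s axis i 1) * cauchy_kernel r t))) (at x)"
  proof (rule integral_has_complex_derivative[where B="ball x r"])
    fix y and t :: real assume y: "y \<in> ball x r"
    have "(f has_derivative (\<lambda>v. \<Sum>j\<in>UNIV. v $ j * partial j f (y + circ r t *s axis i 1))) (at (y + circ r t *s axis i 1))"
      by (rule mholomorphic_on_has_derivative[OF S mem[OF y] f])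
    then have "((\<lambda>y. f (y + circ r t *s axis i 1)) has_derivative (\<lambda>v. \<Sum>j\<in>UNIV. v $ j * partial j f (y + circ r t *s axis i 1))) (at y)"
      by (rule has_derivative_compose[rotated]) (auto intro!: derivative_eq_intros)
    then show "((\<lambda>y. f (y + circ r t *s axis i 1) * cauchy_kernel r t) has_derivative
      (\<lambda>v. \<Sum>j\<in>UNIV. v $ j * (partial j f (y + circ r t *s axis i 1) * cauchy_kernel r t))) (at y)"
      by (rule has_derivative_eq_rhs[OF has_derivative_mult_left]) (simp only: sum_distrib_right mult.assoc)
  next
    fix y assume y: "y \<in> ball x r"
    show "(\<lambda>t. f (y + circ r t *s axis i 1) * cauchy_kernel r t) integrable_on {0..1}"
      by (intro integrable_continuous_interval continuous_intros continuous_on_compose2[OF mholomorphic_on_imp_continuous_on[OF f]])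
        (use mem y r in auto)
  next
    show "continuous_on (ball x r \<times> {0..1}) (\<lambda>p. partial j f (fst p + circ r (snd p) *s axis i 1) * cauchy_kernel r (snd p))" for j
      by (intro continuous_intros continuous_on_compose2[OF partial_continuous_on[OF S f]])
        (use mem r in auto)
  qed (use r in auto)
  moreover have "integral {0..1} (\<lambda>t. f (y + circ r t *s axis i 1) * cauchy_kernel r t) = partial i f y" if "y \<in> ball x r" for y
    using partial_cauchy_integral[OF f S r(1) sub[OF that]] by simp
  ultimately have "(partial i f has_derivative
    (\<lambda>v. \<Sum>j\<in>UNIV. v $ j * integral {0..1} (\<lambda>t. partial j f (x + circ r t *s axis i 1) * cauchy_kernel r t))) (at x)"
    using r by (elim has_derivative_transform_within_open[where s="ball x r"]) simp_all
  then show ?thesis using that[OF r(1) sub] r by simp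
qed

lemma partial_mholomorphic_on:
  assumes "open S" "mholomorphic_on S f"
  shows "mholomorphic_on S (partial i f)"
  unfolding mholomorphic_on_def
proof
  fix x assume x: "x \<in> S"
  obtain d where d: "(partial i f has_derivative (\<lambda>v. \<Sum>j\<in>UNIV. v $ j * d j)) (at x)"
    by (rule partial_has_derivative[OF assms x, of i]) (rule that)
  show "\<exists>D. (partial i f has_derivative D) (at x within S) \<and> (\<forall>c v. D (c *s v) = c * D v)"
    using has_derivative_at_withinI[OF d, of S] by (intro exI conjI) (auto simp: sum_distrib_left mult.assoc)
qed

text \<open>The \<open>j\<close>-th coefficient of the derivative of \<open>partial i f\<close> is
  literally the Cauchy integral that represents \<open>partial i (partial j f)\<close>.\<close>

lemma partial_commute:
  assumes "open S" "mholomorphic_on S f" "x \<in> S"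
  shows "partial j (partial i f) x = partial i (partial j f) x"
proof -
  obtain r where r: "r > 0" "cball x r \<subseteq> S" and
    "(partial i f has_derivative (\<lambda>v. \<Sum>j\<in>UNIV. v $ j *
      integral {0..1} (\<lambda>t. partial j f (x + circ r t *s axis i 1) * cauchy_kernel r t))) (at x)"
    by (rule partial_has_derivative[OF assms, of i]) (rule that)
  from partial_eqI[OF this(3), of j] partial_cauchy_integral[OF partial_mholomorphic_on[OF assms(1,2), of j] assms(1) r, of i]
  show ?thesis by simp
qed

section \<open>Poisson brackets and local isomorphisms\<close>

lemma partial_add:
  assumes "open S" "x \<in> S" "mholomorphic_on S f" "mholomorphic_on S g"
  shows "partial i (\<lambda>x. f x + g x) x = partial i f x + partial i g x"
  by (rule partial_eqI, rule has_derivative_eq_rhs,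
      rule has_derivative_add[OF mholomorphic_on_has_derivative[OF assms(1-3)] mholomorphic_on_has_derivative[OF assms(1,2,4)]])
    (simp add: sum.distrib distrib_left)

lemma partial_mult:
  assumes "open S" "x \<in> S" "mholomorphic_on S f" "mholomorphic_on S g"
  shows "partial i (\<lambda>x. f x * g x) x = partial i f x * g x + f x * partial i g x"
  by (rule partial_eqI, rule has_derivative_eq_rhs,
      rule has_derivative_mult[OF mholomorphic_on_has_derivative[OF assms(1-3)] mholomorphic_on_has_derivative[OF assms(1,2,4)]])
    (simp add: sum.distrib distrib_left sum_distrib_left sum_distrib_right mult_ac add.commute)

lemma partial_minus:
  assumes "open S" "x \<in> S" "mholomorphic_on S f"
  shows "partial i (\<lambda>x. - f x) x = - partial i f x"
  using partial_mult[OF assms(1,2) mholomorphic_on_const assms(3), of i "-1"] by simp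

lemma partial_sum:
  assumes "open S" "x \<in> S" "\<And>a. a \<in> A \<Longrightarrow> mholomorphic_on S (f a)"
  shows "partial i (\<lambda>x. \<Sum>a\<in>A. f a x) x = (\<Sum>a\<in>A. partial i (f a) x)"
  using assms(3)
proof (induction A rule: infinite_finite_induct)
  case (insert a A)
  then show ?case by (simp add: partial_add[OF assms(1,2)] mholomorphic_on_sum)
qed auto

lemma partial_compose:
  assumes "open S" "open W" "x \<in> S" "\<And>i. mholomorphic_on S (\<lambda>x. \<phi> x $ i)" "\<phi> ` S \<subseteq> W"
    and "mholomorphic_on W f"
  shows "partial i (f \<circ> \<phi>) x = (\<Sum>j\<in>UNIV. partial j f (\<phi> x) * partial i (\<lambda>x. \<phi> x $ j) x)"
proof (rule partial_eqI)
  have "(\<phi> has_derivative (\<lambda>v. \<chi> j. \<Sum>i\<in>UNIV. v $ i * partial i (\<lambda>x. \<phi> x $ j) x)) (at x)"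
    by (rule has_derivative_vec) (simp add: mholomorphic_on_has_derivative[OF assms(1,3,4)])
  moreover have "(f has_derivative (\<lambda>v. \<Sum>i\<in>UNIV. v $ i * partial i f (\<phi> x))) (at (\<phi> x))"
    using assms by (intro mholomorphic_on_has_derivative[OF assms(2)]) auto
  ultimately have "(f \<circ> \<phi> has_derivative (\<lambda>v. \<Sum>i\<in>UNIV. v $ i * partial i f (\<phi> x)) \<circ>
      (\<lambda>v. \<chi> j. \<Sum>i\<in>UNIV. v $ i * partial i (\<lambda>x. \<phi> x $ j) x)) (at x)"
    by (rule diff_chain_at)
  moreover have "(\<lambda>v. \<Sum>i\<in>UNIV. v $ i * partial i f (\<phi> x)) \<circ>
      (\<lambda>v. \<chi> j. \<Sum>i\<in>UNIV. v $ i * partial i (\<lambda>x. \<phi> x $ j) x) =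
      (\<lambda>v. \<Sum>i\<in>UNIV. v $ i * (\<Sum>j\<in>UNIV. partial j f (\<phi> x) * partial i (\<lambda>x. \<phi> x $ j) x))"
  proof
    fix v
    have "(\<Sum>j\<in>UNIV. (\<Sum>i\<in>UNIV. v $ i * partial i (\<lambda>x. \<phi> x $ j) x) * partial j f (\<phi> x)) =
      (\<Sum>j\<in>UNIV. \<Sum>i\<in>UNIV. v $ i * (partial j f (\<phi> x) * partial i (\<lambda>x. \<phi> x $ j) x))"
      by (simp add: sum_distrib_right sum_distrib_left mult_ac)
    also have "\<dots> = (\<Sum>i\<in>UNIV. v $ i * (\<Sum>j\<in>UNIV. partial j f (\<phi> x) * partial i (\<lambda>x. \<phi> x $ j) x))"
      by (subst sum.swap) (simp add: sum_distrib_left)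
    finally show "((\<lambda>v. \<Sum>i\<in>UNIV. v $ i * partial i f (\<phi> x)) \<circ>
      (\<lambda>v. \<chi> j. \<Sum>i\<in>UNIV. v $ i * partial i (\<lambda>x. \<phi> x $ j) x)) v =
      (\<Sum>i\<in>UNIV. v $ i * (\<Sum>j\<in>UNIV. partial j f (\<phi> x) * partial i (\<lambda>x. \<phi> x $ j) x))"
      by simp
  qed
  ultimately show "(f \<circ> \<phi> has_derivative
      (\<lambda>v. \<Sum>i\<in>UNIV. v $ i * (\<Sum>j\<in>UNIV. partial j f (\<phi> x) * partial i (\<lambda>x. \<phi> x $ j) x))) (at x)"
    by simp
qed

section \<open>From coordinate subspaces to open sets of the ambient space\<close>

lemma cproj_in_cspace [simp]: "cproj I x \<in> cspace I"
  by (simp add: cproj_def cspace_def)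

lemma cproj_cspace: "x \<in> cspace I \<Longrightarrow> cproj I x = x"
  by (auto simp: cproj_def cspace_def vec_eq_iff)

lemma cspace_UNIV [simp]: "cspace UNIV = UNIV"
  by (simp add: cspace_def)

lemma bounded_linear_cproj: "bounded_linear (cproj I)"
proof -
  have "linear (cproj I)" by (auto simp: cproj_def vec_eq_iff intro!: linearI)
  then show ?thesis by (rule linear_conv_bounded_linear[THEN iffD1])
qed

lemma continuous_on_cproj: "continuous_on A (cproj I)"
  by (rule linear_continuous_on[OF bounded_linear_cproj])

lemma cproj_coordinate_line:
  assumes "i \<in> I"
  shows "cproj I (\<chi> j. if j = i then z else x $ j) = (\<chi> j. if j = i then z else cproj I x $ j)"
  using assms by (auto simp: cproj_def vec_eq_iff)

lemma partial_cproj: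
  assumes "i \<in> I"
  shows "partial i (f \<circ> cproj I) x = partial i f (cproj I x)"
proof -
  have "cproj I x $ i = x $ i" using assms by (simp add: cproj_def)
  then show ?thesis unfolding partial_def by (simp add: cproj_coordinate_line[OF assms])
qed

text \<open>Composition with \<open>cproj I\<close> extends functions on a relatively open
  \<open>U\<close> to this open set, constant in the directions outside \<open>I\<close> and with
  the same partial derivatives along \<open>I\<close>. Statements about \<open>cspace I\<close> thus
  reduce to open sets.\<close>

lemma open_cproj_vimage:
  assumes "openin (top_of_set (cspace I)) U"
  shows "open {x. cproj I x \<in> U}"
proof -
  obtain T where T: "open T" "U = T \<inter> cspace I" using assms by (auto simp: openin_open)
  have "{x. cproj I x \<in> U} = cproj I -` T" using T by auto
  also have "open \<dots>"
    using continuous_on_cproj[of UNIV I] T(1) by (simp add: continuous_on_open_vimage)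
  finally show ?thesis .
qed

lemma openin_subset_cspace:
  "openin (top_of_set (cspace I)) U \<Longrightarrow> x \<in> U \<Longrightarrow> x \<in> cspace I"
  using openin_imp_subset by auto

lemma mholomorphic_on_cproj:
  assumes "mholomorphic_on U f"
  shows "mholomorphic_on {x. cproj I x \<in> U} (f \<circ> cproj I)"
proof (rule mholomorphic_on_compose[OF assms])
  show "mholomorphic_on {x. cproj I x \<in> U} (\<lambda>x. cproj I x $ i)" for i
    by (cases "i \<in> I") (auto simp: cproj_def)
qed auto

lemma bracket_cproj:
  "(bracket I P f g \<circ> cproj I) x = bracket I (\<lambda>i j. P i j \<circ> cproj I) (f \<circ> cproj I) (g \<circ> cproj I) x"
  by (auto simp: bracket_def partial_cproj intro!: sum.cong)

lemma bracket_mholomorphic_on: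
  assumes "open S" "\<And>i j. i \<in> I \<Longrightarrow> j \<in> I \<Longrightarrow> mholomorphic_on S (P i j)"
    "mholomorphic_on S f" "mholomorphic_on S g"
  shows "mholomorphic_on S (bracket I P f g)"
  unfolding bracket_def[abs_def]
  by (intro mholomorphic_intros partial_mholomorphic_on assms)

lemma bracket_antisym:
  assumes "\<And>i j. i \<in> I \<Longrightarrow> j \<in> I \<Longrightarrow> P i j x = - P j i x"
  shows "bracket I P f g x = - bracket I P g f x"
proof -
  have "bracket I P f g x = (\<Sum>j\<in>I. \<Sum>i\<in>I. P i j x * partial i f x * partial j g x)"
    unfolding bracket_def by (rule sum.swap)
  also have "\<dots> = (\<Sum>j\<in>I. \<Sum>i\<in>I. - (P j i x * partial j g x * partial i f x))"
  proof (intro sum.cong refl)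
    fix i j assume "j \<in> I" "i \<in> I"
    then show "P i j x * partial i f x * partial j g x = - (P j i x * partial j g x * partial i f x)"
      using assms[of i j] by simp
  qed
  finally show ?thesis by (simp add: bracket_def sum_negf)
qed

text \<open>
  The second-order terms of the Jacobi sum cancel in pairs, which leaves the Jacobi sums of the
  coordinate functions.
\<close>

lemma jacobi_open:
  fixes P :: "'n::finite \<Rightarrow> 'n \<Rightarrow> complex^'n \<Rightarrow> complex"
  assumes S: "open S" "x \<in> S"
    and P: "\<And>i j. i \<in> I \<Longrightarrow> j \<in> I \<Longrightarrow> mholomorphic_on S (P i j)"
    and anti: "\<And>i j. i \<in> I \<Longrightarrow> j \<in> I \<Longrightarrow> P i j x = - P j i x"
    and jac: "\<And>i j m. i \<in> I \<Longrightarrow> j \<in> I \<Longrightarrow> m \<in> I \<Longrightarrow>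
      (\<Sum>l\<in>I. P i l x * partial l (P j m) x + P j l x * partial l (P m i) x + P m l x * partial l (P i j) x) = 0"
    and f: "mholomorphic_on S f" and g: "mholomorphic_on S g" and h: "mholomorphic_on S h"
  shows "bracket I P f (bracket I P g h) x + bracket I P g (bracket I P h f) x
              + bracket I P h (bracket I P f g) x = 0"
proof -
  \<comment> \<open>\<open>X f\<close> is the Hamiltonian vector field of \<open>f\<close>, and
    \<open>B f g h\<close> is the Hessian of \<open>h\<close> evaluated on \<open>X f\<close> and
    \<open>X g\<close>, hence symmetric in \<open>f\<close> and \<open>g\<close>. \<open>T\<close>
    collects the terms in which the coefficients \<open>P\<close> are differentiated.\<close>
  define X where "X = (\<lambda>f l. \<Sum>i\<in>I. P i l x * partial i f x)"
  define B where "B = (\<lambda>f g h. \<Sum>l\<in>I. \<Sum>m\<in>I. X f l * X g m * partial l (partial m h) x)"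
  define T where "T = (\<lambda>f g h. \<Sum>i\<in>I. \<Sum>j\<in>I. \<Sum>m\<in>I. \<Sum>l\<in>I.
    P i l x * partial l (P j m) x * (partial i f x * partial j g x * partial m h x))"
  have X: "(\<Sum>m\<in>I. P j m x * partial m h x) = - X h j" if "j \<in> I" for j h
    unfolding X_def sum_negf[symmetric]
  proof (intro sum.cong refl)
    fix m assume "m \<in> I"
    then show "P j m x * partial m h x = - (P m j x * partial m h x)" using anti[OF that] by simp
  qed
  have main: "bracket I P f (bracket I P g h) x = T f g h - B f h g + B f g h"
    if f: "mholomorphic_on S f" and g: "mholomorphic_on S g" and h: "mholomorphic_on S h" for f g h
  proof -
    have d: "partial l (bracket I P g h) x =
       (\<Sum>j\<in>I. \<Sum>m\<in>I. partial l (P j m) x * partial j g x * partial m h x) -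
       (\<Sum>j\<in>I. X h j * partial l (partial j g) x) + (\<Sum>m\<in>I. X g m * partial l (partial m h) x)" for l
    proof -
      have "partial l (bracket I P g h) x = (\<Sum>j\<in>I. \<Sum>m\<in>I.
          partial l (\<lambda>x. P j m x * partial j g x * partial m h x) x)"
        unfolding bracket_def[abs_def]
        by (simp add: partial_sum[OF S] mholomorphic_on_sum mholomorphic_on_mult P partial_mholomorphic_on S(1) g h)
      also have "\<dots> = (\<Sum>j\<in>I. \<Sum>m\<in>I. partial l (P j m) x * partial j g x * partial m h x
         + P j m x * partial m h x * partial l (partial j g) x
         + P j m x * partial j g x * partial l (partial m h) x)"
        by (intro sum.cong refl)
          (simp add: partial_mult[OF S] mholomorphic_on_mult P partial_mholomorphic_on S(1) g h algebra_simps)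
      also have "\<dots> = (\<Sum>j\<in>I. \<Sum>m\<in>I. partial l (P j m) x * partial j g x * partial m h x)
         + (\<Sum>j\<in>I. (\<Sum>m\<in>I. P j m x * partial m h x) * partial l (partial j g) x)
         + (\<Sum>j\<in>I. \<Sum>m\<in>I. P j m x * partial j g x * partial l (partial m h) x)"
        by (simp add: sum.distrib sum_distrib_right)
      also have "(\<Sum>j\<in>I. \<Sum>m\<in>I. P j m x * partial j g x * partial l (partial m h) x)
          = (\<Sum>m\<in>I. X g m * partial l (partial m h) x)"
        by (subst sum.swap) (simp add: X_def sum_distrib_right)
      also have "(\<Sum>j\<in>I. (\<Sum>m\<in>I. P j m x * partial m h x) * partial l (partial j g) x)
          = - (\<Sum>j\<in>I. X h j * partial l (partial j g) x)"
        by (simp add: X sum_negf[symmetric])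
      finally show ?thesis by simp
    qed
    have "bracket I P f (bracket I P g h) x = (\<Sum>l\<in>I. X f l * partial l (bracket I P g h) x)"
      unfolding bracket_def[of I P f] X_def by (subst sum.swap) (simp add: sum_distrib_right)
    also have "\<dots> = (\<Sum>l\<in>I. X f l * (\<Sum>j\<in>I. \<Sum>m\<in>I. partial l (P j m) x * partial j g x * partial m h x))
       - B f h g + B f g h"
      unfolding d B_def by (simp add: sum.distrib sum_subtractf distrib_left right_diff_distrib sum_distrib_left mult.assoc)
    also have "(\<Sum>l\<in>I. X f l * (\<Sum>j\<in>I. \<Sum>m\<in>I. partial l (P j m) x * partial j g x * partial m h x)) =
      (\<Sum>l\<in>I. \<Sum>i\<in>I. \<Sum>j\<in>I. \<Sum>m\<in>I. P i l x * partial l (P j m) x * (partial i f x * partial j g x * partial m h x))"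
      unfolding X_def by (simp only: sum_distrib_right) (simp add: sum_distrib_left mult_ac)
    also have "\<dots> = (\<Sum>i\<in>I. \<Sum>j\<in>I. \<Sum>l\<in>I. \<Sum>m\<in>I. P i l x * partial l (P j m) x * (partial i f x * partial j g x * partial m h x))"
      by (subst sum.swap) (intro sum.cong refl sum.swap)
    also have "\<dots> = T f g h"
      unfolding T_def by (intro sum.cong refl sum.swap)
    finally show ?thesis .
  qed
  have B: "B f g h = B g f h" if "mholomorphic_on S h" for f g h
    unfolding B_def by (subst sum.swap) (simp add: partial_commute[OF S(1) that S(2)] mult_ac)
  have T2: "T g h f = (\<Sum>i\<in>I. \<Sum>j\<in>I. \<Sum>m\<in>I. \<Sum>l\<in>I.
    P j l x * partial l (P m i) x * (partial i f x * partial j g x * partial m h x))" for f g h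
  proof -
    have "T g h f = (\<Sum>j\<in>I. \<Sum>m\<in>I. \<Sum>i\<in>I. \<Sum>l\<in>I.
      P j l x * partial l (P m i) x * (partial i f x * partial j g x * partial m h x))"
      unfolding T_def by (intro sum.cong refl) (simp add: mult_ac)
    also have "\<dots> = (\<Sum>j\<in>I. \<Sum>i\<in>I. \<Sum>m\<in>I. \<Sum>l\<in>I.
      P j l x * partial l (P m i) x * (partial i f x * partial j g x * partial m h x))"
      by (intro sum.cong refl sum.swap)
    finally show ?thesis by (subst (asm) sum.swap)
  qed
  have T3: "T h f g = (\<Sum>i\<in>I. \<Sum>j\<in>I. \<Sum>m\<in>I. \<Sum>l\<in>I.
    P m l x * partial l (P i j) x * (partial i f x * partial j g x * partial m h x))" for f g h
  proof -
    have "T h f g = (\<Sum>m\<in>I. \<Sum>i\<in>I. \<Sum>j\<in>I. \<Sum>l\<in>I.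
      P m l x * partial l (P i j) x * (partial i f x * partial j g x * partial m h x))"
      unfolding T_def by (intro sum.cong refl) (simp add: mult_ac)
    also have "\<dots> = (\<Sum>i\<in>I. \<Sum>m\<in>I. \<Sum>j\<in>I. \<Sum>l\<in>I.
      P m l x * partial l (P i j) x * (partial i f x * partial j g x * partial m h x))"
      by (rule sum.swap)
    also have "\<dots> = (\<Sum>i\<in>I. \<Sum>j\<in>I. \<Sum>m\<in>I. \<Sum>l\<in>I.
      P m l x * partial l (P i j) x * (partial i f x * partial j g x * partial m h x))"
      by (intro sum.cong refl sum.swap)
    finally show ?thesis .
  qed
  have "T f g h + T g h f + T h f g = (\<Sum>i\<in>I. \<Sum>j\<in>I. \<Sum>m\<in>I.
    (\<Sum>l\<in>I. P i l x * partial l (P j m) x + P j l x * partial l (P m i) x + P m l x * partial l (P i j) x)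
      * (partial i f x * partial j g x * partial m h x))"
    unfolding T2[where f=f and g=g and h=h] T3[where f=f and g=g and h=h] unfolding T_def
    by (simp add: sum.distrib sum_distrib_right distrib_right)
  also have "\<dots> = 0" by (simp add: jac)
  finally show ?thesis
    unfolding main[OF f g h] main[OF g h f] main[OF h f g]
    using B[OF f, of g h] B[OF g, of f h] B[OF h, of f g] by (simp add: algebra_simps)
qed

lemma poisson_onI:
  fixes P :: "'n::finite \<Rightarrow> 'n \<Rightarrow> complex^'n \<Rightarrow> complex"
  assumes U: "openin (top_of_set (cspace I)) U"
    and P: "\<And>i j. i \<in> I \<Longrightarrow> j \<in> I \<Longrightarrow> mholomorphic_on U (P i j)"
    and anti: "\<And>i j x. x \<in> U \<Longrightarrow> i \<in> I \<Longrightarrow> j \<in> I \<Longrightarrow> P i j x = - P j i x"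
    and jac: "\<And>i j m x. x \<in> U \<Longrightarrow> i \<in> I \<Longrightarrow> j \<in> I \<Longrightarrow> m \<in> I \<Longrightarrow>
      (\<Sum>l\<in>I. P i l x * partial l (P j m) x + P j l x * partial l (P m i) x + P m l x * partial l (P i j) x) = 0"
  shows "poisson_on I U P"
  unfolding poisson_on_def
proof (intro conjI ballI allI impI)
  fix f g h x assume f: "mholomorphic_on U f" and g: "mholomorphic_on U g" and h: "mholomorphic_on U h"
    and x: "x \<in> U"
  let ?S = "{x. cproj I x \<in> U}"
  have cx: "cproj I x = x" using openin_subset_cspace[OF U x] by (rule cproj_cspace)
  let ?P = "\<lambda>i j. P i j \<circ> cproj I" and ?f = "f \<circ> cproj I" and ?g = "g \<circ> cproj I" and ?h = "h \<circ> cproj I"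
  have br: "bracket I P f (bracket I P g h) x = bracket I ?P (f \<circ> cproj I) (bracket I ?P (g \<circ> cproj I) (h \<circ> cproj I)) x" for f g h
    using bracket_cproj[of I P f "bracket I P g h" x] bracket_cproj[of I P g h]
    by (simp add: cx comp_def)
  have "bracket I ?P ?f (bracket I ?P ?g ?h) x + bracket I ?P ?g (bracket I ?P ?h ?f) x
              + bracket I ?P ?h (bracket I ?P ?f ?g) x = 0"
  proof (rule jacobi_open[OF open_cproj_vimage[OF U]])
    show "(\<Sum>l\<in>I. ?P i l x * partial l (?P j m) x + ?P j l x * partial l (?P m i) x + ?P m l x * partial l (?P i j) x) = 0"
      if "i \<in> I" "j \<in> I" "m \<in> I" for i j m
      using jac[OF x that] by (simp add: partial_cproj cx cong: sum.cong)
    show "x \<in> {x. cproj I x \<in> U}" using x cx by simp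
    show "mholomorphic_on {x. cproj I x \<in> U} (?P i j)" if "i \<in> I" "j \<in> I" for i j
      by (rule mholomorphic_on_cproj[OF P[OF that]])
    show "?P i j x = - ?P j i x" if "i \<in> I" "j \<in> I" for i j
      using anti[OF x that] by (simp only: comp_def cx)
  qed (intro mholomorphic_on_cproj f g h)+
  then show "bracket I P f (bracket I P g h) x + bracket I P g (bracket I P h f) x
              + bracket I P h (bracket I P f g) x = 0"
    by (simp only: br)
next
  fix f g x assume "x \<in> U"
  then show "bracket I P f g x = - bracket I P g f x" by (intro bracket_antisym anti)
qed (rule P)


section \<open>Brackets of composites and local isomorphisms\<close>

lemma bracket_swap_sum:
  "bracket I P f g x = (\<Sum>j\<in>I. (\<Sum>i\<in>I. P i j x * partial i f x) * partial j g x)"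
  unfolding bracket_def by (subst sum.swap) (simp add: sum_distrib_right)

lemma bracket_sum_left:
  "bracket I P f g x = (\<Sum>i\<in>I. partial i f x * (\<Sum>j\<in>I. P i j x * partial j g x))"
  unfolding bracket_def by (simp add: sum_distrib_left mult_ac)

lemma bracket_compose_right:
  assumes "open S" "open W" "x \<in> S" "\<And>i. mholomorphic_on S (\<lambda>x. \<phi> x $ i)" "\<phi> ` S \<subseteq> W"
    and "mholomorphic_on W g"
  shows "bracket UNIV P f (g \<circ> \<phi>) x =
    (\<Sum>a\<in>UNIV. bracket UNIV P f (\<lambda>x. \<phi> x $ a) x * partial a g (\<phi> x))"
proof -
  let ?X = "\<lambda>j. \<Sum>i\<in>UNIV. P i j x * partial i f x"
  have "bracket UNIV P f (g \<circ> \<phi>) x =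
    (\<Sum>j\<in>UNIV. \<Sum>a\<in>UNIV. ?X j * (partial a g (\<phi> x) * partial j (\<lambda>x. \<phi> x $ a) x))"
    by (simp only: bracket_swap_sum partial_compose[OF assms] sum_distrib_left)
  also have "\<dots> = (\<Sum>a\<in>UNIV. \<Sum>j\<in>UNIV. ?X j * (partial a g (\<phi> x) * partial j (\<lambda>x. \<phi> x $ a) x))"
    by (rule sum.swap)
  also have "\<dots> = (\<Sum>a\<in>UNIV. (\<Sum>j\<in>UNIV. ?X j * partial j (\<lambda>x. \<phi> x $ a) x) * partial a g (\<phi> x))"
    by (simp only: sum_distrib_right mult.assoc mult.commute[of "partial _ (\<lambda>x. \<phi> x $ _) x"])
  finally show ?thesis by (simp only: bracket_swap_sum)
qed

lemma bracket_compose_left: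
  assumes "open S" "open W" "x \<in> S" "\<And>i. mholomorphic_on S (\<lambda>x. \<phi> x $ i)" "\<phi> ` S \<subseteq> W"
    and "mholomorphic_on W f"
  shows "bracket UNIV P (f \<circ> \<phi>) g x =
    (\<Sum>a\<in>UNIV. partial a f (\<phi> x) * bracket UNIV P (\<lambda>x. \<phi> x $ a) g x)"
proof -
  let ?X = "\<lambda>i. \<Sum>j\<in>UNIV. P i j x * partial j g x"
  have "bracket UNIV P (f \<circ> \<phi>) g x =
    (\<Sum>j\<in>UNIV. \<Sum>a\<in>UNIV. partial a f (\<phi> x) * partial j (\<lambda>x. \<phi> x $ a) x * ?X j)"
    by (simp only: bracket_sum_left partial_compose[OF assms] sum_distrib_right)
  also have "\<dots> = (\<Sum>a\<in>UNIV. \<Sum>j\<in>UNIV. partial a f (\<phi> x) * partial j (\<lambda>x. \<phi> x $ a) x * ?X j)"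
    by (rule sum.swap)
  also have "\<dots> = (\<Sum>a\<in>UNIV. partial a f (\<phi> x) * (\<Sum>j\<in>UNIV. partial j (\<lambda>x. \<phi> x $ a) x * ?X j))"
    by (simp only: sum_distrib_left mult.assoc)
  finally show ?thesis by (simp only: bracket_sum_left)
qed

lemma bracket_compose:
  assumes "open S" "open W" "x \<in> S" "\<And>i. mholomorphic_on S (\<lambda>x. \<phi> x $ i)" "\<phi> ` S \<subseteq> W"
    and "mholomorphic_on W f" "mholomorphic_on W g"
  shows "bracket UNIV P (f \<circ> \<phi>) (g \<circ> \<phi>) x =
    (\<Sum>a\<in>UNIV. \<Sum>b\<in>UNIV. bracket UNIV P (\<lambda>x. \<phi> x $ a) (\<lambda>x. \<phi> x $ b) x
      * partial a f (\<phi> x) * partial b g (\<phi> x))"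
  by (subst bracket_compose_left[OF assms(1-6)], subst bracket_compose_right[OF assms(1-5,7)])
    (simp add: sum_distrib_left mult_ac)

text \<open>Independence of the differentials of the components means that the transposed Jacobian
  matrix has trivial kernel, so the matrix is invertible and the real inverse function theorem
  applies. The derivative of the inverse map inverts a complex linear bijection and is therefore
  complex linear itself.\<close>

lemma holomorphic_local_inverse:
  fixes \<phi> :: "complex^'n::finite \<Rightarrow> complex^'n"
  assumes S: "open S" "p \<in> S" and \<phi>: "\<And>j. mholomorphic_on S (\<lambda>x. \<phi> x $ j)"
    and indep: "\<And>\<alpha> :: 'n \<Rightarrow> complex. \<forall>i. (\<Sum>j\<in>UNIV. \<alpha> j * partial i (\<lambda>x. \<phi> x $ j) p) = 0 \<Longrightarrow> \<forall>j. \<alpha> j = 0"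
  obtains U V \<psi> where "open U" "U \<subseteq> S" "p \<in> U" "open V" "\<phi> ` U = V" "\<psi> ` V = U"
    "\<And>x. x \<in> U \<Longrightarrow> \<psi> (\<phi> x) = x" "\<And>y. y \<in> V \<Longrightarrow> \<phi> (\<psi> y) = y"
    "\<And>i. mholomorphic_on V (\<lambda>y. \<psi> y $ i)"
proof -
  define J where "J = (\<lambda>x. \<chi> j i. partial i (\<lambda>x. \<phi> x $ j) x)"
  have J: "(\<chi> j. \<Sum>i\<in>UNIV. v $ i * partial i (\<lambda>x. \<phi> x $ j) x) = J x *v v" for x v
    by (simp add: J_def matrix_vector_mult_def vec_eq_iff mult.commute)
  have bl: "bounded_linear ((*v) (J x))" for x
    by (rule matrix_vector_mul_bounded_linear)
  define D where "D = (\<lambda>x. Blinfun ((*v) (J x)))"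
  have D: "blinfun_apply (D x) = (*v) (J x)" for x
    unfolding D_def by (rule bounded_linear_Blinfun_apply[OF bl])
  have der: "(\<phi> has_derivative blinfun_apply (D x)) (at x)" if "x \<in> S" for x
    unfolding D J[symmetric] by (rule has_derivative_vec) (simp add: mholomorphic_on_has_derivative[OF S(1) that \<phi>])
  have cont: "continuous_on S D"
  proof (rule continuous_on_blinfun_componentwise)
    fix v :: "complex^'n"
    have "continuous_on S (\<lambda>x. \<chi> j. \<Sum>i\<in>UNIV. v $ i * partial i (\<lambda>x. \<phi> x $ j) x)"
      by (intro continuous_on_vec_lambda continuous_intros partial_continuous_on S \<phi>)
    then show "continuous_on S (\<lambda>x. blinfun_apply (D x) v)" unfolding D J .
  qed
  have "\<exists>B. B ** transpose (J p) = mat 1"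
    unfolding matrix_left_invertible_ker
  proof (intro allI impI)
    fix \<alpha> assume "transpose (J p) *v \<alpha> = 0"
    then have "(\<Sum>j\<in>UNIV. \<alpha> $ j * partial i (\<lambda>x. \<phi> x $ j) p) = 0" for i
      by (simp add: J_def matrix_vector_mult_def vec_eq_iff transpose_def mult.commute)
    with indep[of "\<lambda>j. \<alpha> $ j"] show "\<alpha> = 0" by (simp add: vec_eq_iff)
  qed
  then obtain B where "B ** J p = mat 1"
    using left_invertible_transpose matrix_left_right_inverse by metis
  then have BJ: "B *v (J p *v v) = v" for v
    by (metis matrix_vector_mul_assoc matrix_vector_mul_lid)
  define E where "E = Blinfun ((*v) B)"
  have E: "blinfun_apply E = (*v) B"
    unfolding E_def by (rule bounded_linear_Blinfun_apply[OF matrix_vector_mul_bounded_linear])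
  have inv: "E o\<^sub>L D p = id_blinfun"
    by (rule blinfun_eqI) (simp add: E D BJ)
  obtain U V \<psi> \<psi>' where U: "open U" "U \<subseteq> S" "p \<in> U" "open V" "\<phi> p \<in> V" "homeomorphism U V \<phi> \<psi>"
    and \<psi>: "\<And>y. y \<in> V \<Longrightarrow> (\<psi> has_derivative \<psi>' y) (at y)"
    "\<And>y. y \<in> V \<Longrightarrow> \<psi>' y = inv (blinfun_apply (D (\<psi> y)))"
    "\<And>y. y \<in> V \<Longrightarrow> bij (blinfun_apply (D (\<psi> y)))"
    using inverse_function_theorem[OF S(1) der cont S(2) inv] by blast
  have "mholomorphic_on V (\<lambda>y. \<psi> y $ i)" for i
    unfolding mholomorphic_on_def
  proof (intro ballI exI conjI allI)
    fix y assume y: "y \<in> V"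
    show "((\<lambda>y. \<psi> y $ i) has_derivative (\<lambda>v. \<psi>' y v $ i)) (at y within V)"
      by (rule bounded_linear.has_derivative[OF bounded_linear_vec_nth has_derivative_at_withinI[OF \<psi>(1)[OF y]]])
    fix c v
    have b: "bij ((*v) (J (\<psi> y)))" using \<psi>(3)[OF y] by (simp add: D)
    have JJ: "J (\<psi> y) *v \<psi>' y w = w" for w
      unfolding \<psi>(2)[OF y] D by (rule surj_f_inv_f[OF bij_is_surj[OF b]])
    have "J (\<psi> y) *v (c *s \<psi>' y v) = c *s v"
      by (simp add: vector_scalar_commute JJ)
    moreover have "J (\<psi> y) *v \<psi>' y (c *s v) = c *s v"
      by (rule JJ)
    ultimately have "\<psi>' y (c *s v) = c *s \<psi>' y v"
      using bij_is_inj[OF b] by (metis injD)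
    then show "\<psi>' y (c *s v) $ i = c * \<psi>' y v $ i" by simp
  qed
  with U show ?thesis
    by (intro that[of U V \<psi>]) (auto simp: homeomorphism_def)
qed

text \<open>By the chain rule the bracket of \<open>f \<circ> \<phi>\<close> and
  \<open>g \<circ> \<phi>\<close> is determined by the brackets of the components of
  \<open>\<phi>\<close>, so only these have to be compared with the target.\<close>

lemma isomorphic_nearI:
  fixes M N :: "'n::finite bistructure"
  assumes M: "coords M = UNIV" and N: "coords N = UNIV" "region N = UNIV"
    and S: "open S" "S \<subseteq> region M" "p \<in> S" and \<phi>: "\<And>j. mholomorphic_on S (\<lambda>x. \<phi> x $ j)"
    and indep: "\<And>\<alpha> :: 'n \<Rightarrow> complex. \<forall>i. (\<Sum>j\<in>UNIV. \<alpha> j * partial i (\<lambda>x. \<phi> x $ j) p) = 0 \<Longrightarrow> \<forall>j. \<alpha> j = 0"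
    and b1: "\<And>x i j. x \<in> S \<Longrightarrow> bracket UNIV (brack1 M) (\<lambda>x. \<phi> x $ i) (\<lambda>x. \<phi> x $ j) x = brack1 N i j (\<phi> x)"
    and b2: "\<And>x i j. x \<in> S \<Longrightarrow> bracket UNIV (brack2 M) (\<lambda>x. \<phi> x $ i) (\<lambda>x. \<phi> x $ j) x = brack2 N i j (\<phi> x)"
  shows "isomorphic_near p M N"
proof -
  obtain U V \<psi> where U: "open U" "U \<subseteq> S" "p \<in> U" "open V" "\<phi> ` U = V" "\<psi> ` V = U"
    "\<And>x. x \<in> U \<Longrightarrow> \<psi> (\<phi> x) = x" "\<And>y. y \<in> V \<Longrightarrow> \<phi> (\<psi> y) = y"
    "\<And>i. mholomorphic_on V (\<lambda>y. \<psi> y $ i)"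
    using holomorphic_local_inverse[OF S(1,3) \<phi> indep] by blast
  have \<phi>U: "mholomorphic_on U (\<lambda>x. \<phi> x $ j)" for j
    by (rule mholomorphic_on_subset[OF \<phi> U(2)])
  have reg: "region M \<inter> U = U" using U(2) S(2) by auto
  have "biholomorphic U V \<phi>"
    unfolding biholomorphic_def using U \<phi>U by blast
  moreover have "preserves_brackets (restrict_bi U M) (restrict_bi V N) \<phi>"
    unfolding preserves_brackets_def
  proof (intro allI impI ballI conjI)
    fix f g x assume fg: "mholomorphic_on (region (restrict_bi V N)) f" "mholomorphic_on (region (restrict_bi V N)) g"
      and "x \<in> region (restrict_bi U M)"
    then have x: "x \<in> U" "x \<in> S" and fg: "mholomorphic_on V f" "mholomorphic_on V g"
      using U(2) by (auto simp: restrict_bi_def N)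
    note c = bracket_compose[OF U(1,4) x(1) \<phi>U _ fg]
    show "bracket (coords (restrict_bi U M)) (brack1 (restrict_bi U M)) (f \<circ> \<phi>) (g \<circ> \<phi>) x =
      bracket (coords (restrict_bi V N)) (brack1 (restrict_bi V N)) f g (\<phi> x)"
      using c[of "brack1 M"] U(5) by (simp add: restrict_bi_def M N b1[OF x(2)] bracket_def[of _ "brack1 N"])
    show "bracket (coords (restrict_bi U M)) (brack2 (restrict_bi U M)) (f \<circ> \<phi>) (g \<circ> \<phi>) x =
      bracket (coords (restrict_bi V N)) (brack2 (restrict_bi V N)) f g (\<phi> x)"
      using c[of "brack2 M"] U(5) by (simp add: restrict_bi_def M N b2[OF x(2)] bracket_def[of _ "brack2 N"])
  qed
  ultimately have "isomorphism_bi (restrict_bi U M) (restrict_bi V N) \<phi>"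
    unfolding isomorphism_bi_def using reg by (simp add: restrict_bi_def N)
  then show ?thesis
    unfolding isomorphic_near_def
    using U S N reg by (intro exI[of _ U] exI[of _ V] exI[of _ \<phi>]) (auto simp: openin_open)
qed

section \<open>The flat structures and their indecomposability\<close>

definition flat1 :: "nat \<Rightarrow> nat \<Rightarrow> complex" where
  "flat1 a b = (if even a \<and> b = a + 1 then 1 else if even b \<and> a = b + 1 then -1 else 0)"

definition flat2 :: "nat \<Rightarrow> nat \<Rightarrow> complex" where
  "flat2 a b = (if odd a \<and> b = a + 1 then 1 else if odd b \<and> a = b + 1 then -1 else 0)"

lemma flat1_antisym: "flat1 a b = - flat1 b a"
  by (auto simp: flat1_def)

lemma flat2_antisym: "flat2 a b = - flat2 b a"
  by (auto simp: flat2_def)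

lemma sum_flat1_odd: "odd b \<Longrightarrow> b < n \<Longrightarrow> (\<Sum>a<n. x a * flat1 a b) = x (b - 1)"
proof -
  assume b: "odd b" "b < n"
  have "(\<Sum>a<n. x a * flat1 a b) = (\<Sum>a<n. if a = b - 1 then x a else 0)"
    using b by (intro sum.cong) (auto simp: flat1_def elim!: oddE)
  then show ?thesis using b by simp
qed

lemma sum_flat1_even: "even b \<Longrightarrow> b < n \<Longrightarrow> (\<Sum>a<n. x a * flat1 a b) = (if b + 1 < n then - x (b + 1) else 0)"
proof -
  assume b: "even b" "b < n"
  have "(\<Sum>a<n. x a * flat1 a b) = (\<Sum>a<n. if a = b + 1 then - x a else 0)"
    using b by (intro sum.cong) (auto simp: flat1_def)
  then show ?thesis using b by simp
qed

lemma sum_flat2_odd: "odd b \<Longrightarrow> b < n \<Longrightarrow> (\<Sum>a<n. x a * flat2 a b) = (if b + 1 < n then - x (b + 1) else 0)"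
proof -
  assume b: "odd b" "b < n"
  have "(\<Sum>a<n. x a * flat2 a b) = (\<Sum>a<n. if a = b + 1 then - x a else 0)"
    using b by (intro sum.cong) (auto simp: flat2_def)
  then show ?thesis using b by simp
qed

lemma sum_flat2_even: "even b \<Longrightarrow> b < n \<Longrightarrow> (\<Sum>a<n. x a * flat2 a b) = (if b = 0 then 0 else x (b - 1))"
proof -
  assume b: "even b" "b < n"
  have "(\<Sum>a<n. x a * flat2 a b) = (\<Sum>a<n. if b \<noteq> 0 \<and> a = b - 1 then x a else 0)"
    using b by (intro sum.cong) (auto simp: flat2_def)
  also have "\<dots> = (if b = 0 then 0 else x (b - 1))" using b by auto
  finally show ?thesis .
qed

text \<open>The covector \<open>(1, 0, c, 0, c^2, ...)\<close>: the differential of the Casimir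
  function of \<open>flat2 + c * flat1\<close>.\<close>

definition flat_kernel :: "complex \<Rightarrow> nat \<Rightarrow> complex" where
  "flat_kernel c a = (if even a then c ^ (a div 2) else 0)"

lemma flat_kernel_annihilates:
  assumes "n = 2 * m - 1" "b < n"
  shows "(\<Sum>a<n. flat_kernel c a * (flat2 a b + c * flat1 a b)) = 0"
proof -
  have "(\<Sum>a<n. flat_kernel c a * (flat2 a b + c * flat1 a b)) =
    (\<Sum>a<n. flat_kernel c a * flat2 a b) + c * (\<Sum>a<n. flat_kernel c a * flat1 a b)"
    by (simp add: sum.distrib sum_distrib_left algebra_simps)
  also have "\<dots> = 0"
  proof (cases "even b")
    case True
    then show ?thesis using assms by (simp add: sum_flat1_even sum_flat2_even flat_kernel_def)
  next
    case False
    then obtain l where l: "b = 2 * l + 1" by (auto elim: oddE)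
    then have "b + 1 < n" using assms by simp presburger
    then show ?thesis using False assms l by (simp add: sum_flat1_odd sum_flat2_odd flat_kernel_def)
  qed
  finally show ?thesis .
qed

text \<open>Columns with even index, starting with \<open>b = 0\<close> where dividing by
  \<open>c\<close> is the induction start, make the odd entries vanish one after the other; columns
  with odd index give the recursion from \<open>x (2 * l)\<close> to \<open>x (2 * l + 2)\<close>.
  Hence the kernel is a line.\<close>

lemma flat_kernel_unique:
  assumes n: "n = 2 * m - 1" and c: "c \<noteq> 0"
    and ker: "\<And>b. b < n \<Longrightarrow> (\<Sum>a<n. x a * (flat2 a b + c * flat1 a b)) = 0" and a: "a < n"
  shows "x a = x 0 * flat_kernel c a"
proof -
  have ker: "(\<Sum>a<n. x a * flat2 a b) + c * (\<Sum>a<n. x a * flat1 a b) = 0" if "b < n" for b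
    using ker[OF that] by (simp add: sum.distrib sum_distrib_left algebra_simps)
  have odd0: "x (2 * l + 1) = 0" if "2 * l + 1 < n" for l
    using that
  proof (induction l)
    case 0
    then show ?case using ker[of 0] c by (simp add: sum_flat1_even sum_flat2_even)
  next
    case (Suc l)
    then show ?case using ker[of "2 * Suc l"] c by (simp add: sum_flat1_even sum_flat2_even)
  qed
  have even0: "x (2 * l) = x 0 * c ^ l" if "2 * l < n" for l
    using that
  proof (induction l)
    case (Suc l)
    then show ?case using ker[of "2 * l + 1"] by (simp add: sum_flat1_odd sum_flat2_odd algebra_simps)
  qed simp
  show ?thesis
  proof (cases "even a")
    case True
    then show ?thesis using even0[of "a div 2"] a by (simp add: flat_kernel_def)
  next
    case False
    then show ?thesis using odd0[of "a div 2"] a by (simp add: flat_kernel_def)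
  qed
qed

text \<open>
  Linear algebra of the pencil in which \<open>J\<close> and \<open>K\<close> are inverse to each other: if the
  pencil were block diagonal in the basis \<open>J\<close>, then the kernel of every member would lie
  in one of the blocks, and by polynomial dependence on \<open>c\<close> the same block for all
  \<open>c\<close>; the other block would be contained in the span of these kernels.
\<close>

lemma flat_half_split_impossible:
  fixes J :: "'j \<Rightarrow> nat \<Rightarrow> complex" and K :: "nat \<Rightarrow> 'j \<Rightarrow> complex"
  assumes j: "j \<in> B"
    and KJ: "\<And>a b. a < n \<Longrightarrow> b < n \<Longrightarrow> (\<Sum>j\<in>A\<union>B. K b j * J j a) = (if a = b then 1 else 0)"
    and JK: "\<And>i j. i \<in> A \<union> B \<Longrightarrow> j \<in> A \<union> B \<Longrightarrow> (\<Sum>a<n. J i a * K a j) = (if i = j then 1 else 0)"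
    and block: "\<And>i j. i \<in> A \<Longrightarrow> j \<in> B \<Longrightarrow> (\<Sum>a<n. \<Sum>b<n. flat1 a b * J i a * J j b) = 0"
    and inf: "infinite C" and C: "\<And>c j'. c \<in> C \<Longrightarrow> j' \<in> B \<Longrightarrow> (\<Sum>a<n. flat_kernel c a * K a j') = 0"
  shows False
proof -
  have K0: "K a j = 0" if "even a" "a < n" "j \<in> B" for a j
  proof -
    \<comment> \<open>As a polynomial in \<open>c\<close> the vanishing sum has the numbers
      \<open>K a j\<close> with even \<open>a\<close> as coefficients; infinitely many roots make
      all of them zero.\<close>
    define p where "p = (\<Sum>a<n. if even a then monom (K a j) (a div 2) else 0)"
    have "poly p c = (\<Sum>a<n. flat_kernel c a * K a j)" for c
      unfolding p_def poly_sum flat_kernel_def by (intro sum.cong) (auto simp: poly_monom)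
    then have "C \<subseteq> {c. poly p c = 0}" using C that by auto
    then have "p = 0" using inf poly_roots_finite finite_subset by blast
    have "coeff p (a div 2) = (\<Sum>i<n. if i = a then K a j else 0)"
      unfolding p_def coeff_sum using that by (intro sum.cong) (auto elim!: evenE)
    with \<open>p = 0\<close> show ?thesis using that by simp
  qed
  \<comment> \<open>For even \<open>a\<close> the basis covector with index \<open>a\<close> is a
    combination of the rows \<open>J i\<close>, and by \<open>K0\<close> only rows with
    \<open>i\<close> in \<open>A\<close> occur. Its \<open>flat1\<close>-pairing with
    \<open>J j\<close> is therefore zero, and this pairing is the entry of \<open>J j\<close> at
    \<open>a + 1\<close>. So \<open>J j\<close> and \<open>K\<close> at \<open>j\<close> have
    disjoint supports.\<close>
  have J0: "J j (a + 1) = 0" if "even a" "a + 1 < n" for a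
  proof -
    have "J j (a + 1) = (\<Sum>b<n. flat1 a b * J j b)"
    proof -
      have "(\<Sum>b<n. flat1 a b * J j b) = - (\<Sum>b<n. J j b * flat1 b a)"
        by (subst flat1_antisym) (simp add: sum_negf mult.commute)
      then show ?thesis using that by (simp add: sum_flat1_even)
    qed
    also have "\<dots> = (\<Sum>a'<n. (if a' = a then 1 else 0) * (\<Sum>b<n. flat1 a' b * J j b))"
      using that by (simp add: if_distrib[of "\<lambda>u. u * _"] cong: if_cong)
    also have "\<dots> = (\<Sum>a'<n. (\<Sum>i\<in>A\<union>B. K a i * J i a') * (\<Sum>b<n. flat1 a' b * J j b))"
      using that by (intro sum.cong) (auto simp: KJ)
    also have "\<dots> = (\<Sum>a'<n. \<Sum>i\<in>A\<union>B. K a i * (\<Sum>b<n. flat1 a' b * J i a' * J j b))"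
      by (simp add: sum_distrib_right sum_distrib_left mult_ac)
    also have "\<dots> = (\<Sum>i\<in>A\<union>B. K a i * (\<Sum>a'<n. \<Sum>b<n. flat1 a' b * J i a' * J j b))"
      by (subst sum.swap) (simp add: sum_distrib_left)
    also have "\<dots> = (\<Sum>i\<in>A\<union>B. 0)"
      using that K0 block[OF _ j] by (intro sum.cong) auto
    finally show ?thesis by simp
  qed
  have "J j a * K a j = 0" if "a < n" for a
  proof (cases "even a")
    case True
    then show ?thesis using K0[OF _ that j] by simp
  next
    case False
    then show ?thesis using J0[of "a - 1"] that by (auto elim!: oddE)
  qed
  then have "(\<Sum>a<n. J j a * K a j) = 0" by (intro sum.neutral) auto
  with JK[of j j] j show False by simp
qed

lemma flat_split_impossible:
  fixes J :: "'j \<Rightarrow> nat \<Rightarrow> complex" and K :: "nat \<Rightarrow> 'j \<Rightarrow> complex"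
  assumes n: "n = 2 * m - 1" and fin: "finite A" "finite B" and AB: "A \<inter> B = {}" "A \<noteq> {}" "B \<noteq> {}"
    and KJ: "\<And>a b. a < n \<Longrightarrow> b < n \<Longrightarrow> (\<Sum>j\<in>A\<union>B. K b j * J j a) = (if a = b then 1 else 0)"
    and JK: "\<And>i j. i \<in> A \<union> B \<Longrightarrow> j \<in> A \<union> B \<Longrightarrow> (\<Sum>a<n. J i a * K a j) = (if i = j then 1 else 0)"
    and block1: "\<And>i j. i \<in> A \<Longrightarrow> j \<in> B \<Longrightarrow> (\<Sum>a<n. \<Sum>b<n. flat1 a b * J i a * J j b) = 0"
    and block2: "\<And>i j. i \<in> A \<Longrightarrow> j \<in> B \<Longrightarrow> (\<Sum>a<n. \<Sum>b<n. flat2 a b * J i a * J j b) = 0"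
  shows False
proof -
  define t where "t = (\<lambda>c j. \<Sum>a<n. flat_kernel c a * K a j)"
  have dichotomy: "(\<forall>j\<in>A. t c j = 0) \<or> (\<forall>j\<in>B. t c j = 0)" if c: "c \<noteq> 0" for c
  proof -
    define q where "q = (\<lambda>a b. flat2 a b + c * flat1 a b)"
    \<comment> \<open>\<open>\<xi> A\<close> and \<open>\<xi> B\<close> are the components of the
      kernel covector in the two blocks. Block diagonality puts each of them into the kernel, which
      is a line, so \<open>\<xi> A\<close> is a multiple of their sum. In block coordinates
      \<open>t\<close> this forces one of the two parts of \<open>t\<close> to vanish.\<close>
    define \<xi> where "\<xi> = (\<lambda>A a. \<Sum>j\<in>A. t c j * J j a)"
    have \<xi>_sum: "\<xi> A a + \<xi> B a = flat_kernel c a" if "a < n" for a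
    proof -
      have "\<xi> A a + \<xi> B a = (\<Sum>j\<in>A\<union>B. t c j * J j a)"
        unfolding \<xi>_def using fin AB by (simp add: sum.union_disjoint)
      also have "\<dots> = (\<Sum>j\<in>A\<union>B. \<Sum>b<n. flat_kernel c b * (K b j * J j a))"
        by (simp add: t_def sum_distrib_right mult.assoc)
      also have "\<dots> = (\<Sum>b<n. flat_kernel c b * (\<Sum>j\<in>A\<union>B. K b j * J j a))"
        by (subst sum.swap) (simp add: sum_distrib_left)
      also have "\<dots> = (\<Sum>b<n. if a = b then flat_kernel c b else 0)"
        using that by (intro sum.cong) (auto simp: KJ)
      finally show ?thesis using that by simp
    qed
    have block: "(\<Sum>a<n. \<Sum>b<n. q a b * J i a * J j b) = 0" if "i \<in> A" "j \<in> B" for i j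
    proof -
      have "(\<Sum>a<n. \<Sum>b<n. q a b * J i a * J j b) = (\<Sum>a<n. \<Sum>b<n. flat2 a b * J i a * J j b)
        + c * (\<Sum>a<n. \<Sum>b<n. flat1 a b * J i a * J j b)"
        by (simp add: q_def sum.distrib sum_distrib_left algebra_simps)
      with block1[OF that] block2[OF that] show ?thesis by simp
    qed
    have block': "(\<Sum>a<n. \<Sum>b<n. q a b * J i a * J j b) = 0" if "j \<in> A" "i \<in> B" for i j
    proof -
      have q: "q a b = - q b a" for a b
        unfolding q_def by (subst flat1_antisym, subst flat2_antisym) simp
      have "(\<Sum>a<n. \<Sum>b<n. q a b * J i a * J j b) = (\<Sum>b<n. \<Sum>a<n. q a b * J i a * J j b)"
        by (rule sum.swap)
      also have "\<dots> = - (\<Sum>b<n. \<Sum>a<n. q b a * J j b * J i a)"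
        by (subst q) (simp add: sum_negf mult_ac)
      finally show ?thesis using block[OF that] by simp
    qed
    have W: "(\<Sum>b<n. (\<Sum>a<n. \<xi> X a * q a b) * J i b) = (\<Sum>j\<in>X. t c j * (\<Sum>a<n. \<Sum>b<n. q a b * J j a * J i b))" for X i
    proof -
      have "(\<Sum>b<n. (\<Sum>a<n. \<xi> X a * q a b) * J i b) = (\<Sum>a<n. \<Sum>b<n. \<xi> X a * q a b * J i b)"
        by (subst sum.swap) (simp add: sum_distrib_right)
      also have "\<dots> = (\<Sum>a<n. \<Sum>b<n. \<Sum>j\<in>X. t c j * (q a b * J j a * J i b))"
        by (simp add: \<xi>_def sum_distrib_right sum_distrib_left mult_ac)
      also have "\<dots> = (\<Sum>a<n. \<Sum>j\<in>X. \<Sum>b<n. t c j * (q a b * J j a * J i b))"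
        by (intro sum.cong refl sum.swap)
      also have "\<dots> = (\<Sum>j\<in>X. \<Sum>a<n. \<Sum>b<n. t c j * (q a b * J j a * J i b))"
        by (rule sum.swap)
      finally show ?thesis by (simp add: sum_distrib_left)
    qed
    have W0: "(\<Sum>b<n. (\<Sum>a<n. \<xi> A a * q a b) * J i b) = 0" if "i \<in> A \<union> B" for i
    proof (cases "i \<in> B")
      case True
      then show ?thesis unfolding W by (simp add: block)
    next
      case False
      then have i: "i \<in> A" using that by simp
      have "(\<Sum>a<n. \<xi> A a * q a b) = - (\<Sum>a<n. \<xi> B a * q a b)" if "b < n" for b
      proof -
        have "(\<Sum>a<n. \<xi> A a * q a b) + (\<Sum>a<n. \<xi> B a * q a b) = (\<Sum>a<n. flat_kernel c a * q a b)"
          unfolding sum.distrib[symmetric] by (intro sum.cong) (auto simp: \<xi>_sum[symmetric] algebra_simps)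
        also have "\<dots> = 0" unfolding q_def by (rule flat_kernel_annihilates[OF n that])
        finally show ?thesis by (simp add: eq_neg_iff_add_eq_0)
      qed
      then have "(\<Sum>b<n. (\<Sum>a<n. \<xi> A a * q a b) * J i b) = (\<Sum>b<n. - (\<Sum>a<n. \<xi> B a * q a b) * J i b)"
        by (intro sum.cong) auto
      also have "\<dots> = 0" using W[of B i] block'[OF i] by (simp add: sum_negf)
      finally show ?thesis .
    qed
    have w0: "(\<Sum>a<n. \<xi> A a * q a b) = 0" if "b < n" for b
    proof -
      have "(\<Sum>a<n. \<xi> A a * q a b) = (\<Sum>b'<n. (\<Sum>a<n. \<xi> A a * q a b') * (if b' = b then 1 else 0))"
        using that by (simp add: if_distrib[of "\<lambda>u. _ * u"] cong: if_cong)
      also have "\<dots> = (\<Sum>b'<n. (\<Sum>a<n. \<xi> A a * q a b') * (\<Sum>j\<in>A\<union>B. K b j * J j b'))"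
        using that by (intro sum.cong) (auto simp: KJ)
      also have "\<dots> = (\<Sum>b'<n. \<Sum>j\<in>A\<union>B. K b j * ((\<Sum>a<n. \<xi> A a * q a b') * J j b'))"
        by (simp only: sum_distrib_left mult.left_commute)
      also have "\<dots> = (\<Sum>j\<in>A\<union>B. K b j * (\<Sum>b'<n. (\<Sum>a<n. \<xi> A a * q a b') * J j b'))"
        by (subst sum.swap) (simp only: sum_distrib_left)
      finally show ?thesis by (simp add: W0)
    qed
    have \<xi>A: "\<xi> A a = \<xi> A 0 * flat_kernel c a" if "a < n" for a
      using flat_kernel_unique[OF n c _ that, of "\<xi> A"] w0 unfolding q_def by blast
    have \<tau>: "(if j \<in> A then t c j else 0) = \<xi> A 0 * t c j" if "j \<in> A \<union> B" for j
    proof -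
      have "\<xi> A 0 * t c j = (\<Sum>a<n. \<xi> A a * K a j)"
        unfolding t_def sum_distrib_left
      proof (intro sum.cong refl)
        fix a assume "a \<in> {..<n}"
        then have "\<xi> A a = \<xi> A 0 * flat_kernel c a" by (intro \<xi>A) simp
        then show "\<xi> A 0 * (flat_kernel c a * K a j) = \<xi> A a * K a j" by (simp only: mult.assoc)
      qed
      also have "\<dots> = (\<Sum>a<n. \<Sum>i\<in>A. t c i * (J i a * K a j))"
        by (simp add: \<xi>_def sum_distrib_right mult.assoc)
      also have "\<dots> = (\<Sum>i\<in>A. t c i * (\<Sum>a<n. J i a * K a j))"
        by (subst sum.swap) (simp add: sum_distrib_left)
      also have "\<dots> = (\<Sum>i\<in>A. if i = j then t c i else 0)"
        using that by (intro sum.cong) (auto simp: JK)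
      finally show ?thesis using fin by simp
    qed
    show ?thesis
    proof (cases "\<xi> A 0 = 0")
      case True
      then show ?thesis using \<tau> by (intro disjI1) force
    next
      case False
      have "t c j = 0" if "j \<in> B" for j
      proof -
        have "j \<notin> A" using that AB(1) by blast
        then show ?thesis using \<tau>[of j] that False by simp
      qed
      then show ?thesis by blast
    qed
  qed
  \<comment> \<open>Which alternative holds may depend on \<open>c\<close>, but one of them holds
    for infinitely many \<open>c\<close>, which is enough for the polynomial argument. The two cases
    differ by exchanging \<open>A\<close> and \<open>B\<close>.\<close>
  have "infinite (UNIV - {0::complex})" by (simp add: infinite_UNIV_char_0)
  moreover have "UNIV - {0::complex} = {c. c \<noteq> 0 \<and> (\<forall>j\<in>A. t c j = 0)} \<union> {c. c \<noteq> 0 \<and> (\<forall>j\<in>B. t c j = 0)}"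
    using dichotomy by blast
  ultimately have "infinite ({c. c \<noteq> 0 \<and> (\<forall>j\<in>A. t c j = 0)} \<union> {c. c \<noteq> 0 \<and> (\<forall>j\<in>B. t c j = 0)})"
    by simp
  then consider "infinite {c. c \<noteq> 0 \<and> (\<forall>j\<in>A. t c j = 0)}" | "infinite {c. c \<noteq> 0 \<and> (\<forall>j\<in>B. t c j = 0)}"
    unfolding finite_Un by blast
  then show False
  proof cases
    case 1
    obtain j where j: "j \<in> A" using AB by blast
    have "(\<Sum>a<n. \<Sum>b<n. flat1 a b * J i a * J j b) = 0" if "i \<in> B" "j \<in> A" for i j
    proof -
      have "(\<Sum>a<n. \<Sum>b<n. flat1 a b * J i a * J j b) = (\<Sum>b<n. \<Sum>a<n. flat1 a b * J i a * J j b)"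
        by (rule sum.swap)
      also have "\<dots> = - (\<Sum>b<n. \<Sum>a<n. flat1 b a * J j b * J i a)"
        by (subst flat1_antisym) (simp add: sum_negf mult_ac)
      finally show ?thesis using block1[OF that(2,1)] by simp
    qed
    note block = this
    show False
    proof (rule flat_half_split_impossible[OF j _ _ block 1])
      show "(\<Sum>j\<in>B\<union>A. K b j * J j a) = (if a = b then 1 else 0)" if "a < n" "b < n" for a b
        unfolding Un_commute[of B A] by (rule KJ[OF that])
      show "(\<Sum>a<n. J i a * K a j) = (if i = j then 1 else 0)" if "i \<in> B \<union> A" "j \<in> B \<union> A" for i j
        using that by (intro JK) blast+
    qed (use t_def in auto)
  next
    case 2
    obtain j where j: "j \<in> B" using AB by blast
    show False
      using flat_half_split_impossible[OF j KJ JK block1 2] j unfolding t_def by simp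
  qed
qed


section \<open>The constant structures, and indecomposability as a statement at one point\<close>

definition flat_bi :: "'n::finite set \<Rightarrow> ('n \<Rightarrow> nat) \<Rightarrow> 'n bistructure" where
  "flat_bi I pos = \<lparr>coords = I, region = cspace I,
     brack1 = (\<lambda>i j x. flat1 (pos i) (pos j)), brack2 = (\<lambda>i j x. flat2 (pos i) (pos j))\<rparr>"

lemma flat_bi_simps [simp]:
  "coords (flat_bi I pos) = I" "region (flat_bi I pos) = cspace I"
  "brack1 (flat_bi I pos) = (\<lambda>i j x. flat1 (pos i) (pos j))"
  "brack2 (flat_bi I pos) = (\<lambda>i j x. flat2 (pos i) (pos j))"
  by (simp_all add: flat_bi_def)

lemma poisson_on_constant:
  assumes "\<And>i j. c i j = - c j i" "openin (top_of_set (cspace I)) U"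
  shows "poisson_on I U (\<lambda>i j x. c i j)"
  by (rule poisson_onI[OF assms(2)]) (simp, rule assms(1), simp)

lemma bihamiltonian_flat_bi: "bihamiltonian (flat_bi I pos)"
proof -
  have 1: "a * flat1 i j + b * flat2 i j = - (a * flat1 j i + b * flat2 j i)" for a b i j
    by (subst flat1_antisym, subst flat2_antisym) simp
  show ?thesis
    unfolding bihamiltonian_def flat_bi_simps
    by (intro conjI allI poisson_on_constant 1 flat1_antisym flat2_antisym openin_subtopology_self)
qed

lemma partial_translate: "partial i (\<lambda>x. f (x + a)) x = partial i f (x + a)"
proof -
  have "(\<lambda>z. f ((\<chi> j. if j = i then z else x $ j) + a)) =
      (\<lambda>z. (\<lambda>w. f (\<chi> j. if j = i then w else (x + a) $ j)) (z + a $ i))"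
    by (intro ext arg_cong[of _ _ f]) (simp add: vec_eq_iff)
  moreover have "deriv (\<lambda>z. F (z + c)) w = deriv F (w + c)" for F :: "complex \<Rightarrow> complex" and c w
    unfolding deriv_def using DERIV_shift[of F _ w c] by simp
  ultimately show ?thesis unfolding partial_def by simp
qed

lemma translation_invariant_flat_bi: "translation_invariant (flat_bi I pos)"
  unfolding translation_invariant_def preserves_brackets_def
  by (simp add: bracket_def comp_def partial_translate)

lemma bracket_coordinates:
  assumes "i \<in> I" "j \<in> I"
  shows "bracket I P (\<lambda>x. x $ i) (\<lambda>x. x $ j) x = P i j x"
  using assms by (simp add: bracket_def partial_coordinate if_distrib[of "\<lambda>u. _ * u"] cong: if_cong)

text \<open>The chain rule for \<open>\<psi> \<circ> \<phi> = id\<close> after extension by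
  \<open>cproj\<close>. The sum stops at \<open>I'\<close> because the components of
  \<open>\<phi>\<close> outside \<open>I'\<close> vanish on \<open>U\<close>, so their derivatives
  along \<open>I\<close> are zero.\<close>

lemma chain_cspace:
  fixes \<phi> :: "complex^'n::finite \<Rightarrow> complex^'m::finite"
  assumes U: "openin (top_of_set (cspace I)) U" and W: "openin (top_of_set (cspace I')) W"
    and \<phi>: "\<phi> ` U \<subseteq> W" "\<And>j. mholomorphic_on U (\<lambda>x. \<phi> x $ j)" and \<psi>: "\<And>i. mholomorphic_on W (\<lambda>y. \<psi> y $ i)"
    and inv: "\<And>x. x \<in> U \<Longrightarrow> \<psi> (\<phi> x) = x" and x: "x \<in> U" and ab: "a \<in> I" "b \<in> I"
  shows "(\<Sum>j\<in>I'. partial j (\<lambda>y. \<psi> y $ b) (\<phi> x) * partial a (\<lambda>x. \<phi> x $ j) x) = (if a = b then 1 else 0)"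
proof -
  let ?S = "{x. cproj I x \<in> U}" and ?T = "{y. cproj I' y \<in> W}"
  let ?\<phi> = "\<phi> \<circ> cproj I"
  have S: "open ?S" and T: "open ?T" using U W by (auto intro: open_cproj_vimage)
  have cx: "cproj I x = x" by (rule cproj_cspace[OF openin_subset_cspace[OF U x]])
  have c\<phi>: "cproj I' (\<phi> y) = \<phi> y" "\<phi> y \<in> W" if "y \<in> U" for y
    using that \<phi>(1) cproj_cspace[OF openin_subset_cspace[OF W]] by auto
  have "partial a (((\<lambda>y. \<psi> y $ b) \<circ> cproj I') \<circ> ?\<phi>) x =
     (\<Sum>j\<in>UNIV. partial j ((\<lambda>y. \<psi> y $ b) \<circ> cproj I') (?\<phi> x) * partial a (\<lambda>x. ?\<phi> x $ j) x)"
  proof (rule partial_compose[OF S T])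
    show "x \<in> ?S" using x cx by simp
    show "mholomorphic_on ?S (\<lambda>x. ?\<phi> x $ i)" for i
      using mholomorphic_on_cproj[OF \<phi>(2)] by (simp add: comp_def)
    show "?\<phi> ` ?S \<subseteq> ?T" using c\<phi> by auto
    show "mholomorphic_on ?T ((\<lambda>y. \<psi> y $ b) \<circ> cproj I')" by (rule mholomorphic_on_cproj[OF \<psi>])
  qed
  also have "\<dots> = (\<Sum>j\<in>UNIV. if j \<in> I' then partial j (\<lambda>y. \<psi> y $ b) (\<phi> x) * partial a (\<lambda>x. \<phi> x $ j) x else 0)"
  proof (intro sum.cong refl)
    fix j
    have pa: "partial a (\<lambda>x. ?\<phi> x $ j) x = partial a (\<lambda>x. \<phi> x $ j) x"
      using partial_cproj[OF ab(1), of "\<lambda>x. \<phi> x $ j" x] by (simp add: comp_def cx)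
    show "partial j ((\<lambda>y. \<psi> y $ b) \<circ> cproj I') (?\<phi> x) * partial a (\<lambda>x. ?\<phi> x $ j) x =
      (if j \<in> I' then partial j (\<lambda>y. \<psi> y $ b) (\<phi> x) * partial a (\<lambda>x. \<phi> x $ j) x else 0)"
    proof (cases "j \<in> I'")
      case True
      then show ?thesis unfolding pa partial_cproj[OF True] using c\<phi>[OF x] cx by simp
    next
      case False
      have "partial a (\<lambda>x. ?\<phi> x $ j) x = partial a (\<lambda>x. 0) x"
      proof (rule partial_cong_open[OF S])
        show "x \<in> ?S" using x cx by simp
        show "?\<phi> y $ j = 0" if "y \<in> ?S" for y
          using openin_subset_cspace[OF W c\<phi>(2)[of "cproj I y"]] that False by (simp add: cspace_def)
      qed
      then show ?thesis using False by simp
    qed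
  qed
  also have "\<dots> = (\<Sum>j\<in>I'. partial j (\<lambda>y. \<psi> y $ b) (\<phi> x) * partial a (\<lambda>x. \<phi> x $ j) x)"
    by (simp add: sum.If_cases)
  finally have "(\<Sum>j\<in>I'. partial j (\<lambda>y. \<psi> y $ b) (\<phi> x) * partial a (\<lambda>x. \<phi> x $ j) x) =
     partial a (((\<lambda>y. \<psi> y $ b) \<circ> cproj I') \<circ> ?\<phi>) x" by simp
  also have "\<dots> = partial a (\<lambda>x. x $ b) x"
  proof (rule partial_cong_open[OF S])
    show "x \<in> ?S" using x cx by simp
    show "((\<lambda>y. \<psi> y $ b) \<circ> cproj I' \<circ> ?\<phi>) y = y $ b" if "y \<in> ?S" for y
      using that c\<phi> inv ab by (simp add: cproj_def)
  qed
  finally show ?thesis by (simp add: partial_coordinate)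
qed

lemma openin_region_prod_bi:
  assumes "bihamiltonian N1" "bihamiltonian N2"
  shows "openin (top_of_set (cspace (coords N1 \<union> coords N2))) (region (prod_bi [N1, N2]))"
proof -
  have "region (prod_bi [N1, N2]) = cspace (coords N1 \<union> coords N2) \<inter>
    ({x. cproj (coords N1) x \<in> region N1} \<inter> {x. cproj (coords N2) x \<in> region N2})"
    by (auto simp: prod_bi_def Let_def)
  moreover have "open ({x. cproj (coords N1) x \<in> region N1} \<inter> {x. cproj (coords N2) x \<in> region N2})"
    using assms by (intro open_Int open_cproj_vimage) (auto simp: bihamiltonian_def)
  ultimately show ?thesis by (auto simp: openin_open)
qed

lemma prod_bi_block:
  assumes "disjoint_coords [N1, N2]" "i \<in> coords N1" "j \<in> coords N2"
  shows "brack1 (prod_bi [N1, N2]) i j y = 0" "brack2 (prod_bi [N1, N2]) i j y = 0"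
proof -
  have "coords N1 \<inter> coords N2 = {}" using assms(1) by (force simp: disjoint_coords_def)
  then have "i \<notin> coords N2" "j \<notin> coords N1" using assms by auto
  then show "brack1 (prod_bi [N1, N2]) i j y = 0" "brack2 (prod_bi [N1, N2]) i j y = 0"
    by (simp_all add: prod_bi_def Let_def)
qed

text \<open>The brackets of the factors may vary from point to point, but only their values at the
  image of the origin are used. There the Jacobian matrices \<open>J\<close> and \<open>K\<close> of
  the isomorphism and of its inverse are inverse to each other, and preservation of brackets, tested
  on coordinate functions, says that the constant pencil is block diagonal in the basis
  \<open>J\<close>.\<close>

lemma flat_bi_indecomposable:
  fixes I :: "'n::finite set"
  assumes pos: "bij_betw pos I {..<2 * m - 1}"
  shows "\<not> decomposable (flat_bi I pos)"
proof
  assume "decomposable (flat_bi I pos)"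
  then obtain N1 N2 :: "'n bistructure" where N: "bihamiltonian N1" "bihamiltonian N2"
    "coords N1 \<noteq> {}" "coords N2 \<noteq> {}" "disjoint_coords [N1, N2]"
    and iso: "isomorphic_near 0 (flat_bi I pos) (prod_bi [N1, N2])"
    unfolding decomposable_def by (fastforce simp: cspace_def)
  define A B where "A = coords N1" and "B = coords N2"
  have AB: "A \<inter> B = {}" using N(5) by (force simp: disjoint_coords_def A_def B_def)
  have cp: "coords (prod_bi [N1, N2]) = A \<union> B" by (simp add: prod_bi_def Let_def A_def B_def)
  define n where "n = 2 * m - 1"
  obtain U W \<phi> where U: "0 \<in> U" "U \<subseteq> cspace I" "openin (top_of_set (cspace I)) U"
    and W: "W \<subseteq> region (prod_bi [N1, N2])" "openin (top_of_set (region (prod_bi [N1, N2]))) W"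
    and \<phi>: "isomorphism_bi (restrict_bi U (flat_bi I pos)) (restrict_bi W (prod_bi [N1, N2])) \<phi>"
    using iso unfolding isomorphic_near_def by auto
  have W': "openin (top_of_set (cspace (A \<union> B))) W"
    using openin_trans[OF W(2)] openin_region_prod_bi[OF N(1,2)] by (simp add: A_def B_def)
  have rU: "cspace I \<inter> U = U" and rW: "region (prod_bi [N1, N2]) \<inter> W = W" using U W by auto
  from \<phi> have "biholomorphic U W \<phi>"
    unfolding isomorphism_bi_def restrict_bi_def by (simp add: rU rW)
  then obtain \<psi> where \<psi>: "\<psi> ` W = U" "\<forall>i. mholomorphic_on W (\<lambda>y. \<psi> y $ i)"
      "\<forall>x\<in>U. \<psi> (\<phi> x) = x" "\<forall>y\<in>W. \<phi> (\<psi> y) = y" and im: "\<phi> ` U = W"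
    and hol: "\<And>j. mholomorphic_on U (\<lambda>x. \<phi> x $ j)"
    unfolding biholomorphic_def by fast
  have inv: "\<And>x. x \<in> U \<Longrightarrow> \<psi> (\<phi> x) = x" "\<And>y. y \<in> W \<Longrightarrow> \<phi> (\<psi> y) = y"
    and hol': "\<And>i. mholomorphic_on W (\<lambda>y. \<psi> y $ i)" using \<psi> by auto
  define e where "e = inv_into I pos"
  have e: "bij_betw e {..<n} I" unfolding e_def n_def by (rule bij_betw_inv_into[OF pos])
  have pe: "pos (e a) = a" if "a < n" for a
    using pos that unfolding e_def n_def by (simp add: bij_betw_inv_into_right)
  have eI: "e a \<in> I" if "a < n" for a using bij_betwE[OF e] that by simp
  have einj: "e a = e b \<longleftrightarrow> a = b" if "a < n" "b < n" for a b using pe that by metis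
  define J where "J = (\<lambda>j a. partial (e a) (\<lambda>x. \<phi> x $ j) 0)"
  define K where "K = (\<lambda>a j. partial j (\<lambda>y. \<psi> y $ e a) (\<phi> 0))"
  have \<phi>0: "\<phi> 0 \<in> W" "\<psi> (\<phi> 0) = 0" using im \<psi>(1) U inv by auto
  have KJ: "(\<Sum>j\<in>A\<union>B. K b j * J j a) = (if a = b then 1 else 0)" if "a < n" "b < n" for a b
    unfolding K_def J_def
    using chain_cspace[OF U(3) W' _ hol hol' inv(1) U(1) eI[OF that(1)] eI[OF that(2)]] im einj that by simp
  have JK: "(\<Sum>a<n. J i a * K a j) = (if i = j then 1 else 0)" if "i \<in> A \<union> B" "j \<in> A \<union> B" for i j
  proof -
    have "(\<Sum>a<n. J i a * K a j) = (\<Sum>a\<in>I. partial a (\<lambda>x. \<phi> x $ i) 0 * partial j (\<lambda>y. \<psi> y $ a) (\<phi> 0))"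
      unfolding J_def K_def by (rule sum.reindex_bij_betw[OF e])
    also have "\<dots> = (if j = i then 1 else 0)"
      using chain_cspace[OF W' U(3) _ hol' hol inv(2) \<phi>0(1) that(2,1)] \<psi>(1) \<phi>0 by simp
    finally show ?thesis by auto
  qed
  have br: "(\<Sum>a<n. \<Sum>b<n. F a b * J i a * J j b) = bracket I (\<lambda>i j x. F (pos i) (pos j)) (\<lambda>x. \<phi> x $ i) (\<lambda>x. \<phi> x $ j) 0" for F i j
  proof -
    have "(\<Sum>a<n. \<Sum>b<n. F a b * J i a * J j b) = (\<Sum>a<n. \<Sum>b<n. F (pos (e a)) (pos (e b)) *
       partial (e a) (\<lambda>x. \<phi> x $ i) 0 * partial (e b) (\<lambda>x. \<phi> x $ j) 0)"
      by (simp add: J_def pe)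
    also have "\<dots> = (\<Sum>a<n. \<Sum>b\<in>I. F (pos (e a)) (pos b) *
       partial (e a) (\<lambda>x. \<phi> x $ i) 0 * partial b (\<lambda>x. \<phi> x $ j) 0)"
      by (intro sum.cong refl sum.reindex_bij_betw[OF e])
    also have "\<dots> = (\<Sum>a\<in>I. \<Sum>b\<in>I. F (pos a) (pos b) *
       partial a (\<lambda>x. \<phi> x $ i) 0 * partial b (\<lambda>x. \<phi> x $ j) 0)"
      by (rule sum.reindex_bij_betw[OF e])
    finally show ?thesis by (simp add: bracket_def)
  qed
  have pres: "bracket I (\<lambda>i j x. flat1 (pos i) (pos j)) (\<lambda>x. \<phi> x $ i) (\<lambda>x. \<phi> x $ j) 0 = brack1 (prod_bi [N1, N2]) i j (\<phi> 0)"
    "bracket I (\<lambda>i j x. flat2 (pos i) (pos j)) (\<lambda>x. \<phi> x $ i) (\<lambda>x. \<phi> x $ j) 0 = brack2 (prod_bi [N1, N2]) i j (\<phi> 0)"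
    if "i \<in> A \<union> B" "j \<in> A \<union> B" for i j
  proof -
    have "preserves_brackets (restrict_bi U (flat_bi I pos)) (restrict_bi W (prod_bi [N1, N2])) \<phi>"
      using \<phi> unfolding isomorphism_bi_def by simp
    from this[unfolded preserves_brackets_def, rule_format, of "\<lambda>x. x $ i" "\<lambda>x. x $ j" 0]
    show "bracket I (\<lambda>i j x. flat1 (pos i) (pos j)) (\<lambda>x. \<phi> x $ i) (\<lambda>x. \<phi> x $ j) 0 = brack1 (prod_bi [N1, N2]) i j (\<phi> 0)"
      "bracket I (\<lambda>i j x. flat2 (pos i) (pos j)) (\<lambda>x. \<phi> x $ i) (\<lambda>x. \<phi> x $ j) 0 = brack2 (prod_bi [N1, N2]) i j (\<phi> 0)"
      using U that by (auto simp: restrict_bi_def rU rW comp_def cp bracket_coordinates)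
  qed
  show False
  proof (rule flat_split_impossible[OF n_def _ _ AB _ _ KJ JK])
    show "A \<noteq> {}" "B \<noteq> {}" using N by (auto simp: A_def B_def)
    show "(\<Sum>a<n. \<Sum>b<n. flat1 a b * J i a * J j b) = 0" "(\<Sum>a<n. \<Sum>b<n. flat2 a b * J i a * J j b) = 0"
      if "i \<in> A" "j \<in> B" for i j
      using that pres[of i j] prod_bi_block[OF N(5)] unfolding br A_def B_def by auto
  qed auto
qed

section \<open>Relative primitives\<close>

text \<open>The primitive is the integral along segments parallel to the coordinates in \<open>O\<close>.\<close>

lemma relative_poincare:
  fixes \<nu> :: "'n::finite \<Rightarrow> complex^'n \<Rightarrow> complex"
  assumes r: "B = ball c r" and \<nu>: "\<And>j. j \<in> D \<Longrightarrow> mholomorphic_on B (\<nu> j)"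
    and closed: "\<And>i j z. i \<in> D \<Longrightarrow> j \<in> D \<Longrightarrow> z \<in> B \<Longrightarrow> partial i (\<nu> j) z = partial j (\<nu> i) z"
  obtains Y where "mholomorphic_on B Y" "\<And>j z. j \<in> D \<Longrightarrow> z \<in> B \<Longrightarrow> partial j Y z = \<nu> j z"
    "\<And>z. \<forall>j\<in>D. z $ j = c $ j \<Longrightarrow> Y z = 0"
proof -
  have B: "open B" "convex B" by (simp_all add: r)
  define w where "w = (\<lambda>z (t::real). \<chi> i. if i \<in> D then c $ i + of_real t * (z $ i - c $ i) else z $ i)"
  \<comment> \<open>The segments shrink only the coordinates in \<open>D\<close> towards the centre,
    which does not increase the distance to \<open>c\<close>. This keeps them inside a ball around
    \<open>c\<close>.\<close>
  have wB: "w z t \<in> B" if "z \<in> B" "t \<in> {0..1}" for z t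
  proof -
    have "norm (w z t - c) \<le> norm (z - c)"
      unfolding norm_vec_def using that
      by (intro L2_set_mono) (auto simp: w_def norm_mult intro: mult_left_le_one_le)
    then show ?thesis using that(1) by (simp add: r dist_norm norm_minus_commute)
  qed
  define \<omega> where "\<omega> = (\<lambda>z t. \<Sum>j\<in>D. \<nu> j (w z t) * (z $ j - c $ j))"
  define d where "d = (\<lambda>z t i. (\<Sum>j\<in>D. partial i (\<nu> j) (w z t) * (if i \<in> D then of_real t else 1) * (z $ j - c $ j))
    + (if i \<in> D then \<nu> i (w z t) else 0))"
  define Y where "Y = (\<lambda>z. integral {0..1} (\<omega> z))"
  have w_der: "((\<lambda>z. w z t) has_derivative (\<lambda>v. \<chi> i. (if i \<in> D then of_real t else 1) * v $ i)) (at z)" for z t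
    by (rule has_derivative_vec)
      (auto simp: w_def intro!: derivative_eq_intros bounded_linear_imp_has_derivative)
  have \<omega>_der: "((\<lambda>z. \<omega> z t) has_derivative (\<lambda>v. \<Sum>i\<in>UNIV. v $ i * d z t i)) (at z)"
    if z: "z \<in> B" and t: "t \<in> {0..1}" for z t
  proof -
    have \<nu>_der: "((\<lambda>z. \<nu> j (w z t)) has_derivative
        (\<lambda>v. \<Sum>i\<in>UNIV. (if i \<in> D then of_real t else 1) * v $ i * partial i (\<nu> j) (w z t))) (at z)" if "j \<in> D" for j
      using has_derivative_compose[OF w_der mholomorphic_on_has_derivative[OF B(1) wB[OF z t] \<nu>[OF that]]] by simp
    have "((\<lambda>z. \<omega> z t) has_derivative (\<lambda>v. \<Sum>j\<in>D. \<nu> j (w z t) * v $ j +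
       (\<Sum>i\<in>UNIV. (if i \<in> D then of_real t else 1) * v $ i * partial i (\<nu> j) (w z t)) * (z $ j - c $ j))) (at z)"
      unfolding \<omega>_def
      by (intro has_derivative_sum has_derivative_mult \<nu>_der has_derivative_eq_rhs[OF has_derivative_diff[OF
        bounded_linear_imp_has_derivative[OF bounded_linear_vec_nth] has_derivative_const]]) auto
    moreover have "(\<Sum>j\<in>D. \<nu> j (w z t) * v $ j +
       (\<Sum>i\<in>UNIV. (if i \<in> D then of_real t else 1) * v $ i * partial i (\<nu> j) (w z t)) * (z $ j - c $ j)) =
       (\<Sum>i\<in>UNIV. v $ i * d z t i)" for v
    proof -
      have "(\<Sum>i\<in>UNIV. v $ i * d z t i) = (\<Sum>i\<in>UNIV. \<Sum>j\<in>D. v $ i *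
          (partial i (\<nu> j) (w z t) * (if i \<in> D then of_real t else 1) * (z $ j - c $ j)))
          + (\<Sum>i\<in>UNIV. if i \<in> D then v $ i * \<nu> i (w z t) else 0)"
        by (simp add: d_def distrib_left sum.distrib sum_distrib_left if_distrib[of "\<lambda>u. _ * u"] cong: if_cong)
      also have "(\<Sum>i\<in>UNIV. if i \<in> D then v $ i * \<nu> i (w z t) else 0) = (\<Sum>j\<in>D. \<nu> j (w z t) * v $ j)"
        by (simp add: sum.If_cases mult.commute)
      also have "(\<Sum>i\<in>UNIV. \<Sum>j\<in>D. v $ i *
          (partial i (\<nu> j) (w z t) * (if i \<in> D then of_real t else 1) * (z $ j - c $ j))) =
        (\<Sum>j\<in>D. (\<Sum>i\<in>UNIV. (if i \<in> D then of_real t else 1) * v $ i * partial i (\<nu> j) (w z t)) * (z $ j - c $ j))"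
        by (subst sum.swap) (simp add: sum_distrib_right sum_distrib_left mult_ac)
      finally show ?thesis by (simp add: sum.distrib add.commute)
    qed
    ultimately show ?thesis by simp
  qed
  have w_cont: "continuous_on A (\<lambda>p. w (fst p) (snd p))" for A
    unfolding w_def
  proof (rule continuous_on_vec_lambda)
    show "continuous_on A (\<lambda>p. if i \<in> D then c $ i + of_real (snd p) * (fst p $ i - c $ i) else fst p $ i)" for i
      by (cases "i \<in> D") (auto intro!: continuous_intros)
  qed
  have wB': "(\<lambda>p. w (fst p) (snd p)) ` (B \<times> {0..1}) \<subseteq> B" using wB by auto
  have w_cont1: "continuous_on A (w z)" for A z
    using continuous_on_compose2[OF w_cont[of UNIV] continuous_on_Pair[OF continuous_on_const[of A z] continuous_on_id]] by simp
  have d_cont: "continuous_on (B \<times> {0..1}) (\<lambda>p. d (fst p) (snd p) i)" for i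
  proof -
    have 1: "continuous_on (B \<times> {0..1}) (\<lambda>p. partial i (\<nu> j) (w (fst p) (snd p)))" if "j \<in> D" for j
      by (rule continuous_on_compose2[OF partial_continuous_on[OF B(1) \<nu>[OF that]] w_cont wB'])
    have 2: "continuous_on (B \<times> {0..1}) (\<lambda>p. if i \<in> D then \<nu> i (w (fst p) (snd p)) else 0)"
      by (cases "i \<in> D") (auto intro!: continuous_on_compose2[OF mholomorphic_on_imp_continuous_on[OF \<nu>] w_cont] wB)
    have 3: "continuous_on (B \<times> {0..1}) (\<lambda>p. if i \<in> D then complex_of_real (snd p) else 1)"
      by (cases "i \<in> D") (auto intro!: continuous_intros)
    show ?thesis unfolding d_def
      by (intro continuous_on_add continuous_on_sum continuous_on_mult 1 2 3) (auto intro!: continuous_intros)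
  qed
  have \<omega>_int: "\<omega> z integrable_on {0..1}" if "z \<in> B" for z
    unfolding \<omega>_def
    by (intro integrable_continuous_interval continuous_on_sum continuous_on_mult continuous_on_const
        continuous_on_compose2[OF mholomorphic_on_imp_continuous_on[OF \<nu>] w_cont1]) (use wB that in auto)
  have Y_der: "(Y has_derivative (\<lambda>v. \<Sum>i\<in>UNIV. v $ i * integral {0..1} (\<lambda>t. d z t i))) (at z)" if "z \<in> B" for z
    unfolding Y_def by (rule integral_has_complex_derivative[OF B that \<omega>_der \<omega>_int d_cont])
  have "mholomorphic_on B Y" by (rule mholomorphic_onI[OF Y_der])
  moreover have "partial i Y z = \<nu> i z" if i: "i \<in> D" and z: "z \<in> B" for i z
  proof -
    \<comment> \<open>Closedness turns the integrand \<open>d z t i\<close> of the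
      \<open>i\<close>-th derivative into the \<open>t\<close>-derivative of
      \<open>t * \<nu> i (w z t)\<close>; integration from \<open>0\<close> to \<open>1\<close>
      leaves \<open>\<nu> i z\<close>.\<close>
    have "((\<lambda>t. of_real t * \<nu> i (w z t)) has_vector_derivative d z t i) (at t within {0..1})" if t: "t \<in> {0..1}" for t
    proof -
      have "((\<lambda>t. w z t) has_derivative (\<lambda>h. \<chi> j. if j \<in> D then of_real h * (z $ j - c $ j) else 0)) (at t)"
      proof (rule has_derivative_vec)
        show "((\<lambda>t. w z t $ j) has_derivative (\<lambda>h. (\<chi> j. if j \<in> D then of_real h * (z $ j - c $ j) else 0) $ j)) (at t)" for j
          by (cases "j \<in> D") (auto simp: w_def intro!: derivative_eq_intros)
      qed
      from has_derivative_compose[OF this mholomorphic_on_has_derivative[OF B(1) wB[OF z t] \<nu>[OF i]]]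
      have "((\<lambda>t. \<nu> i (w z t)) has_derivative (\<lambda>h. \<Sum>j\<in>D. of_real h * (z $ j - c $ j) * partial j (\<nu> i) (w z t))) (at t)"
        by (simp add: if_distrib[of "\<lambda>u. u * _"] sum.If_cases cong: if_cong)
      from has_derivative_mult[OF has_derivative_of_real[OF has_derivative_ident] this]
      have "((\<lambda>t. of_real t * \<nu> i (w z t)) has_derivative (\<lambda>h. of_real t *
         (\<Sum>j\<in>D. of_real h * (z $ j - c $ j) * partial j (\<nu> i) (w z t)) + of_real h * \<nu> i (w z t))) (at t)" .
      moreover have "of_real t * (\<Sum>j\<in>D. of_real h * (z $ j - c $ j) * partial j (\<nu> i) (w z t)) + of_real h * \<nu> i (w z t)
          = h *\<^sub>R d z t i" for h :: real
      proof -
        have "(\<Sum>j\<in>D. partial i (\<nu> j) (w z t) * of_real t * (z $ j - c $ j)) =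
          (\<Sum>j\<in>D. partial j (\<nu> i) (w z t) * of_real t * (z $ j - c $ j))"
          using closed[OF i _ wB[OF z t]] by (intro sum.cong) auto
        then show ?thesis using i
          by (simp add: d_def scaleR_conv_of_real distrib_left sum_distrib_left mult_ac)
      qed
      ultimately show ?thesis
        unfolding has_vector_derivative_def by (auto intro!: has_derivative_at_withinI)
    qed
    from fundamental_theorem_of_calculus[OF _ this]
    have "integral {0..1} (\<lambda>t. d z t i) = \<nu> i (w z 1)"
      by (simp add: integral_unique)
    moreover have "w z 1 = z" by (simp add: w_def vec_eq_iff)
    ultimately show ?thesis using partial_eqI[OF Y_der[OF z], of i] by simp
  qed
  moreover have "Y z = 0" if "\<forall>j\<in>D. z $ j = c $ j" for z
    using that by (simp add: Y_def \<omega>_def[abs_def])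
  ultimately show ?thesis using that by blast
qed


text \<open>The segment from \<open>z\<close> to its projection onto the slice through
  \<open>c\<close> runs in directions of \<open>D\<close> only. This reduces identities for
  functions constant along \<open>D\<close> to the slice.\<close>

lemma relative_constant:
  fixes F :: "complex^'n::finite \<Rightarrow> complex"
  assumes r: "B = ball c r" and F: "mholomorphic_on B F"
    and zero: "\<And>j z. j \<in> D \<Longrightarrow> z \<in> B \<Longrightarrow> partial j F z = 0" and z: "z \<in> B"
  shows "(\<chi> i. if i \<in> D then c $ i else z $ i) \<in> B"
    and "F z = F (\<chi> i. if i \<in> D then c $ i else z $ i)"
proof -
  have B: "open B" "convex B" by (simp_all add: r)
  let ?w = "\<chi> i. if i \<in> D then c $ i else z $ i"
  have "norm (?w - c) \<le> norm (z - c)"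
    unfolding norm_vec_def by (intro L2_set_mono) auto
  then show w: "?w \<in> B" using z by (simp add: r dist_norm norm_minus_commute)
  define g where "g = (\<lambda>t::real. z + t *\<^sub>R (?w - z))"
  have gB: "g t \<in> B" if "t \<in> {0..1}" for t
  proof -
    have "(1 - t) *\<^sub>R z + t *\<^sub>R ?w \<in> B" using convexD[OF B(2) z w, of "1 - t" t] that by simp
    then show ?thesis by (simp add: g_def algebra_simps)
  qed
  have "((\<lambda>t. F (g t)) has_derivative (\<lambda>h. 0)) (at t within {0..1})" if t: "t \<in> {0..1}" for t
  proof -
    have "(g has_derivative (\<lambda>h. h *\<^sub>R (?w - z))) (at t)"
      unfolding g_def by (auto intro!: derivative_eq_intros)
    from has_derivative_compose[OF this mholomorphic_on_has_derivative[OF B(1) gB[OF t] F]]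
    have "((\<lambda>t. F (g t)) has_derivative (\<lambda>h. \<Sum>i\<in>UNIV. (h *\<^sub>R (?w - z)) $ i * partial i F (g t))) (at t)" .
    moreover have "(\<Sum>i\<in>UNIV. (h *\<^sub>R (?w - z)) $ i * partial i F (g t)) = 0" for h
      by (intro sum.neutral) (auto simp: zero gB[OF t])
    ultimately show ?thesis by (simp add: has_derivative_at_withinI)
  qed
  then obtain C where "\<And>t. t \<in> {0..1} \<Longrightarrow> F (g t) = C"
    using has_derivative_zero_constant[of "{0..1::real}" "\<lambda>t. F (g t)"] by (metis convex_real_interval(5))
  from this[of 0] this[of 1] show "F z = F ?w" by (simp add: g_def)
qed

text \<open>The block sum of a \<open>K\<close> by \<open>K\<close> matrix with an identity matrix.
  It makes \<open>det\<close> and Cramer's rule over the index type applicable to a size that is a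
  number.\<close>

definition padded_matrix :: "('n::finite \<Rightarrow> nat) \<Rightarrow> nat \<Rightarrow> (nat \<Rightarrow> nat \<Rightarrow> complex) \<Rightarrow> complex^'n^'n" where
  "padded_matrix pos K m = (\<chi> i j. if pos i < K \<and> pos j < K then m (pos i) (pos j) else if i = j then 1 else 0)"

lemma padded_matrix_apply:
  assumes pos: "bij_betw pos UNIV {..<N}" and K: "K \<le> N"
  shows "(padded_matrix pos K m *v v) $ i =
    (if pos i < K then (\<Sum>q<K. m (pos i) q * v $ inv pos q) else v $ i)"
proof (cases "pos i < K")
  case True
  have e: "bij_betw (inv pos) {..<N} UNIV" using bij_betw_inv_into[OF pos] .
  have pe: "pos (inv pos q) = q" if "q < N" for q
    using pos that by (simp add: bij_betw_inv_into_right)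
  have "(padded_matrix pos K m *v v) $ i = (\<Sum>j\<in>UNIV. if pos j < K then m (pos i) (pos j) * v $ j else 0)"
    using True unfolding padded_matrix_def matrix_vector_mult_def by (auto intro!: sum.cong)
  also have "\<dots> = (\<Sum>q<N. if pos (inv pos q) < K then m (pos i) (pos (inv pos q)) * v $ (inv pos q) else 0)"
    by (rule sum.reindex_bij_betw[OF e, symmetric])
  also have "\<dots> = (\<Sum>q<N. if q < K then m (pos i) q * v $ (inv pos q) else 0)"
    by (intro sum.cong) (auto simp: pe)
  also have "\<dots> = (\<Sum>q<K. m (pos i) q * v $ inv pos q)"
    using K by (intro sum.mono_neutral_cong_right) auto
  finally show ?thesis using True by simp
next
  case False
  then show ?thesis
    by (simp add: padded_matrix_def matrix_vector_mult_def if_distrib[of "\<lambda>u. u * _"] cong: if_cong)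
qed

lemma det_padded_matrix:
  assumes pos: "bij_betw pos UNIV {..<N}" and K: "K \<le> N"
  shows "det (padded_matrix pos K m) \<noteq> 0 \<longleftrightarrow>
    (\<forall>\<gamma>. (\<forall>l<K. (\<Sum>q<K. m l q * \<gamma> q) = 0) \<longrightarrow> (\<forall>q<K. \<gamma> q = 0))" (is "?L \<longleftrightarrow> ?R")
proof -
  have pe: "pos (inv pos q) = q" if "q < N" for q
    using pos that by (simp add: bij_betw_inv_into_right)
  have ep: "inv pos (pos i) = i" for i
    using pos by (simp add: bij_betw_def inv_f_f)
  have "?L \<longleftrightarrow> (\<forall>v. padded_matrix pos K m *v v = 0 \<longrightarrow> v = 0)"
    using invertible_det_nz[of "padded_matrix pos K m"] matrix_left_invertible_ker[of "padded_matrix pos K m"]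
    by (simp add: invertible_left_inverse)
  also have "\<dots> \<longleftrightarrow> ?R"
  proof safe
    fix \<gamma> q assume ker: "\<forall>v. padded_matrix pos K m *v v = 0 \<longrightarrow> v = 0"
      and \<gamma>: "\<forall>l<K. (\<Sum>q<K. m l q * \<gamma> q) = 0" and q: "q < K"
    define v :: "complex^'a" where "v = (\<chi> i. if pos i < K then \<gamma> (pos i) else 0)"
    have "padded_matrix pos K m *v v = 0"
      using \<gamma> K by (simp add: vec_eq_iff padded_matrix_apply[OF pos K] v_def pe)
    then have "v = 0" using ker by blast
    then have "v $ inv pos q = 0" by simp
    then show "\<gamma> q = 0" using q K by (simp add: v_def pe)
  next
    fix v assume R: ?R and "padded_matrix pos K m *v v = 0"
    then have v: "(if pos i < K then (\<Sum>q<K. m (pos i) q * v $ inv pos q) else v $ i) = 0" for i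
      by (simp only: padded_matrix_apply[OF pos K, symmetric]) simp
    have "(\<Sum>q<K. m l q * v $ inv pos q) = 0" if "l < K" for l
      using v[of "inv pos l"] that K by (simp add: pe)
    then have "v $ inv pos q = 0" if "q < K" for q
      using spec[OF R, of "\<lambda>q. v $ inv pos q"] that by simp
    then have "v $ i = 0" for i using v[of i] by (cases "pos i < K") (auto dest: meta_spec[of _ "pos i"] simp: ep)
    then show "v = 0" by (simp add: vec_eq_iff)
  qed
  finally show ?thesis .
qed

text \<open>Cramer's rule presents the entries of the inverse as quotients of determinants, which
  are holomorphic where the denominator is nonzero.\<close>

lemma mholomorphic_inverse_matrix:
  fixes S :: "(complex^'n::finite) set" and m :: "nat \<Rightarrow> nat \<Rightarrow> complex^'n \<Rightarrow> complex"
  assumes K: "K \<le> CARD('n)" and m: "\<And>l q. l < K \<Longrightarrow> q < K \<Longrightarrow> mholomorphic_on S (m l q)"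
    and nondeg: "\<And>x \<gamma>. x \<in> S \<Longrightarrow> \<forall>l<K. (\<Sum>q<K. m l q x * \<gamma> q) = 0 \<Longrightarrow> \<forall>q<K. \<gamma> q = 0"
  obtains n where "\<And>q p. q < K \<Longrightarrow> p < K \<Longrightarrow> mholomorphic_on S (n q p)"
    "\<And>x l p. x \<in> S \<Longrightarrow> l < K \<Longrightarrow> p < K \<Longrightarrow> (\<Sum>q<K. m l q x * n q p x) = (if l = p then 1 else 0)"
    "\<And>x q r. x \<in> S \<Longrightarrow> q < K \<Longrightarrow> r < K \<Longrightarrow> (\<Sum>p<K. n q p x * m p r x) = (if q = r then 1 else 0)"
proof -
  obtain pos :: "'n \<Rightarrow> nat" where pos: "bij_betw pos UNIV {..<CARD('n)}"
    using ex_bij_betw_finite_nat[of "UNIV :: 'n set"] by (auto simp: atLeast0LessThan)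
  have pe: "pos (inv pos q) = q" if "q < K" for q
    using pos that K by (simp add: bij_betw_inv_into_right)
  have einj: "inv pos q = inv pos p \<longleftrightarrow> q = p" if "q < K" "p < K" for p q
    using pe that by metis
  define M where "M = (\<lambda>x. padded_matrix pos K (\<lambda>l q. m l q x))"
  have det: "det (M x) \<noteq> 0" if "x \<in> S" for x
    unfolding M_def det_padded_matrix[OF pos K] using nondeg[OF that] by blast
  define R where "R = (\<lambda>x. \<chi> i p. det (\<chi> a b. if b = i then axis p 1 $ a else M x $ a $ b) / det (M x))"
  have M_hol: "mholomorphic_on S (\<lambda>x. M x $ i $ j)" for i j
    using m by (cases "pos i < K \<and> pos j < K") (auto simp: M_def padded_matrix_def)
  have R_hol: "mholomorphic_on S (\<lambda>x. R x $ i $ p)" for i p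
  proof -
    have "mholomorphic_on S (\<lambda>x. (\<chi> a b. if b = i then axis p 1 $ a else M x $ a $ b) $ a $ b)" for a b
      by (cases "b = i") (simp_all add: M_hol)
    then show ?thesis
      unfolding R_def vec_lambda_beta using det by (intro mholomorphic_on_divide mholomorphic_on_det M_hol) auto
  qed
  have MR: "M x ** R x = mat 1" if "x \<in> S" for x
  proof -
    have "M x *v (\<chi> i. R x $ i $ p) = axis p 1" for p
      using cramer[OF det[OF that], of "\<chi> i. R x $ i $ p" "axis p 1"] by (simp add: R_def)
    then have "(\<Sum>j\<in>UNIV. M x $ i $ j * R x $ j $ p) = (axis p 1 :: complex^'n) $ i" for i p
      by (simp add: vec_eq_iff matrix_vector_mult_def)
    then show ?thesis by (simp add: matrix_matrix_mult_def mat_def vec_eq_iff axis_def)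
  qed
  have RM: "R x ** M x = mat 1" if "x \<in> S" for x
    using MR[OF that] matrix_left_right_inverse by blast
  show ?thesis
  proof (rule that)
    show "mholomorphic_on S (\<lambda>x. R x $ inv pos q $ inv pos p)" for q p by (rule R_hol)
    show "(\<Sum>q<K. m l q x * R x $ inv pos q $ inv pos p) = (if l = p then 1 else 0)"
      if "x \<in> S" "l < K" "p < K" for x l p
    proof -
      have "(M x *v (\<chi> i. R x $ i $ inv pos p)) $ inv pos l = (M x ** R x) $ inv pos l $ inv pos p"
        by (simp add: matrix_vector_mult_def matrix_matrix_mult_def)
      then show ?thesis
        using that unfolding MR[OF that(1)] unfolding M_def padded_matrix_apply[OF pos K]
        by (simp add: pe mat_def einj)
    qed
    have "transpose (M x) = padded_matrix pos K (\<lambda>l q. m q l x)" for x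
      by (auto simp: M_def padded_matrix_def transpose_def vec_eq_iff)
    note tr = this
    show "(\<Sum>p<K. R x $ inv pos q $ inv pos p * m p r x) = (if q = r then 1 else 0)"
      if "x \<in> S" "q < K" "r < K" for x q r
    proof -
      have "(transpose (M x) *v (\<chi> i. R x $ inv pos q $ i)) $ inv pos r = (R x ** M x) $ inv pos q $ inv pos r"
        by (simp add: matrix_vector_mult_def matrix_matrix_mult_def transpose_def mult.commute)
      then show ?thesis
        using that unfolding RM[OF that(1)] unfolding tr padded_matrix_apply[OF pos K]
        by (simp add: pe mat_def einj mult.commute)
    qed
  qed
qed

text \<open>
  Differentiating \<open>m n = 1\<close> turns the commutation of the vector fields with coefficients
  \<open>m\<close> into closedness of the dual forms with coefficients \<open>n\<close>.
\<close>

lemma dual_forms_closed: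
  fixes m n :: "nat \<Rightarrow> nat \<Rightarrow> complex"
  assumes inv: "\<And>q r. q < K \<Longrightarrow> r < K \<Longrightarrow> (\<Sum>p<K. n q p * m p r) = (if q = r then 1 else 0)"
    and der: "\<And>q l. q < K \<Longrightarrow> l < K \<Longrightarrow> (\<Sum>b<K. dm q l b * \<nu> b + m l b * c q b) = 0"
    and comm: "\<And>l l' b. l < K \<Longrightarrow> l' < K \<Longrightarrow> b < K \<Longrightarrow> (\<Sum>q<K. m l q * dm q l' b) = (\<Sum>q<K. m l' q * dm q l b)"
    and rs: "r < K" "s < K"
  shows "c r s = c s r"
proof -
  \<comment> \<open>\<open>T l l'\<close> is the bilinear form \<open>c\<close> evaluated on the
    vector fields with coefficients \<open>m l\<close> and \<open>m l'\<close>. Commutation makes it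
    symmetric, and contraction with the inverse matrix \<open>n\<close> recovers
    \<open>c\<close>.\<close>
  define T where "T = (\<lambda>l l'. \<Sum>q<K. \<Sum>b<K. m l q * m l' b * c q b)"
  have T: "T l l' = - (\<Sum>b<K. (\<Sum>q<K. m l q * dm q l' b) * \<nu> b)" if "l < K" "l' < K" for l l'
  proof -
    have "(\<Sum>b<K. m l' b * c q b) = - (\<Sum>b<K. dm q l' b * \<nu> b)" if "q < K" for q
      using der[OF that \<open>l' < K\<close>] by (simp add: sum.distrib eq_neg_iff_add_eq_0 add.commute)
    then have "(\<Sum>q<K. m l q * (\<Sum>b<K. m l' b * c q b)) = (\<Sum>q<K. m l q * - (\<Sum>b<K. dm q l' b * \<nu> b))"
      by (intro sum.cong) auto
    then have "T l l' = - (\<Sum>q<K. \<Sum>b<K. m l q * dm q l' b * \<nu> b)"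
      by (simp add: T_def sum_distrib_left sum_negf mult.assoc)
    also have "(\<Sum>q<K. \<Sum>b<K. m l q * dm q l' b * \<nu> b) = (\<Sum>b<K. (\<Sum>q<K. m l q * dm q l' b) * \<nu> b)"
      by (subst sum.swap) (simp add: sum_distrib_right)
    finally show ?thesis .
  qed
  have sym: "T l l' = T l' l" if "l < K" "l' < K" for l l'
    using that by (simp add: T comm[OF that])
  have recover: "(\<Sum>l<K. \<Sum>l'<K. n r l * n s l' * T l l') = c r s" if "r < K" "s < K" for r s
  proof -
    have "(\<Sum>l<K. \<Sum>l'<K. n r l * n s l' * T l l') =
      (\<Sum>l<K. \<Sum>l'<K. \<Sum>q<K. \<Sum>b<K. (n r l * m l q) * (n s l' * m l' b) * c q b)"
      by (simp add: T_def sum_distrib_left mult_ac)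
    also have "\<dots> = (\<Sum>l<K. \<Sum>q<K. \<Sum>l'<K. \<Sum>b<K. (n r l * m l q) * (n s l' * m l' b) * c q b)"
      by (rule sum.cong[OF refl], rule sum.swap)
    also have "\<dots> = (\<Sum>l<K. \<Sum>q<K. \<Sum>b<K. \<Sum>l'<K. (n r l * m l q) * (n s l' * m l' b) * c q b)"
      by (rule sum.cong[OF refl], rule sum.cong[OF refl], rule sum.swap)
    also have "\<dots> = (\<Sum>l<K. \<Sum>q<K. (n r l * m l q) * (\<Sum>b<K. (\<Sum>l'<K. n s l' * m l' b) * c q b))"
      by (simp add: sum_distrib_left sum_distrib_right mult_ac)
    also have "\<dots> = (\<Sum>l<K. \<Sum>q<K. (n r l * m l q) * (\<Sum>b<K. if b = s then c q b else 0))"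
      using that by (intro sum.cong refl arg_cong2[of _ _ _ _ "(*)"]) (auto simp: inv)
    also have "\<dots> = (\<Sum>l<K. \<Sum>q<K. n r l * m l q * c q s)" using that by simp
    also have "\<dots> = (\<Sum>q<K. (\<Sum>l<K. n r l * m l q) * c q s)"
      by (subst sum.swap) (simp add: sum_distrib_right)
    also have "\<dots> = (\<Sum>q<K. if q = r then c q s else 0)"
      using that by (intro sum.cong) (auto simp: inv)
    finally show ?thesis using that by simp
  qed
  have "c r s = (\<Sum>l<K. \<Sum>l'<K. n r l * n s l' * T l' l)"
    unfolding recover[OF rs, symmetric] by (intro sum.cong refl) (auto simp: sym)
  also have "\<dots> = (\<Sum>l'<K. \<Sum>l<K. n s l' * n r l * T l' l)"
    by (subst sum.swap) (simp add: mult_ac)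
  also have "\<dots> = c s r" by (rule recover[OF rs(2,1)])
  finally show ?thesis .
qed

section \<open>Straightening a Lenard chain\<close>

lemma bracket_cong_open:
  assumes "open U" "x \<in> U" "\<And>y. y \<in> U \<Longrightarrow> f y = f' y" "\<And>y. y \<in> U \<Longrightarrow> g y = g' y"
  shows "bracket I P f g x = bracket I P f' g' x"
  unfolding bracket_def
  using partial_cong_open[OF assms(1,2,3)] partial_cong_open[OF assms(1,2,4)] by (auto intro!: sum.cong)

lemma bracket_const [simp]: "bracket I P f (\<lambda>x. c) x = 0" "bracket I P (\<lambda>x. c) f x = 0"
  by (simp_all add: bracket_def)

lemma poisson_on_antisym:
  assumes "poisson_on UNIV U P" "x \<in> U"
  shows "P i j x = - P j i x" "bracket UNIV P f g x = - bracket UNIV P g f x"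
proof -
  have *: "P i j x = - P j i x" for i j
    using assms unfolding poisson_on_def
    by (metis (no_types, lifting) UNIV_I bracket_coordinates mholomorphic_on_coordinate)
  then show "P i j x = - P j i x" by blast
  show "bracket UNIV P f g x = - bracket UNIV P g f x" by (rule bracket_antisym) (rule *)
qed

text \<open>Two of the three Jacobi terms are brackets with a constant. It will show that the
  bracket of two conjugate functions is constant along the flow of each \<open>H l\<close>.\<close>

lemma poisson_on_jacobi_const:
  assumes P: "poisson_on UNIV U P" and U: "open U" "x \<in> U"
    and hol: "mholomorphic_on U h" "mholomorphic_on U u" "mholomorphic_on U v"
    and c: "\<And>y. y \<in> U \<Longrightarrow> bracket UNIV P h u y = c" and d: "\<And>y. y \<in> U \<Longrightarrow> bracket UNIV P h v y = d"
  shows "bracket UNIV P h (bracket UNIV P u v) x = 0"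
proof -
  have "bracket UNIV P h (bracket UNIV P u v) x + bracket UNIV P u (bracket UNIV P v h) x
    + bracket UNIV P v (bracket UNIV P h u) x = 0"
    using P U(2) hol unfolding poisson_on_def by blast
  moreover have "bracket UNIV P u (bracket UNIV P v h) x = bracket UNIV P u (\<lambda>y. - d) x"
    by (rule bracket_cong_open[OF U]) (simp_all add: poisson_on_antisym(2)[OF P, of _ v h] d)
  moreover have "bracket UNIV P v (bracket UNIV P h u) x = bracket UNIV P v (\<lambda>y. c) x"
    by (rule bracket_cong_open[OF U]) (simp_all add: c)
  ultimately show ?thesis by simp
qed

text \<open>Commuting functions have commuting Hamiltonian fields: the third Jacobi term is a
  bracket with zero.\<close>

lemma poisson_on_jacobi_commute:
  assumes P: "poisson_on UNIV U P" and U: "open U" "x \<in> U"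
    and hol: "mholomorphic_on U h" "mholomorphic_on U h'" "mholomorphic_on U u"
    and c: "\<And>y. y \<in> U \<Longrightarrow> bracket UNIV P h h' y = 0"
  shows "bracket UNIV P h (bracket UNIV P h' u) x = bracket UNIV P h' (bracket UNIV P h u) x"
proof -
  have "bracket UNIV P h (bracket UNIV P h' u) x + bracket UNIV P h' (bracket UNIV P u h) x
    + bracket UNIV P u (bracket UNIV P h h') x = 0"
    using P U(2) hol unfolding poisson_on_def by blast
  moreover have "bracket UNIV P h' (bracket UNIV P u h) x = bracket UNIV P h' (\<lambda>y. - bracket UNIV P h u y) x"
    by (rule bracket_cong_open[OF U]) (simp_all add: poisson_on_antisym(2)[OF P, of _ u h])
  moreover have "\<dots> = - bracket UNIV P h' (bracket UNIV P h u) x"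
  proof -
    have "mholomorphic_on U (bracket UNIV P h u)"
      using P hol by (intro bracket_mholomorphic_on U) (auto simp: poisson_on_def)
    from partial_minus[OF U this] show ?thesis by (simp add: bracket_def[of _ _ h'] sum_negf)
  qed
  moreover have "bracket UNIV P u (bracket UNIV P h h') x = bracket UNIV P u (\<lambda>y. 0) x"
    by (rule bracket_cong_open[OF U]) (simp_all add: c)
  ultimately show ?thesis by simp
qed

lemma sum_even_odd: "(\<Sum>r<2 * k. g r) = (\<Sum>l<k. g (2 * l)) + (\<Sum>q<k. g (2 * q + 1))" for g :: "nat \<Rightarrow> complex"
  by (induction k) (simp_all add: algebra_simps)

text \<open>The layout of the \<open>2 * Suc K\<close> coordinates: \<open>H l\<close> at position
  \<open>2 * l\<close>, its conjugate function at \<open>2 * l + 1\<close>, and \<open>A\<close>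
  last. Positions below \<open>2 * K + 1\<close> form the large Kronecker block.\<close>

lemma sum_positions:
  fixes G :: "'n::finite \<Rightarrow> complex" and K :: nat
  assumes pos: "bij_betw pos UNIV {..<2 * Suc K}"
  shows "(\<Sum>i\<in>UNIV. G i) = (\<Sum>l<Suc K. G (inv pos (2 * l))) + (\<Sum>q<K. G (inv pos (2 * q + 1))) + G (inv pos (2 * K + 1))"
proof -
  have "(\<Sum>i\<in>UNIV. G i) = (\<Sum>r<2 * Suc K. G (inv pos r))"
    by (rule sum.reindex_bij_betw[OF bij_betw_inv_into[OF pos], symmetric])
  then show ?thesis unfolding sum_even_odd by simp
qed

definition flat_prod :: "nat \<Rightarrow> ('n::finite \<Rightarrow> nat) \<Rightarrow> 'n bistructure" where
  "flat_prod K pos = prod_bi [flat_bi {i. pos i < 2 * K + 1} pos, flat_bi {i. pos i = 2 * K + 1} (\<lambda>_. 0)]"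

lemma flat_prod_simps:
  assumes pos: "bij_betw pos UNIV {..<2 * Suc K}"
  shows "coords (flat_prod K pos) = UNIV" "region (flat_prod K pos) = UNIV"
    "brack1 (flat_prod K pos) i j x = (if pos i < 2 * K + 1 \<and> pos j < 2 * K + 1 then flat1 (pos i) (pos j) else 0)"
    "brack2 (flat_prod K pos) i j x = (if pos i < 2 * K + 1 \<and> pos j < 2 * K + 1 then flat2 (pos i) (pos j) else 0)"
proof -
  have "pos i < 2 * Suc K" for i using bij_betwE[OF pos] by auto
  then have "pos i < 2 * K + 1 \<or> pos i = 2 * K + 1" for i using less_Suc_eq by fastforce
  then have *: "{i. pos i < 2 * K + 1} \<union> {i. pos i = 2 * K + 1} = UNIV" by blast
  show "coords (flat_prod K pos) = UNIV" "region (flat_prod K pos) = UNIV"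
    using * by (simp_all add: flat_prod_def prod_bi_def Let_def)
  show "brack1 (flat_prod K pos) i j x = (if pos i < 2 * K + 1 \<and> pos j < 2 * K + 1 then flat1 (pos i) (pos j) else 0)"
    "brack2 (flat_prod K pos) i j x = (if pos i < 2 * K + 1 \<and> pos j < 2 * K + 1 then flat2 (pos i) (pos j) else 0)"
    by (simp_all add: flat_prod_def prod_bi_def Let_def flat1_def flat2_def)
qed

text \<open>
  The functions \<open>H l\<close> are the coefficients of the Casimir functions of the pencil,
  \<open>s q\<close> are functions commuting in both brackets whose joint level sets are transversal to
  the common level sets of \<open>H l\<close> and \<open>A\<close>.
\<close>

locale lenard_chain =
  fixes P1 P2 :: "'n::finite \<Rightarrow> 'n \<Rightarrow> complex^'n \<Rightarrow> complex" and S :: "(complex^'n) set"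
    and H s :: "nat \<Rightarrow> complex^'n \<Rightarrow> complex" and A :: "complex^'n \<Rightarrow> complex" and K :: nat and pos :: "'n \<Rightarrow> nat"
  assumes S: "open S" and pos: "bij_betw pos UNIV {..<2 * Suc K}"
    and poisson: "\<And>U. open U \<Longrightarrow> U \<subseteq> S \<Longrightarrow> poisson_on UNIV U P1"
      "\<And>U. open U \<Longrightarrow> U \<subseteq> S \<Longrightarrow> poisson_on UNIV U P2"
    and hol_H: "\<And>l. mholomorphic_on S (H l)" and hol_s: "\<And>q. mholomorphic_on S (s q)" and hol_A: "mholomorphic_on S A"
    and chain_first: "\<And>f x. x \<in> S \<Longrightarrow> bracket UNIV P2 (H 0) f x = 0"
    and chain: "\<And>l f x. x \<in> S \<Longrightarrow> l < K \<Longrightarrow> bracket UNIV P2 (H (l + 1)) f x = - bracket UNIV P1 (H l) f x"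
    and chain_last: "\<And>f x. x \<in> S \<Longrightarrow> bracket UNIV P1 (H K) f x = 0"
    and casimir: "\<And>f x. x \<in> S \<Longrightarrow> bracket UNIV P1 A f x = 0" "\<And>f x. x \<in> S \<Longrightarrow> bracket UNIV P2 A f x = 0"
    and s_commute: "\<And>i j x. x \<in> S \<Longrightarrow> bracket UNIV P1 (s i) (s j) x = 0"
      "\<And>i j x. x \<in> S \<Longrightarrow> bracket UNIV P2 (s i) (s j) x = 0"
    and nondeg: "\<And>x \<gamma>. x \<in> S \<Longrightarrow> \<forall>l<K. (\<Sum>q<K. bracket UNIV P1 (H l) (s q) x * \<gamma> q) = 0 \<Longrightarrow> \<forall>q<K. \<gamma> q = 0"
    and casimir_indep: "\<And>x \<alpha> \<beta>. x \<in> S \<Longrightarrow> \<forall>i. \<alpha> * partial i (H K) x + \<beta> * partial i A x = 0 \<Longrightarrow> \<alpha> = 0 \<and> \<beta> = 0"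
begin

abbreviation "br1 \<equiv> bracket UNIV P1"
abbreviation "br2 \<equiv> bracket UNIV P2"

lemma anti1: "x \<in> S \<Longrightarrow> br1 f g x = - br1 g f x"
  by (rule poisson_on_antisym(2)[OF poisson(1)[OF S subset_refl]])

lemma anti2: "x \<in> S \<Longrightarrow> br2 f g x = - br2 g f x"
  by (rule poisson_on_antisym(2)[OF poisson(2)[OF S subset_refl]])

text \<open>The Lenard argument: going up the chain in one slot and down in the other turns the
  bracket of \<open>H l\<close> and \<open>H (m + 1)\<close> into that of \<open>H (l + 1)\<close>
  and \<open>H m\<close>, until an end of the chain is reached.\<close>

lemma H_commute1:
  assumes x: "x \<in> S"
  shows "l \<le> K \<Longrightarrow> m \<le> K \<Longrightarrow> br1 (H l) (H m) x = 0"
proof (induction m arbitrary: l)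
  case 0
  show ?case
  proof (cases "l < K")
    case True
    then show ?thesis using chain[OF x True, of "H 0"] anti2[OF x, of "H (l+1)" "H 0"] chain_first[OF x] by simp
  next
    case False
    then have "l = K" using 0 by simp
    then show ?thesis using chain_last[OF x] by simp
  qed
next
  case (Suc m)
  show ?case
  proof (cases "l < K")
    case True
    have "br1 (H l) (H (Suc m)) x = br2 (H (m + 1)) (H (l + 1)) x"
      using chain[OF x True, of "H (Suc m)"] anti2[OF x, of "H (l+1)" "H (Suc m)"] by simp
    also have "\<dots> = br1 (H (l + 1)) (H m) x"
      using chain[OF x, of m "H (l + 1)"] Suc.prems anti1[OF x, of "H (l+1)" "H m"] by simp
    finally show ?thesis using Suc.IH[of "l + 1"] Suc.prems True by simp
  next
    case False
    then have "l = K" using Suc.prems by simp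
    then show ?thesis using chain_last[OF x] by simp
  qed
qed

lemma chain_cases:
  assumes x: "x \<in> S" and l: "l \<le> K"
  shows "br2 (H l) f x = (if l = 0 then 0 else - br1 (H (l - 1)) f x)"
  using chain_first[OF x] chain[OF x, of "l - 1"] l by (cases l) auto

lemma H_commute2: "x \<in> S \<Longrightarrow> l \<le> K \<Longrightarrow> m \<le> K \<Longrightarrow> br2 (H l) (H m) x = 0"
  by (simp add: chain_cases H_commute1)

text \<open>The family \<open>g\<close> at the odd positions is a parameter because two coordinate
  systems are built: one with \<open>s\<close>, in which the primitives are computed, and one with
  the conjugate functions.\<close>

definition frame :: "(nat \<Rightarrow> complex^'n \<Rightarrow> complex) \<Rightarrow> nat \<Rightarrow> complex^'n \<Rightarrow> complex" where
  "frame g r = (if r = 2 * K + 1 then A else if even r then H (r div 2) else g (r div 2))"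

lemma pos_inv: "r < 2 * Suc K \<Longrightarrow> pos (inv pos r) = r"
  using pos by (simp add: bij_betw_inv_into_right)

lemma frame_even [simp]: "l \<le> K \<Longrightarrow> frame g (2 * l) = H l"
  by (auto simp: frame_def)

lemma frame_odd [simp]: "q < K \<Longrightarrow> frame g (Suc (2 * q)) = g q"
  by (auto simp: frame_def)

lemma frame_last [simp]: "frame g (Suc (2 * K)) = A"
  by (simp add: frame_def)

lemma sum_frame:
  "(\<Sum>j\<in>UNIV. \<alpha> j * T (frame g (pos j))) = (\<Sum>l<Suc K. \<alpha> (inv pos (2 * l)) * T (H l))
    + (\<Sum>q<K. \<alpha> (inv pos (2 * q + 1)) * T (g q)) + \<alpha> (inv pos (2 * K + 1)) * T A"
  for T :: "(complex^'n \<Rightarrow> complex) \<Rightarrow> complex"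
proof -
  have "2 * K + 1 < 2 * Suc K" by simp
  then show ?thesis
    by (simp add: sum_positions[OF pos] pos_inv)
qed

lemma pos_cases:
  obtains l where "l \<le> K" "pos i = 2 * l" | q where "q < K" "pos i = 2 * q + 1" | "pos i = 2 * K + 1"
proof -
  have "pos i < 2 * Suc K" using bij_betwE[OF pos] by auto
  show ?thesis
  proof (cases "even (pos i)")
    case True
    then show ?thesis using that(1)[of "pos i div 2"] \<open>pos i < 2 * Suc K\<close> by auto
  next
    case False
    then have "pos i = 2 * (pos i div 2) + 1" by simp
    then show ?thesis
      using that(2)[of "pos i div 2"] that(3) \<open>pos i < 2 * Suc K\<close> by (cases "pos i div 2 < K") auto
  qed
qed

text \<open>A vanishing combination of differentials is paired with Hamiltonian fields. The fields
  of \<open>H l\<close> see only the functions \<open>g\<close>, and one inverse relation removes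
  these coefficients; the fields of \<open>g q\<close> then see only \<open>H l\<close> with
  \<open>l < K\<close>, removed by the other. What remains is a relation between the Casimir
  functions \<open>H K\<close> and \<open>A\<close>.\<close>

lemma frame_independent:
  assumes x: "x \<in> S"
    and right: "\<And>l p. l < K \<Longrightarrow> p < K \<Longrightarrow> (\<Sum>q<K. br1 (H l) (g q) x * n q p) = (if l = p then 1 else 0)"
    and left: "\<And>q r. q < K \<Longrightarrow> r < K \<Longrightarrow> (\<Sum>p<K. n q p * br1 (H p) (g r) x) = (if q = r then 1 else 0)"
    and \<alpha>: "\<forall>i. (\<Sum>j\<in>UNIV. \<alpha> j * partial i (frame g (pos j)) x) = 0"
  shows "\<forall>j. \<alpha> j = 0"
proof -
  have pair: "(\<Sum>j\<in>UNIV. \<alpha> j * br1 h (frame g (pos j)) x) = 0" for h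
  proof -
    have "(\<Sum>j\<in>UNIV. \<alpha> j * br1 h (frame g (pos j)) x) =
      (\<Sum>j\<in>UNIV. \<Sum>i\<in>UNIV. (\<Sum>a\<in>UNIV. P1 a i x * partial a h x) * (\<alpha> j * partial i (frame g (pos j)) x))"
      by (simp add: bracket_swap_sum sum_distrib_left mult_ac)
    also have "\<dots> = (\<Sum>i\<in>UNIV. (\<Sum>a\<in>UNIV. P1 a i x * partial a h x) * (\<Sum>j\<in>UNIV. \<alpha> j * partial i (frame g (pos j)) x))"
      by (subst sum.swap) (simp add: sum_distrib_left)
    finally show ?thesis using \<alpha> by simp
  qed
  have A0: "br1 f A x = 0" for f using anti1[OF x, of f A] casimir(1)[OF x] by simp
  have odd: "\<alpha> (inv pos (2 * q + 1)) = 0" if "q < K" for q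
  proof -
    have 1: "(\<Sum>r<K. br1 (H l) (g r) x * \<alpha> (inv pos (2 * r + 1))) = 0" if "l < K" for l
      using pair[of "H l"] that unfolding sum_frame[where T="\<lambda>u. br1 (H l) u x"]
      by (simp add: H_commute1[OF x] A0 mult.commute)
    have "\<alpha> (inv pos (2 * q + 1)) = (\<Sum>r<K. (if q = r then 1 else 0) * \<alpha> (inv pos (2 * r + 1)))"
      using that by (simp add: if_distrib[of "\<lambda>u. u * _"] cong: if_cong)
    also have "\<dots> = (\<Sum>r<K. (\<Sum>p<K. n q p * br1 (H p) (g r) x) * \<alpha> (inv pos (2 * r + 1)))"
      using that by (intro sum.cong refl arg_cong2[of _ _ _ _ "(*)"]) (auto simp: left)
    also have "\<dots> = (\<Sum>r<K. \<Sum>p<K. n q p * (br1 (H p) (g r) x * \<alpha> (inv pos (2 * r + 1))))"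
      by (simp add: sum_distrib_right mult.assoc)
    also have "\<dots> = (\<Sum>p<K. n q p * (\<Sum>r<K. br1 (H p) (g r) x * \<alpha> (inv pos (2 * r + 1))))"
      by (subst sum.swap) (simp add: sum_distrib_left)
    also have "\<dots> = 0" using 1 by (intro sum.neutral) auto
    finally show ?thesis .
  qed
  have even: "\<alpha> (inv pos (2 * p)) = 0" if "p < K" for p
  proof -
    have 1: "(\<Sum>l<K. \<alpha> (inv pos (2 * l)) * br1 (H l) (g q) x) = 0" if "q < K" for q
    proof -
      have last: "br1 (g q) (H K) x = 0" using anti1[OF x, of "g q" "H K"] chain_last[OF x] by simp
      have "(\<Sum>l<Suc K. \<alpha> (inv pos (2 * l)) * br1 (g q) (H l) x) = 0"
        using pair[of "g q"] odd unfolding sum_frame[where T="\<lambda>u. br1 (g q) u x"] by (simp add: A0)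
      then have "(\<Sum>l<K. \<alpha> (inv pos (2 * l)) * br1 (g q) (H l) x) = 0" by (simp add: last)
      moreover have "(\<Sum>l<K. \<alpha> (inv pos (2 * l)) * br1 (g q) (H l) x) =
          - (\<Sum>l<K. \<alpha> (inv pos (2 * l)) * br1 (H l) (g q) x)"
        by (subst anti1[OF x]) (simp add: sum_negf)
      ultimately show ?thesis by simp
    qed
    have "\<alpha> (inv pos (2 * p)) = (\<Sum>l<K. \<alpha> (inv pos (2 * l)) * (if l = p then 1 else 0))"
      using that by (simp add: if_distrib[of "\<lambda>u. _ * u"] cong: if_cong)
    also have "\<dots> = (\<Sum>l<K. \<alpha> (inv pos (2 * l)) * (\<Sum>q<K. br1 (H l) (g q) x * n q p))"
      using that by (intro sum.cong refl arg_cong2[of _ _ _ _ "(*)"]) (auto simp: right)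
    also have "\<dots> = (\<Sum>l<K. \<Sum>q<K. (\<alpha> (inv pos (2 * l)) * br1 (H l) (g q) x) * n q p)"
      by (simp add: sum_distrib_left mult.assoc)
    also have "\<dots> = (\<Sum>q<K. (\<Sum>l<K. \<alpha> (inv pos (2 * l)) * br1 (H l) (g q) x) * n q p)"
      by (subst sum.swap) (simp add: sum_distrib_right)
    also have "\<dots> = 0" using 1 by (intro sum.neutral) auto
    finally show ?thesis .
  qed
  have "\<alpha> (inv pos (2 * K)) * partial i (H K) x + \<alpha> (inv pos (2 * K + 1)) * partial i A x = 0" for i
  proof -
    have "(\<Sum>l<Suc K. \<alpha> (inv pos (2 * l)) * partial i (H l) x) = \<alpha> (inv pos (2 * K)) * partial i (H K) x"
      using even by simp
    then show ?thesis
      using spec[OF \<alpha>, of i] odd unfolding sum_frame[where T="\<lambda>u. partial i u x"] by simp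
  qed
  then have last: "\<alpha> (inv pos (2 * K)) = 0" "\<alpha> (inv pos (2 * K + 1)) = 0"
    using casimir_indep[OF x] by blast+
  show ?thesis
  proof
    fix j
    have j: "inv pos (pos j) = j" using pos by (simp add: bij_betw_def inv_f_f)
    show "\<alpha> j = 0"
    proof (rule pos_cases[of j])
      fix l assume "l \<le> K" "pos j = 2 * l"
      then show ?thesis using even[of l] last(1) j by (cases "l = K") auto
    next
      fix q assume "q < K" "pos j = 2 * q + 1"
      then show ?thesis using odd[of q] j by auto
    next
      assume "pos j = 2 * K + 1"
      then show ?thesis using last(2) j by auto
    qed
  qed
qed


lemma frame_mholomorphic_on:
  assumes "U \<subseteq> S" "\<And>q. q < K \<Longrightarrow> mholomorphic_on U (g q)"
  shows "mholomorphic_on U (frame g (pos j))"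
proof (rule pos_cases[of j])
  fix l assume "l \<le> K" "pos j = 2 * l"
  then show ?thesis using mholomorphic_on_subset[OF hol_H assms(1)] by simp
next
  fix q assume "q < K" "pos j = 2 * q + 1"
  then show ?thesis using assms(2) by simp
next
  assume "pos j = 2 * K + 1"
  then show ?thesis using mholomorphic_on_subset[OF hol_A assms(1)] by simp
qed

text \<open>The second bracket is not assumed for pairs of \<open>H\<close> and \<open>g\<close>:
  the chain gives \<open>{H (p + 1), g p}\<^sub>2 = - {H p, g p}\<^sub>1 = -1\<close>, which is the
  sign convention of \<open>flat2\<close>.\<close>

lemma frame_bracket_table:
  assumes x: "x \<in> S"
    and Hg: "\<And>l p. l \<le> K \<Longrightarrow> p < K \<Longrightarrow> br1 (H l) (g p) x = (if l = p then 1 else 0)"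
    and gg: "\<And>p q. p < K \<Longrightarrow> q < K \<Longrightarrow> br1 (g p) (g q) x = 0" "\<And>p q. p < K \<Longrightarrow> q < K \<Longrightarrow> br2 (g p) (g q) x = 0"
  shows "br1 (frame g (pos i)) (frame g (pos j)) x = brack1 (flat_prod K pos) i j y"
    and "br2 (frame g (pos i)) (frame g (pos j)) x = brack2 (flat_prod K pos) i j y"
proof -
  have Hg2: "br2 (H l) (g p) x = (if l = Suc p then -1 else 0)" if "l \<le> K" "p < K" for l p
    using chain_cases[OF x that(1), of "g p"] that by (cases l) (auto simp: Hg)
  have gH: "br1 (g p) (H l) x = (if l = p then -1 else 0)" "br2 (g p) (H l) x = (if l = Suc p then 1 else 0)"
    if "l \<le> K" "p < K" for l p
    using anti1[OF x, of "g p" "H l"] anti2[OF x, of "g p" "H l"] Hg[OF that] Hg2[OF that] by auto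
  have cA: "br1 f A x = 0" "br2 f A x = 0" for f
    using anti1[OF x, of f A] anti2[OF x, of f A] casimir[OF x] by auto
  note rules = H_commute1[OF x] H_commute2[OF x] Hg Hg2 gH gg cA casimir[OF x] flat_prod_simps[OF pos] flat1_def flat2_def
  have "br1 (frame g (pos i)) (frame g (pos j)) x = brack1 (flat_prod K pos) i j y \<and>
    br2 (frame g (pos i)) (frame g (pos j)) x = brack2 (flat_prod K pos) i j y"
  proof (rule pos_cases[of i]; rule pos_cases[of j])
    fix l l' assume "l \<le> K" "pos i = 2 * l" "l' \<le> K" "pos j = 2 * l'"
    then show ?thesis by (simp add: rules) presburger
  next
    fix l q assume "l \<le> K" "pos i = 2 * l" "q < K" "pos j = 2 * q + 1"
    then show ?thesis by (auto simp: rules)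
  next
    fix q l assume "q < K" "pos i = 2 * q + 1" "l \<le> K" "pos j = 2 * l"
    then show ?thesis by (auto simp: rules)
  next
    fix q q' assume "q < K" "pos i = 2 * q + 1" "q' < K" "pos j = 2 * q' + 1"
    then show ?thesis by (simp add: rules) presburger
  qed (simp_all add: rules)
  then show "br1 (frame g (pos i)) (frame g (pos j)) x = brack1 (flat_prod K pos) i j y"
    "br2 (frame g (pos i)) (frame g (pos j)) x = brack2 (flat_prod K pos) i j y" by auto
qed

theorem straightening:
  fixes M :: "'n bistructure"
  assumes M: "coords M = UNIV" "brack1 M = P1" "brack2 M = P2" "S \<subseteq> region M" and p: "p \<in> S"
  shows "isomorphic_near p M (flat_prod K pos)"
proof -
  define m where "m = (\<lambda>l q. br1 (H l) (s q))"
  have P1_hol: "mholomorphic_on S (P1 i j)" and P2_hol: "mholomorphic_on S (P2 i j)" for i j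
    using poisson[OF S subset_refl] unfolding poisson_on_def by auto
  have m_hol: "mholomorphic_on S (m l q)" for l q
    unfolding m_def by (intro bracket_mholomorphic_on S P1_hol hol_H hol_s)
  have "CARD('n) = 2 * Suc K" using bij_betw_same_card[OF pos] by simp
  then have "K \<le> CARD('n)" by simp
  then obtain n where n_hol: "\<And>q p. q < K \<Longrightarrow> p < K \<Longrightarrow> mholomorphic_on S (n q p)"
    and mn: "\<And>x l p. x \<in> S \<Longrightarrow> l < K \<Longrightarrow> p < K \<Longrightarrow> (\<Sum>q<K. m l q x * n q p x) = (if l = p then 1 else 0)"
    and nm: "\<And>x q r. x \<in> S \<Longrightarrow> q < K \<Longrightarrow> r < K \<Longrightarrow> (\<Sum>p<K. n q p x * m p r x) = (if q = r then 1 else 0)"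
    using mholomorphic_inverse_matrix[of K S m] m_hol nondeg unfolding m_def by blast
  define \<Phi> where "\<Phi> = (\<lambda>x. \<chi> j. frame s (pos j) x)"
  have \<Phi>_eq: "(\<lambda>x. \<Phi> x $ j) = frame s (pos j)" for j by (simp add: \<Phi>_def)
  have \<Phi>_hol: "mholomorphic_on S (\<lambda>x. \<Phi> x $ j)" for j
    unfolding \<Phi>_eq by (rule frame_mholomorphic_on[OF subset_refl hol_s])
  have indep: "\<forall>j. \<alpha> j = 0" if "\<forall>i. (\<Sum>j\<in>UNIV. \<alpha> j * partial i (\<lambda>x. \<Phi> x $ j) p) = 0" for \<alpha>
    using frame_independent[OF p, of s "\<lambda>q r. n q r p" \<alpha>] mn[OF p] nm[OF p] that unfolding m_def \<Phi>_eq by simp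
  obtain U V \<Psi> where U: "open U" "U \<subseteq> S" "p \<in> U" "open V" "\<Phi> ` U = V" "\<Psi> ` V = U"
    "\<And>x. x \<in> U \<Longrightarrow> \<Psi> (\<Phi> x) = x" "\<And>y. y \<in> V \<Longrightarrow> \<Phi> (\<Psi> y) = y"
    "\<And>i. mholomorphic_on V (\<lambda>y. \<Psi> y $ i)"
    using holomorphic_local_inverse[OF S p \<Phi>_hol indep] by blast
  define c where "c = \<Phi> p"
  obtain r where r: "r > 0" "ball c r \<subseteq> V" using U unfolding c_def by (meson imageI open_contains_ball)
  define B where "B = ball c r"
  have B: "open B" "B \<subseteq> V" "c \<in> B" using r by (auto simp: B_def)
  define U0 where "U0 = {x \<in> U. \<Phi> x \<in> B}"
  have "continuous_on U \<Phi>"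
    unfolding \<Phi>_def
    by (intro continuous_on_vec_lambda mholomorphic_on_imp_continuous_on frame_mholomorphic_on U
        mholomorphic_on_subset[OF hol_s])
  moreover have "U0 = U \<inter> \<Phi> -` B" by (auto simp: U0_def)
  ultimately have U0: "open U0"
    using continuous_open_preimage[OF _ U(1) B(1), of \<Phi>] by simp
  have U0S: "U0 \<subseteq> S" and pU0: "p \<in> U0" and \<Phi>U0: "\<Phi> ` U0 \<subseteq> B"
    using U B by (auto simp: U0_def c_def)
  have \<Psi>B: "\<Psi> z \<in> U0" "\<Phi> (\<Psi> z) = z" if "z \<in> B" for z
    using that U B by (auto simp: U0_def)
  have \<Psi>\<Phi>: "\<Psi> (\<Phi> x) = x" if "x \<in> U0" for x using that U by (auto simp: U0_def)
  have \<Phi>_hol0: "mholomorphic_on U0 (\<lambda>x. \<Phi> x $ j)" for j by (rule mholomorphic_on_subset[OF \<Phi>_hol U0S])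
  have \<Psi>_hol: "mholomorphic_on B (\<lambda>y. \<Psi> y $ i)" for i by (rule mholomorphic_on_subset[OF U(9) B(2)])
  have pull: "mholomorphic_on B (\<lambda>z. f (\<Psi> z))" if "mholomorphic_on U0 f" for f
    using mholomorphic_on_compose[OF that \<Psi>_hol] \<Psi>B by (auto simp: comp_def)
  have push: "mholomorphic_on U0 (\<lambda>x. g (\<Phi> x))" if "mholomorphic_on B g" for g
    using mholomorphic_on_compose[OF that \<Phi>_hol0 \<Phi>U0] by (simp add: comp_def)
  define e where "e = (\<lambda>q. inv pos (2 * q + 1))"
  define D where "D = e ` {..<K}"
  have pe: "pos (e q) = 2 * q + 1" if "q < K" for q unfolding e_def using that by (intro pos_inv) simp
  \<comment> \<open>In the coordinates \<open>\<Phi>\<close> the field of \<open>H l\<close> has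
    components only in the directions of \<open>s\<close>, since \<open>H l\<close> commutes with
    every \<open>H\<close> and with \<open>A\<close>.\<close>
  have H_along: "br1 (H l) f x = (\<Sum>q<K. m l q x * partial (e q) g (\<Phi> x))"
    if g: "mholomorphic_on B g" and fg: "\<And>y. y \<in> U0 \<Longrightarrow> f y = g (\<Phi> y)" and x: "x \<in> U0" and l: "l \<le> K" for l f g x
  proof -
    have xS: "x \<in> S" using x U0S by blast
    have A0: "br1 (H l) A x = 0" using anti1[OF xS, of _ A] casimir(1)[OF xS] by simp
    have "br1 (H l) f x = br1 (H l) (g \<circ> \<Phi>) x"
      by (rule bracket_cong_open[OF U0 x]) (simp_all add: fg)
    also have "\<dots> = (\<Sum>a\<in>UNIV. br1 (H l) (frame s (pos a)) x * partial a g (\<Phi> x))"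
      using bracket_compose_right[OF U0 B(1) x \<Phi>_hol0 \<Phi>U0 g] by (simp add: \<Phi>_eq)
    also have "\<dots> = (\<Sum>q<K. m l q x * partial (e q) g (\<Phi> x))"
      unfolding sum_positions[OF pos] using l by (simp add: pos_inv H_commute1[OF xS] A0 m_def e_def)
    finally show ?thesis .
  qed
  \<comment> \<open>For \<open>j = e q\<close> the position is \<open>2 * q + 1\<close>, so
    \<open>pos j div 2\<close> recovers \<open>q\<close>.\<close>
  define \<nu> where "\<nu> = (\<lambda>p j z. n (pos j div 2) p (\<Psi> z))"
  have n_hol0: "mholomorphic_on B (\<lambda>z. n q p (\<Psi> z))" if "q < K" "p < K" for q p
    by (rule pull[OF mholomorphic_on_subset[OF n_hol[OF that] U0S]])
  have m_hol0: "mholomorphic_on B (\<lambda>z. m l q (\<Psi> z))" for l q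
    by (rule pull[OF mholomorphic_on_subset[OF m_hol U0S]])
  have \<nu>_e: "\<nu> p (e q) = (\<lambda>z. n q p (\<Psi> z))" if "q < K" for p q using pe[OF that] by (simp add: \<nu>_def)
  have \<nu>_hol: "mholomorphic_on B (\<nu> p j)" if "p < K" "j \<in> D" for p j
    using that n_hol0 by (auto simp: D_def \<nu>_e)
  have closed: "partial i (\<nu> p j) z = partial j (\<nu> p i) z" if pij: "p < K" "i \<in> D" "j \<in> D" and z: "z \<in> B" for p i j z
  proof -
    define x where "x = \<Psi> z"
    have x: "x \<in> U0" "x \<in> S" "\<Phi> x = z" using \<Psi>B[OF z] U0S by (auto simp: x_def)
    obtain q b where qb: "q < K" "i = e q" "b < K" "j = e b" using pij by (auto simp: D_def)
    have "partial (e q) (\<lambda>z. n b p (\<Psi> z)) z = partial (e b) (\<lambda>z. n q p (\<Psi> z)) z"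
    proof (rule dual_forms_closed[where K=K and m="\<lambda>l q. m l q x" and n="\<lambda>q p. n q p x"
          and dm="\<lambda>q l b. partial (e q) (\<lambda>z. m l b (\<Psi> z)) z" and \<nu>="\<lambda>b. n b p x"
          and c="\<lambda>q b. partial (e q) (\<lambda>z. n b p (\<Psi> z)) z"])
      show "(\<Sum>p<K. n q p x * m p r x) = (if q = r then 1 else 0)" if "q < K" "r < K" for q r
        by (rule nm[OF x(2) that])
      show "(\<Sum>b<K. partial (e q) (\<lambda>z. m l b (\<Psi> z)) z * n b p x + m l b x * partial (e q) (\<lambda>z. n b p (\<Psi> z)) z) = 0"
        if "q < K" "l < K" for q l
      proof -
        have "(\<Sum>b<K. partial (e q) (\<lambda>z. m l b (\<Psi> z)) z * n b p x + m l b x * partial (e q) (\<lambda>z. n b p (\<Psi> z)) z)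
          = partial (e q) (\<lambda>z. \<Sum>b<K. m l b (\<Psi> z) * n b p (\<Psi> z)) z"
        proof (subst partial_sum[OF B(1) z])
          show "mholomorphic_on B (\<lambda>z. m l b (\<Psi> z) * n b p (\<Psi> z))" if "b \<in> {..<K}" for b
            using that pij by (intro mholomorphic_on_mult m_hol0 n_hol0) auto
          show "(\<Sum>b<K. partial (e q) (\<lambda>z. m l b (\<Psi> z)) z * n b p x + m l b x * partial (e q) (\<lambda>z. n b p (\<Psi> z)) z) =
            (\<Sum>b<K. partial (e q) (\<lambda>z. m l b (\<Psi> z) * n b p (\<Psi> z)) z)"
            using pij by (intro sum.cong refl) (simp add: partial_mult[OF B(1) z m_hol0 n_hol0] x_def)
        qed
        also have "\<dots> = partial (e q) (\<lambda>z. if l = p then 1 else 0) z"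
          using \<Psi>B U0S mn that \<open>p < K\<close> by (intro partial_cong_open[OF B(1) z]) blast
        finally show ?thesis by simp
      qed
      show "(\<Sum>q<K. m l q x * partial (e q) (\<lambda>z. m l' b (\<Psi> z)) z) =
          (\<Sum>q<K. m l' q x * partial (e q) (\<lambda>z. m l b (\<Psi> z)) z)" if "l < K" "l' < K" "b < K" for l l' b
      proof -
        \<comment> \<open>Commutation of the fields comes from the Jacobi identity applied to
          \<open>s b\<close>; \<open>H_along\<close> rewrites the outer bracket as derivatives of
          the coefficients \<open>m\<close>.\<close>
        have "br1 (H l) (br1 (H l') (s b)) x = br1 (H l') (br1 (H l) (s b)) x"
          using that H_commute1 by (intro poisson_on_jacobi_commute[OF poisson(1)[OF S subset_refl] S x(2) hol_H hol_H hol_s]) auto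
        moreover have "br1 (H l) (br1 (H l') (s b)) x = (\<Sum>q<K. m l q x * partial (e q) (\<lambda>z. m l' b (\<Psi> z)) z)" if "l < K" for l l'
          using H_along[OF m_hol0, of "br1 (H l') (s b)" l' b x l] \<Psi>\<Phi> x that by (simp add: m_def)
        ultimately show ?thesis using that by simp
      qed
    qed (use qb in auto)
    then show ?thesis using qb by (simp add: \<nu>_e)
  qed
  have "\<forall>p. \<exists>Y. p < K \<longrightarrow> mholomorphic_on B Y \<and> (\<forall>j z. j \<in> D \<longrightarrow> z \<in> B \<longrightarrow> partial j Y z = \<nu> p j z)
      \<and> (\<forall>z. (\<forall>j\<in>D. z $ j = c $ j) \<longrightarrow> Y z = 0)"
  proof
    fix p
    show "\<exists>Y. p < K \<longrightarrow> mholomorphic_on B Y \<and> (\<forall>j z. j \<in> D \<longrightarrow> z \<in> B \<longrightarrow> partial j Y z = \<nu> p j z)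
      \<and> (\<forall>z. (\<forall>j\<in>D. z $ j = c $ j) \<longrightarrow> Y z = 0)"
    proof (cases "p < K")
      case True
      show ?thesis
        by (rule relative_poincare[OF B_def \<nu>_hol[OF True] closed[OF True]]) auto
    qed simp
  qed
  from choice[OF this] obtain Y where Y: "\<And>p. p < K \<Longrightarrow> mholomorphic_on B (Y p)"
    "\<And>p j z. p < K \<Longrightarrow> j \<in> D \<Longrightarrow> z \<in> B \<Longrightarrow> partial j (Y p) z = \<nu> p j z"
    "\<And>p z. p < K \<Longrightarrow> \<forall>j\<in>D. z $ j = c $ j \<Longrightarrow> Y p z = 0" by blast
  define y where "y = (\<lambda>p x. Y p (\<Phi> x))"
  have y_hol: "mholomorphic_on U0 (y p)" if "p < K" for p unfolding y_def by (rule push[OF Y(1)[OF that]])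
  have Hy: "br1 (H l) (y p) x = (if l = p then 1 else 0)" if "l \<le> K" "p < K" and x: "x \<in> U0" for l p x
  proof (cases "l = K")
    case True
    then show ?thesis using that U0S chain_last by auto
  next
    case False
    have "br1 (H l) (y p) x = (\<Sum>q<K. m l q x * partial (e q) (Y p) (\<Phi> x))"
      by (rule H_along[OF Y(1)]) (use that in \<open>auto simp: y_def\<close>)
    also have "\<dots> = (\<Sum>q<K. m l q x * n q p x)"
    proof (intro sum.cong refl)
      fix q assume "q \<in> {..<K}"
      then show "m l q x * partial (e q) (Y p) (\<Phi> x) = m l q x * n q p x"
        using Y(2)[OF \<open>p < K\<close>, of "e q" "\<Phi> x"] \<Phi>U0 x by (auto simp: D_def \<nu>_e \<Psi>\<Phi>)
    qed
    also have "\<dots> = (if l = p then 1 else 0)" using that False U0S by (intro mn) auto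
    finally show ?thesis .
  qed
  have Hy2: "br2 (H (Suc l)) (y p) x = (if l = p then -1 else 0)" if "l < K" "p < K" "x \<in> U0" for l p x
    using chain[of x l "y p"] Hy[of l p x] that U0S by auto
  \<comment> \<open>A function annihilated by all fields of \<open>H l\<close> has zero derivatives
    along \<open>D\<close>, because the coefficient matrix \<open>m\<close> of these fields is
    invertible. Its value on the slice then decides.\<close>
  have vanish: "f x = 0"
    if f: "mholomorphic_on U0 f" and Hf: "\<And>l x. l < K \<Longrightarrow> x \<in> U0 \<Longrightarrow> br1 (H l) f x = 0"
      and slice: "\<And>x. x \<in> U0 \<Longrightarrow> \<forall>j\<in>D. \<Phi> x $ j = c $ j \<Longrightarrow> f x = 0" and x: "x \<in> U0" for f x
  proof -
    define F where "F = (\<lambda>z. f (\<Psi> z))"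
    have F: "mholomorphic_on B F" unfolding F_def by (rule pull[OF f])
    have "partial j F z = 0" if "j \<in> D" "z \<in> B" for j z
    proof -
      obtain r where r: "r < K" "j = e r" using \<open>j \<in> D\<close> by (auto simp: D_def)
      let ?x = "\<Psi> z"
      have x: "?x \<in> U0" "?x \<in> S" "\<Phi> ?x = z" using \<Psi>B[OF \<open>z \<in> B\<close>] U0S by auto
      have 0: "(\<Sum>q<K. m l q ?x * partial (e q) F z) = 0" if "l < K" for l
        using H_along[OF F, of f ?x l] Hf[OF that x(1)] x \<Psi>\<Phi> that by (simp add: F_def)
      have "partial (e r) F z = (\<Sum>q<K. (if r = q then 1 else 0) * partial (e q) F z)"
        using r by (simp add: if_distrib[of "\<lambda>u. u * _"] cong: if_cong)
      also have "\<dots> = (\<Sum>q<K. (\<Sum>l<K. n r l ?x * m l q ?x) * partial (e q) F z)"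
        using r by (intro sum.cong refl arg_cong2[of _ _ _ _ "(*)"]) (auto simp: nm[OF x(2)])
      also have "\<dots> = (\<Sum>l<K. n r l ?x * (\<Sum>q<K. m l q ?x * partial (e q) F z))"
        unfolding sum_distrib_right sum_distrib_left by (subst sum.swap) (simp add: mult.assoc)
      also have "\<dots> = 0" by (simp add: 0)
      finally show ?thesis using r by simp
    qed
    note zero = this
    have \<Phi>x: "\<Phi> x \<in> B" using \<Phi>U0 x by blast
    note w = relative_constant[OF B_def F zero \<Phi>x]
    have "F (\<chi> i. if i \<in> D then c $ i else \<Phi> x $ i) = 0"
      unfolding F_def using \<Psi>B[OF w(1)] by (intro slice) auto
    with w(2) show ?thesis by (simp add: F_def \<Psi>\<Phi>[OF x])
  qed
  have yy_slice: "bracket UNIV P (y a) (y b) x = 0"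
    if "a < K" "b < K" "x \<in> U0" and on: "\<forall>j\<in>D. \<Phi> x $ j = c $ j"
      and ss: "\<And>i j. bracket UNIV P (s i) (s j) x = 0" for P a b x
  proof -
    \<comment> \<open>Changing a coordinate outside \<open>D\<close> stays on the slice.
      \<open>partial\<close> is taken along a line that may leave \<open>B\<close>, so it matters
      that \<open>Y a\<close> vanishes on the entire slice. On the slice only the brackets of the
      \<open>s q\<close> contribute, and these are zero.\<close>
    have off: "partial i (Y a) (\<Phi> x) = 0" if "i \<notin> D" "a < K" for i a
    proof -
      have "Y a (\<chi> j. if j = i then z else \<Phi> x $ j) = 0" for z
        using that on by (intro Y(3)) auto
      then show ?thesis by (simp add: partial_def)
    qed
    have "bracket UNIV P (Y a \<circ> \<Phi>) (Y b \<circ> \<Phi>) x = (\<Sum>i\<in>UNIV. \<Sum>j\<in>UNIV. bracket UNIV P (frame s (pos i)) (frame s (pos j)) x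
      * partial i (Y a) (\<Phi> x) * partial j (Y b) (\<Phi> x))"
      using bracket_compose[OF U0 B(1) \<open>x \<in> U0\<close> \<Phi>_hol0 \<Phi>U0 Y(1)[OF \<open>a < K\<close>] Y(1)[OF \<open>b < K\<close>]] by (simp add: \<Phi>_eq)
    also have "\<dots> = 0"
    proof (intro sum.neutral ballI)
      fix i j
      show "bracket UNIV P (frame s (pos i)) (frame s (pos j)) x * partial i (Y a) (\<Phi> x) * partial j (Y b) (\<Phi> x) = 0"
        using off[OF _ \<open>a < K\<close>, of i] off[OF _ \<open>b < K\<close>, of j]
        by (cases "i \<in> D \<and> j \<in> D") (auto simp: D_def pe ss)
    qed
    finally show ?thesis by (simp add: y_def comp_def)
  qed
  have yy_hol: "mholomorphic_on U0 (bracket UNIV P (y a) (y b))"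
    if "a < K" "b < K" "\<And>i j. mholomorphic_on S (P i j)" for P a b
    using that by (intro bracket_mholomorphic_on U0 y_hol mholomorphic_on_subset[OF _ U0S]) auto
  have y_commute1: "br1 (y a) (y b) x = 0" if "a < K" "b < K" and x: "x \<in> U0" for a b x
  proof (rule vanish[OF yy_hol[OF that(1,2) P1_hol] _ _ x])
    show "br1 (H l) (br1 (y a) (y b)) x = 0" if l: "l < K" and x: "x \<in> U0" for l x
      using Hy[of l] l \<open>a < K\<close> \<open>b < K\<close>
      by (intro poisson_on_jacobi_const[OF poisson(1)[OF U0 U0S] U0 x mholomorphic_on_subset[OF hol_H U0S] y_hol y_hol]) auto
    show "br1 (y a) (y b) x = 0" if "x \<in> U0" "\<forall>j\<in>D. \<Phi> x $ j = c $ j" for x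
      using yy_slice[OF \<open>a < K\<close> \<open>b < K\<close> that] s_commute that U0S by blast
  qed
  have y_commute2: "br2 (y a) (y b) x = 0" if "a < K" "b < K" and x: "x \<in> U0" for a b x
  proof (rule vanish[OF yy_hol[OF that(1,2) P2_hol] _ _ x])
    show "br1 (H l) (br2 (y a) (y b)) x = 0" if l: "l < K" and x: "x \<in> U0" for l x
    proof -
      \<comment> \<open>The bracket of \<open>H (Suc l)\<close> with each \<open>y\<close> is
        constant in the second structure, so the Jacobi identity is used there; the chain then
        converts the field of \<open>H (Suc l)\<close> back into that of \<open>H l\<close> for the
        first bracket.\<close>
      have "br2 (H (Suc l)) (br2 (y a) (y b)) x = 0"
        using Hy2[OF l] \<open>a < K\<close> \<open>b < K\<close>
        by (intro poisson_on_jacobi_const[OF poisson(2)[OF U0 U0S] U0 x mholomorphic_on_subset[OF hol_H U0S] y_hol y_hol]) auto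
      then show ?thesis using chain[of x l "br2 (y a) (y b)"] l x U0S by auto
    qed
    show "br2 (y a) (y b) x = 0" if "x \<in> U0" "\<forall>j\<in>D. \<Phi> x $ j = c $ j" for x
      using yy_slice[OF \<open>a < K\<close> \<open>b < K\<close> that] s_commute that U0S by blast
  qed
  define \<phi> where "\<phi> = (\<lambda>x. \<chi> j. frame y (pos j) x)"
  have \<phi>_eq: "(\<lambda>x. \<phi> x $ j) = frame y (pos j)" for j by (simp add: \<phi>_def)
  have table: "br1 (frame y (pos i)) (frame y (pos j)) x = brack1 (flat_prod K pos) i j z"
    "br2 (frame y (pos i)) (frame y (pos j)) x = brack2 (flat_prod K pos) i j z" if "x \<in> U0" for x i j z
    using frame_bracket_table[of x y i j z] that U0S Hy y_commute1 y_commute2 by blast+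
  show ?thesis
  proof (rule isomorphic_nearI[OF M(1) flat_prod_simps(1,2)[OF pos] U0 _ pU0, of \<phi>])
    show "U0 \<subseteq> region M" using U0S M by blast
    show "mholomorphic_on U0 (\<lambda>x. \<phi> x $ j)" for j
      unfolding \<phi>_eq by (rule frame_mholomorphic_on[OF U0S y_hol])
    show "\<forall>j. \<alpha> j = 0" if "\<forall>i. (\<Sum>j\<in>UNIV. \<alpha> j * partial i (\<lambda>x. \<phi> x $ j) p) = 0" for \<alpha>
    proof (rule frame_independent[OF p, of y "\<lambda>q r. if q = r then 1 else 0"])
      show "(\<Sum>q<K. br1 (H l) (y q) p * (if q = p' then 1 else 0)) = (if l = p' then 1 else 0)"
        if "l < K" "p' < K" for l p'
        using that Hy[OF _ _ pU0] by (simp add: if_distrib[of "\<lambda>u. _ * u"] cong: if_cong)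
      show "(\<Sum>p'<K. (if q = p' then 1 else 0) * br1 (H p') (y r) p) = (if q = r then 1 else 0)"
        if "q < K" "r < K" for q r
        using that Hy[OF _ _ pU0] by (simp add: if_distrib[of "\<lambda>u. u * _"] cong: if_cong)
    qed (use that in \<open>simp add: \<phi>_eq\<close>)
  qed (simp_all only: \<phi>_eq M table)
qed

end

section \<open>The Toda pencil\<close>

text \<open>
  Hamiltonian vector fields of the pencil \<open>\<alpha> {,}\<^sub>1 + \<beta> {,}\<^sub>2\<close>, with
  \<open>a l = v\<^bsub>2l+1\<^esub>\<close> and \<open>w l = \<alpha> + \<beta> v\<^bsub>2l\<^esub>\<close>: the brackets of
  \<open>v\<^bsub>2l\<^esub>\<close>, respectively \<open>v\<^bsub>2l+1\<^esub>\<close>, with a function whose partial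
  derivatives are \<open>gb l\<close> and \<open>ga l\<close>.
\<close>

definition
  "toda_b (\<beta> :: complex) w a gb ga (l :: int) = w l * (a (l - 1) * ga (l - 1) - a l * ga l)
     + 2 * \<beta> * ((a (l - 1))\<^sup>2 * gb (l - 1) - (a l)\<^sup>2 * gb (l + 1))"

definition
  "toda_a (\<beta> :: complex) w a gb ga (l :: int) = a l * (w l * gb l - w (l + 1) * gb (l + 1)
     + \<beta> / 2 * (a (l - 1) * ga (l - 1) - a (l + 1) * ga (l + 1)))"

definition
  "dtoda_b (\<beta> :: complex) w a w' a' gb ga (l :: int) = w' l * (a (l - 1) * ga (l - 1) - a l * ga l)
     + w l * (a' (l - 1) * ga (l - 1) - a' l * ga l)
     + 4 * \<beta> * (a (l - 1) * a' (l - 1) * gb (l - 1) - a l * a' l * gb (l + 1))"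

definition
  "dtoda_a (\<beta> :: complex) w a w' a' gb ga (l :: int) = a' l * (w l * gb l - w (l + 1) * gb (l + 1)
     + \<beta> / 2 * (a (l - 1) * ga (l - 1) - a (l + 1) * ga (l + 1)))
     + a l * (w' l * gb l - w' (l + 1) * gb (l + 1)
     + \<beta> / 2 * (a' (l - 1) * ga (l - 1) - a' (l + 1) * ga (l + 1)))"

text \<open>One site's share in the derivative of the bracket with gradients \<open>y\<close>,
  \<open>z\<close> along the Hamiltonian field with gradient \<open>x\<close>. The minus sign
  reverses the order of arguments in \<open>toda_b\<close> and \<open>toda_a\<close>; the factor
  \<open>\<beta>\<close> is the derivative of \<open>w\<close> with respect to the even
  coordinate.\<close>

definition
  "jacobi_term (\<beta> :: complex) w a xb xa yb ya zb za (l :: int) =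
     yb l * dtoda_b \<beta> w a (\<lambda>l. - \<beta> * toda_b \<beta> w a xb xa l) (\<lambda>l. - toda_a \<beta> w a xb xa l) zb za l
     + ya l * dtoda_a \<beta> w a (\<lambda>l. - \<beta> * toda_b \<beta> w a xb xa l) (\<lambda>l. - toda_a \<beta> w a xb xa l) zb za l"

definition
  "jacobi_flux (\<beta> :: complex) w a xb xa yb ya zb za (l :: int) =
     2 * \<beta> ^ 2 * a (l - 2) * (a (l - 1)) ^ 2 * xa (l - 2) * yb l * zb (l - 1)
     + (1/4) * \<beta> ^ 2 * a (l - 2) * a (l - 1) * a l * xa (l - 2) * ya l * za (l - 1)
     + (1/2) * \<beta> * a (l - 2) * a (l - 1) * w l * xa (l - 2) * yb l * za (l - 1)
     + 2 * \<beta> ^ 2 * (a (l - 1)) ^ 3 * xa (l - 1) * yb (l - 1) * zb l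
     + (1/4) * \<beta> ^ 2 * (a (l - 1)) ^ 2 * a l * xa (l - 1) * ya (l - 1) * za l
     - 2 * \<beta> ^ 2 * (a (l - 1)) ^ 2 * a l * xa l * yb (l - 1) * zb l
     + 4 * \<beta> * (a (l - 1)) ^ 2 * w (l - 1) * xb (l - 1) * yb (l - 1) * zb l
     + \<beta> * (a (l - 1)) ^ 2 * w l * xa (l - 1) * ya (l - 1) * zb l
     - 4 * \<beta> * (a (l - 1)) ^ 2 * w l * xb (l - 1) * yb l * zb l
     - (1/4) * \<beta> ^ 2 * a (l - 1) * (a l) ^ 2 * xa (l - 1) * ya l * za l
     - 2 * \<beta> ^ 2 * a (l - 1) * (a l) ^ 2 * xa (l - 1) * yb l * zb (l + 1)
     - (1/4) * \<beta> ^ 2 * a (l - 1) * a l * a (l + 1) * xa (l - 1) * ya l * za (l + 1)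
     + (1/2) * \<beta> * a (l - 1) * a l * w (l - 1) * xa (l - 1) * yb (l - 1) * za l
     - (3/2) * \<beta> * a (l - 1) * a l * w l * xa (l - 1) * yb l * za l
     - (1/2) * \<beta> * a (l - 1) * a l * w (l + 1) * xa (l - 1) * ya l * zb (l + 1)
     + a (l - 1) * w (l - 1) * w l * xa (l - 1) * yb (l - 1) * zb l
     - a (l - 1) * (w l) ^ 2 * xa (l - 1) * yb l * zb l"

text \<open>
  The Jacobi sum at a site is a discrete divergence; the flux is found by collecting the monomials
  of the left-hand side up to translation.
\<close>

lemma jacobi_divergence:
  "jacobi_term \<beta> w a xb xa yb ya zb za l + jacobi_term \<beta> w a yb ya zb za xb xa l
     + jacobi_term \<beta> w a zb za xb xa yb ya l =
   (jacobi_flux \<beta> w a xb xa yb ya zb za (l + 1) + jacobi_flux \<beta> w a yb ya zb za xb xa (l + 1)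
     + jacobi_flux \<beta> w a zb za xb xa yb ya (l + 1))
   - (jacobi_flux \<beta> w a xb xa yb ya zb za l + jacobi_flux \<beta> w a yb ya zb za xb xa l
     + jacobi_flux \<beta> w a zb za xb xa yb ya l)"
proof -
  have idx: "l - 1 - 1 = l - 2" "l + 1 - 1 = l" "l - 1 + 1 = l" "l + 1 + 1 = l + 2" "l + 1 - 2 = l - 1" "2 + l = l + 2" "1 + l = l + 1"
    by simp_all
  show ?thesis
    unfolding jacobi_term_def jacobi_flux_def dtoda_b_def dtoda_a_def toda_b_def toda_a_def idx
    by (simp add: field_simps power2_eq_square power3_eq_cube)
qed

lemma sum_int_telescope:
  fixes F :: "int \<Rightarrow> complex"
  shows "(\<Sum>l\<in>{0..<int n}. F (l + 1) - F l) = F (int n) - F 0"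
proof (induction n)
  case (Suc n)
  have "{0..<int (Suc n)} = insert (int n) {0..<int n}" by auto
  then show ?case using Suc by (simp add: add.commute)
qed simp

section \<open>Periodization and integer labels of the coordinates\<close>

definition ev :: "int \<Rightarrow> 'k::finite bit0" where "ev l = of_int (2 * l)"

definition od :: "int \<Rightarrow> 'k::finite bit0" where "od l = of_int (2 * l + 1)"

lemma of_int_bit0_eq_iff:
  "(of_int m :: 'k::finite bit0) = of_int n \<longleftrightarrow> m mod (2 * int CARD('k)) = n mod (2 * int CARD('k))"
proof -
  have "Rep_bit0 (of_int m :: 'k bit0) = m mod (2 * int CARD('k))" for m
    unfolding bit0.of_int_eq using bit0.Rep_Abs_mod[where 'a='k, of m] by simp
  then show ?thesis by (metis bit0.Rep_inject_sym)
qed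

lemma Rep_bit0_of_int: "Rep_bit0 (of_int m :: 'k::finite bit0) = m mod (2 * int CARD('k))"
  unfolding bit0.of_int_eq using bit0.Rep_Abs_mod[where 'a='k, of m] by simp

lemma of_int_Rep_bit0: "of_int (Rep_bit0 i) = (i :: 'k::finite bit0)"
  unfolding bit0.of_int_eq bit0.Rep_mod bit0.Rep_inverse ..

lemma of_int_shift: "(of_int (m + 2 * int CARD('k) * s) :: 'k::finite bit0) = of_int m"
  unfolding of_int_bit0_eq_iff by simp

lemma ev_shift: "(ev (l + int CARD('k)) :: 'k::finite bit0) = ev l"
  unfolding ev_def of_int_bit0_eq_iff by (simp add: distrib_left)

lemma od_shift: "(od (l + int CARD('k)) :: 'k::finite bit0) = od l"
proof -
  have "2 * (l + int CARD('k)) + 1 = 2 * l + 1 + 2 * int CARD('k)" by simp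
  then show ?thesis unfolding od_def of_int_bit0_eq_iff by (metis mod_add_self2)
qed

lemma ev_neq_od: "(ev l :: 'k::finite bit0) \<noteq> od m"
proof
  assume "(ev l :: 'k bit0) = od m"
  then have "2 * int CARD('k) dvd (2 * l - (2 * m + 1))"
    unfolding ev_def od_def of_int_bit0_eq_iff by (simp only: mod_eq_dvd_iff)
  then have "2 dvd (2 * l - (2 * m + 1))" using dvd_mult_left by blast
  then show False by presburger
qed

lemma ev_eq_iff: "(ev l :: 'k::finite bit0) = ev m \<longleftrightarrow> int CARD('k) dvd l - m"
proof -
  have "(ev l :: 'k bit0) = ev m \<longleftrightarrow> 2 * int CARD('k) dvd 2 * (l - m)"
    unfolding ev_def of_int_bit0_eq_iff by (simp only: mod_eq_dvd_iff right_diff_distrib)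
  then show ?thesis by (simp only: dvd_mult_cancel_left) simp
qed

lemma od_eq_iff: "(od l :: 'k::finite bit0) = od m \<longleftrightarrow> int CARD('k) dvd l - m"
proof -
  have "(od l :: 'k bit0) = od m \<longleftrightarrow> 2 * int CARD('k) dvd (2 * l + 1) - (2 * m + 1)"
    unfolding od_def of_int_bit0_eq_iff by (simp only: mod_eq_dvd_iff)
  also have "(2 * l + 1) - (2 * m + 1) = 2 * (l - m)" by simp
  finally show ?thesis by (simp only: dvd_mult_cancel_left) simp
qed

lemma sum_bit0:
  fixes F :: "'k::finite bit0 \<Rightarrow> complex"
  shows "(\<Sum>i\<in>UNIV. F i) = (\<Sum>l\<in>{0..<int CARD('k)}. F (ev l) + F (od l))"
proof -
  let ?K = "{0..<int CARD('k)}"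
  have "i \<in> ev ` ?K \<union> od ` ?K" for i :: "'k bit0"
  proof -
    let ?r = "Rep_bit0 i"
    have r: "0 \<le> ?r" "?r < 2 * int CARD('k)" using type_definition.Rep[OF type_definition_bit0, of i] by auto
    have i: "of_int ?r = i" by (rule of_int_Rep_bit0)
    show ?thesis
    proof (cases "even ?r")
      case True
      then have "i = ev (?r div 2)" using i by (simp add: ev_def)
      moreover have "?r div 2 \<in> ?K" using r by auto
      ultimately show ?thesis by blast
    next
      case False
      then have "i = od (?r div 2)" using i unfolding od_def by (metis odd_two_times_div_two_succ)
      moreover have "?r div 2 \<in> ?K" using r by auto
      ultimately show ?thesis by blast
    qed
  qed
  then have cover: "UNIV = (ev ` ?K \<union> od ` ?K :: 'k bit0 set)" by blast
  have inj: "inj_on (ev :: int \<Rightarrow> 'k bit0) ?K" "inj_on (od :: int \<Rightarrow> 'k bit0) ?K"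
    unfolding inj_on_def ev_eq_iff od_eq_iff mod_eq_dvd_iff[symmetric] by auto
  have "(\<Sum>i\<in>UNIV. F i) = (\<Sum>i\<in>ev ` ?K. F i) + (\<Sum>i\<in>od ` ?K. F i)"
    unfolding cover by (rule sum.union_disjoint) (auto simp: ev_neq_od)
  then show ?thesis by (simp add: sum.reindex inj sum.distrib)
qed

lemma periodic_seq_shift: "periodic_seq (x :: complex^('k::finite bit0)) (l + 2 * int CARD('k) * s) = periodic_seq x l"
  by (simp only: periodic_seq_def of_int_shift)

text \<open>Summing over residues \<open>j\<close> and over translates is summing over all integers,
  grouped by residue. Finite range leaves a window of five indices, and the shift invariance allows
  any integer \<open>r\<close> as representative. For small periods several indices of the window
  share a residue, which the grouping takes into account.\<close>

lemma sum_periodize: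
  fixes x :: "complex^('k::finite bit0)" and G :: "'k bit0 \<Rightarrow> complex"
  assumes range: "\<And>i j. \<bar>i - j\<bar> > 2 \<Longrightarrow> B i j (periodic_seq x) = 0"
    and shift: "\<And>i j s. B (i + 2 * int CARD('k) * s) (j + 2 * int CARD('k) * s) (periodic_seq x) = B i j (periodic_seq x)"
  shows "(\<Sum>j\<in>UNIV. periodize B (of_int r) j x * G j) = (\<Sum>n\<in>{r - 2..r + 2}. B r n (periodic_seq x) * G (of_int n))"
proof -
  let ?N = "2 * int CARD('k)" and ?v = "periodic_seq x"
  define R where "R = r mod ?N"
  define W where "W = {R - 2..R + 2}"
  have "?N > 0" by simp
  have per: "periodize B (of_int r) j x = (\<Sum>n\<in>{n\<in>W. of_int n = j}. B R n ?v)" for j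
  proof -
    have inj: "inj (\<lambda>s. Rep_bit0 j + ?N * s)" by (auto simp: inj_def)
    have rng: "range (\<lambda>s. Rep_bit0 j + ?N * s) = {n. of_int n = j}"
    proof safe
      show "of_int (Rep_bit0 j + ?N * s) = j" for s by (simp only: of_int_shift of_int_Rep_bit0)
      fix n :: int
      have "n = Rep_bit0 (of_int n :: 'k bit0) + ?N * (n div ?N)" unfolding Rep_bit0_of_int by simp
      then show "n \<in> range (\<lambda>s. Rep_bit0 (of_int n :: 'k bit0) + ?N * s)" by blast
    qed
    have "periodize B (of_int r) j x = (\<Sum>\<^sub>\<infinity>s. B R (Rep_bit0 j + ?N * s) ?v)"
      by (simp add: periodize_def Rep_bit0_of_int R_def)
    also have "\<dots> = (\<Sum>\<^sub>\<infinity>n\<in>{n. of_int n = j}. B R n ?v)"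
      using infsum_reindex[OF inj, of "\<lambda>n. B R n ?v"] unfolding rng by (simp add: comp_def)
    also have "\<dots> = (\<Sum>\<^sub>\<infinity>n\<in>{n\<in>W. of_int n = j}. B R n ?v)"
      by (rule infsum_cong_neutral) (auto simp: W_def intro!: range)
    also have "\<dots> = (\<Sum>n\<in>{n\<in>W. of_int n = j}. B R n ?v)"
      by (rule infsum_finite, rule finite_subset[of _ W]) (auto simp: W_def)
    finally show ?thesis .
  qed
  have "(\<Sum>j\<in>UNIV. periodize B (of_int r) j x * G j) =
      (\<Sum>j\<in>(UNIV :: 'k bit0 set). \<Sum>n\<in>{n\<in>W. of_int n = j}. B R n ?v * G (of_int n))"
    unfolding per sum_distrib_right by (auto intro!: sum.cong)
  also have "\<dots> = (\<Sum>n\<in>W. B R n ?v * G (of_int n))"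
    by (rule sum.group) (auto simp: W_def)
  also have "\<dots> = (\<Sum>n\<in>W. B r (n + ?N * (r div ?N)) ?v * G (of_int (n + ?N * (r div ?N))))"
  proof (intro sum.cong refl)
    fix n
    have "r = R + ?N * (r div ?N)" by (simp add: R_def)
    then show "B R n ?v * G (of_int n) = B r (n + ?N * (r div ?N)) ?v * G (of_int (n + ?N * (r div ?N)))"
      using shift[of R "r div ?N" n] by (simp only: of_int_shift)
  qed
  also have "\<dots> = (\<Sum>n\<in>{r - 2..r + 2}. B r n ?v * G (of_int n))"
  proof (rule sum.reindex_bij_witness[of _ "\<lambda>n. n - ?N * (r div ?N)" "\<lambda>n. n + ?N * (r div ?N)"])
    have "R = r - ?N * (r div ?N)" by (simp add: R_def minus_mult_div_eq_mod)
    then show "n - ?N * (r div ?N) \<in> W" if "n \<in> {r - 2..r + 2}" for n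
      using that by (simp add: W_def)
    show "n + ?N * (r div ?N) \<in> {r - 2..r + 2}" if "n \<in> W" for n
      using that \<open>R = r - ?N * (r div ?N)\<close> by (simp add: W_def)
  qed auto
  finally show ?thesis .
qed

lemma toda_range: "\<bar>i - j\<bar> > 2 \<Longrightarrow> toda1 i j v = 0" "\<bar>i - j\<bar> > 2 \<Longrightarrow> toda2 i j v = 0"
  by (auto simp: toda1_def toda2_def toda_half1_def toda_half2_def)

lemma toda_shift:
  assumes "\<And>l. v (l + 2 * N) = v l"
  shows "toda1 (i + 2 * N) (j + 2 * N) v = toda1 i j v" "toda2 (i + 2 * N) (j + 2 * N) v = toda2 i j v"
proof -
  have v: "v (i + 2 * N + 1) = v (i + 1)" "v (j + 2 * N + 1) = v (j + 1)" for i j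
    using assms[of "i + 1"] assms[of "j + 1"] by (simp_all add: algebra_simps)
  show "toda1 (i + 2 * N) (j + 2 * N) v = toda1 i j v" "toda2 (i + 2 * N) (j + 2 * N) v = toda2 i j v"
    by (simp_all add: toda1_def toda2_def toda_half1_def toda_half2_def assms v)
qed

definition pencil :: "complex \<Rightarrow> complex \<Rightarrow> 'k::finite bit0 \<Rightarrow> 'k bit0 \<Rightarrow> complex^('k bit0) \<Rightarrow> complex" where
  "pencil \<alpha> \<beta> i j x = \<alpha> * periodize toda1 i j x + \<beta> * periodize toda2 i j x"

lemma sum_five: "(\<Sum>n\<in>{r - 2..r + 2 :: int}. F n) = F (r - 2) + F (r - 1) + F r + F (r + 1) + F (r + 2)" for F :: "int \<Rightarrow> complex"
proof -
  have "{r - 2..r + 2} = {r - 2, r - 1, r, r + 1, r + 2}" by auto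
  then show ?thesis by (simp add: add_ac)
qed

text \<open>The infinite sum in \<open>periodize\<close> is replaced by local formulas valid for
  every period. The parameter \<open>\<alpha>\<close> enters only through \<open>w\<close>, which is
  the shift of the even coordinates.\<close>

lemma pencil_hamiltonian:
  fixes x :: "complex^('k::finite bit0)" and G :: "'k bit0 \<Rightarrow> complex" and \<alpha> \<beta> :: complex
  defines "w \<equiv> \<lambda>l. \<alpha> + \<beta> * x $ ev l" and "a \<equiv> \<lambda>l. x $ od l"
  shows "(\<Sum>j\<in>UNIV. pencil \<alpha> \<beta> (ev l) j x * G j) = toda_b \<beta> w a (\<lambda>l. G (ev l)) (\<lambda>l. G (od l)) l"
    and "(\<Sum>j\<in>UNIV. pencil \<alpha> \<beta> (od l) j x * G j) = toda_a \<beta> w a (\<lambda>l. G (ev l)) (\<lambda>l. G (od l)) l"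
proof -
  let ?v = "periodic_seq x"
  have v: "?v (l + 2 * (int CARD('k) * s)) = ?v l" for l s using periodic_seq_shift[of x l s] by (simp only: mult.assoc)
  have sh: "toda1 (i + 2 * int CARD('k) * s) (j + 2 * int CARD('k) * s) ?v = toda1 i j ?v"
    "toda2 (i + 2 * int CARD('k) * s) (j + 2 * int CARD('k) * s) ?v = toda2 i j ?v" for i j s
    using toda_shift[of ?v "int CARD('k) * s" i j] v by (simp_all only: mult.assoc)
  have split: "(\<Sum>j\<in>UNIV. pencil \<alpha> \<beta> i j x * G j) = \<alpha> * (\<Sum>j\<in>UNIV. periodize toda1 i j x * G j)
     + \<beta> * (\<Sum>j\<in>UNIV. periodize toda2 i j x * G j)" for i
    by (simp add: pencil_def sum.distrib sum_distrib_left algebra_simps)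
  note p1 = sum_periodize[where B=toda1 and x=x, OF toda_range(1) sh(1)]
    and p2 = sum_periodize[where B=toda2 and x=x, OF toda_range(2) sh(2)]
  have idx: "2 * (l - 1) = 2 * l - 2" "2 * (l + 1) = 2 * l + 2" "2 * l - 2 + 1 = 2 * l - 1" "2 * l + 2 + 1 = 2 * l + 3"
    "2 * l + 1 - 2 = 2 * l - 1" "2 * l + 1 - 1 = 2 * l" "2 * l + 1 + 1 = 2 * l + 2" "2 * l + 1 + 2 = 2 * l + 3"
    by simp_all
  have "(\<Sum>j\<in>UNIV. pencil \<alpha> \<beta> (of_int r) j x * G j) =
      \<alpha> * (\<Sum>n\<in>{r - 2..r + 2}. toda1 r n ?v * G (of_int n))
      + \<beta> * (\<Sum>n\<in>{r - 2..r + 2}. toda2 r n ?v * G (of_int n))" for r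
    unfolding split by (simp only: p1 p2)
  note H = this[unfolded sum_five]
  show "(\<Sum>j\<in>UNIV. pencil \<alpha> \<beta> (ev l) j x * G j) = toda_b \<beta> w a (\<lambda>l. G (ev l)) (\<lambda>l. G (od l)) l"
    unfolding ev_def H w_def a_def toda_b_def od_def idx
    by (simp add: toda1_def toda2_def toda_half1_def toda_half2_def periodic_seq_def del: of_int_add of_int_diff of_int_mult)
      (simp add: algebra_simps del: of_int_add of_int_diff of_int_mult)
  show "(\<Sum>j\<in>UNIV. pencil \<alpha> \<beta> (od l) j x * G j) = toda_a \<beta> w a (\<lambda>l. G (ev l)) (\<lambda>l. G (od l)) l"
    unfolding od_def H w_def a_def toda_a_def ev_def idx
    by (simp add: toda1_def toda2_def toda_half1_def toda_half2_def periodic_seq_def del: of_int_add of_int_diff of_int_mult)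
      (simp add: field_simps del: of_int_add of_int_diff of_int_mult)
qed


lemma toda_antisym: "toda1 i j v = - toda1 j i v" "toda2 i j v = - toda2 j i v"
  by (simp_all add: toda1_def toda2_def)

lemma periodize_antisym:
  fixes x :: "complex^('k::finite bit0)"
  assumes anti: "\<And>i j v. B i j v = - B j i v"
    and shift: "\<And>i j s. B (i + 2 * int CARD('k) * s) (j + 2 * int CARD('k) * s) (periodic_seq x) = B i j (periodic_seq x)"
  shows "periodize B i j x = - periodize B j i x"
proof -
  let ?N = "2 * int CARD('k)" and ?v = "periodic_seq x" and ?i = "Rep_bit0 i" and ?j = "Rep_bit0 j"
  have "periodize B j i x = (\<Sum>\<^sub>\<infinity>s. B ?j (?i + ?N * s) ?v)" by (simp add: periodize_def)
  also have "\<dots> = (\<Sum>\<^sub>\<infinity>s\<in>range uminus. B ?j (?i + ?N * s) ?v)" by simp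
  also have "\<dots> = (\<Sum>\<^sub>\<infinity>s. B ?j (?i + ?N * (- s)) ?v)"
    by (subst infsum_reindex) (auto simp: comp_def)
  also have "\<dots> = (\<Sum>\<^sub>\<infinity>s. - B ?i (?j + ?N * s) ?v)"
  proof (rule infsum_cong)
    fix s :: int
    have "B ?j (?i + ?N * (- s)) ?v = B (?j + ?N * s) (?i + ?N * (- s) + ?N * s) ?v" by (simp only: shift)
    also have "\<dots> = - B ?i (?j + ?N * s) ?v" by (subst anti) simp
    finally show "B ?j (?i + ?N * (- s)) ?v = - B ?i (?j + ?N * s) ?v" .
  qed
  also have "\<dots> = - periodize B i j x" by (simp add: infsum_uminus periodize_def)
  finally show ?thesis by simp
qed

lemma pencil_antisym: "pencil \<alpha> \<beta> i j x = - pencil \<alpha> \<beta> j i x"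
proof -
  let ?v = "periodic_seq x"
  have "?v (l + 2 * (int CARD('a) * s)) = ?v l" for l s using periodic_seq_shift[of x l s] by (simp only: mult.assoc)
  then have "toda1 (i + 2 * int CARD('a) * s) (j + 2 * int CARD('a) * s) ?v = toda1 i j ?v"
    "toda2 (i + 2 * int CARD('a) * s) (j + 2 * int CARD('a) * s) ?v = toda2 i j ?v" for i j s
    using toda_shift[of ?v "int CARD('a) * s" i j] by (simp_all only: mult.assoc)
  from periodize_antisym[where B=toda1, OF toda_antisym(1) this(1), of i j]
    periodize_antisym[where B=toda2, OF toda_antisym(2) this(2), of i j]
  show ?thesis by (simp add: pencil_def)
qed

section \<open>The Jacobi identity of the pencil\<close>

definition delta :: "'a \<Rightarrow> 'a \<Rightarrow> complex" where "delta i j = (if j = i then 1 else 0)"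

lemma sum_delta_right: "(\<Sum>j\<in>UNIV. F j * delta m j) = F (m :: 'a :: finite)"
  by (simp add: delta_def if_distrib[of "\<lambda>u. _ * u"] cong: if_cong)

lemma sum_delta_left: "(\<Sum>j\<in>UNIV. delta m j * F j) = F (m :: 'a :: finite)"
  by (simp add: delta_def if_distrib[of "\<lambda>u. u * _"] cong: if_cong)

text \<open>With \<open>delta\<close> as gradients of coordinate functions, an entry becomes a
  finite polynomial expression that can be differentiated directly.\<close>

lemma pencil_entry:
  fixes y :: "complex^('k::finite bit0)" and j m :: "'k bit0"
  shows "pencil \<alpha> \<beta> j m y = (\<Sum>l\<in>{0..<int CARD('k)}.
      delta j (ev l) * toda_b \<beta> (\<lambda>l. \<alpha> + \<beta> * y $ ev l) (\<lambda>l. y $ od l) (\<lambda>l. delta m (ev l)) (\<lambda>l. delta m (od l)) l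
    + delta j (od l) * toda_a \<beta> (\<lambda>l. \<alpha> + \<beta> * y $ ev l) (\<lambda>l. y $ od l) (\<lambda>l. delta m (ev l)) (\<lambda>l. delta m (od l)) l)"
proof -
  have "pencil \<alpha> \<beta> j m y = (\<Sum>i\<in>UNIV. delta j i * (\<Sum>n\<in>UNIV. pencil \<alpha> \<beta> i n y * delta m n))"
    by (simp only: sum_delta_right sum_delta_left)
  then show ?thesis by (simp only: sum_bit0[of "\<lambda>i. delta j i * _ i"] pencil_hamiltonian)
qed

lemma pencil_entry_has_derivative:
  fixes x :: "complex^('k::finite bit0)" and j m :: "'k bit0"
  shows "(pencil \<alpha> \<beta> j m has_derivative (\<lambda>v. \<Sum>l\<in>{0..<int CARD('k)}.
      delta j (ev l) * dtoda_b \<beta> (\<lambda>l. \<alpha> + \<beta> * x $ ev l) (\<lambda>l. x $ od l) (\<lambda>l. \<beta> * v $ ev l) (\<lambda>l. v $ od l)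
        (\<lambda>l. delta m (ev l)) (\<lambda>l. delta m (od l)) l
    + delta j (od l) * dtoda_a \<beta> (\<lambda>l. \<alpha> + \<beta> * x $ ev l) (\<lambda>l. x $ od l) (\<lambda>l. \<beta> * v $ ev l) (\<lambda>l. v $ od l)
        (\<lambda>l. delta m (ev l)) (\<lambda>l. delta m (od l)) l)) (at x)"
proof -
  have c: "((\<lambda>y. y $ i) has_derivative (\<lambda>v. v $ i)) (at x)" for i :: "'k bit0"
    by (rule bounded_linear_imp_has_derivative[OF bounded_linear_vec_nth])
  have b: "((\<lambda>y. toda_b \<beta> (\<lambda>l. \<alpha> + \<beta> * y $ ev l) (\<lambda>l. y $ od l) gb ga l) has_derivative
    (\<lambda>v. dtoda_b \<beta> (\<lambda>l. \<alpha> + \<beta> * x $ ev l) (\<lambda>l. x $ od l) (\<lambda>l. \<beta> * v $ ev l) (\<lambda>l. v $ od l) gb ga l)) (at x)" for gb ga l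
    unfolding toda_b_def dtoda_b_def power2_eq_square
    by (rule derivative_eq_intros c refl)+ (simp add: fun_eq_iff algebra_simps)
  have a: "((\<lambda>y. toda_a \<beta> (\<lambda>l. \<alpha> + \<beta> * y $ ev l) (\<lambda>l. y $ od l) gb ga l) has_derivative
    (\<lambda>v. dtoda_a \<beta> (\<lambda>l. \<alpha> + \<beta> * x $ ev l) (\<lambda>l. x $ od l) (\<lambda>l. \<beta> * v $ ev l) (\<lambda>l. v $ od l) gb ga l)) (at x)" for gb ga l
    unfolding toda_a_def dtoda_a_def
    by (rule derivative_eq_intros c refl)+ (simp add: fun_eq_iff algebra_simps)
  show ?thesis
    unfolding pencil_entry[abs_def]
    by (intro has_derivative_sum has_derivative_add has_derivative_mult_right a b)
qed

lemma pencil_mholomorphic_on: "mholomorphic_on U (pencil \<alpha> \<beta> i j)"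
  unfolding pencil_entry[abs_def] toda_a_def toda_b_def
  by (intro mholomorphic_intros)

lemma pencil_jacobi:
  fixes x :: "complex^('k::finite bit0)"
  shows "(\<Sum>l\<in>UNIV. pencil \<alpha> \<beta> i l x * partial l (pencil \<alpha> \<beta> j m) x
     + pencil \<alpha> \<beta> j l x * partial l (pencil \<alpha> \<beta> m i) x
     + pencil \<alpha> \<beta> m l x * partial l (pencil \<alpha> \<beta> i j) x) = 0"
proof -
  let ?P = "pencil \<alpha> \<beta>" and ?w = "\<lambda>l. \<alpha> + \<beta> * x $ ev l" and ?a = "\<lambda>l. x $ od l"
  define gb ga where "gb = (\<lambda>i l. delta i (ev l :: 'k bit0))" and "ga = (\<lambda>i l. delta i (od l :: 'k bit0))"
  let ?J = "\<lambda>i j m. jacobi_term \<beta> ?w ?a (gb i) (ga i) (gb j) (ga j) (gb m) (ga m)"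
  let ?F = "\<lambda>i j m. jacobi_flux \<beta> ?w ?a (gb i) (ga i) (gb j) (ga j) (gb m) (ga m)"
  have one: "(\<Sum>l\<in>UNIV. ?P i l x * partial l (?P j m) x) = (\<Sum>l\<in>{0..<int CARD('k)}. ?J i j m l)" for i j m
  proof -
    \<comment> \<open>\<open>\<theta>\<close> is the Hamiltonian field of the coordinate
      \<open>i\<close>; each Jacobi term is the derivative of an entry along it, computed by
      \<open>pencil_entry_has_derivative\<close>.\<close>
    define \<theta> where "\<theta> = (\<chi> l. ?P i l x)"
    have \<theta>: "\<theta> $ ev l = - toda_b \<beta> ?w ?a (gb i) (ga i) l" "\<theta> $ od l = - toda_a \<beta> ?w ?a (gb i) (ga i) l" for l
      using pencil_hamiltonian[of \<alpha> \<beta> l x "delta i"] pencil_antisym[of \<alpha> \<beta> i _ x]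
      by (simp_all add: \<theta>_def sum_delta_right gb_def ga_def)
    have "(?P j m has_derivative (\<lambda>v. \<Sum>l\<in>UNIV. v $ l * partial l (?P j m) x)) (at x)"
      by (rule mholomorphic_on_has_derivative[OF open_UNIV UNIV_I pencil_mholomorphic_on])
    from has_derivative_unique[OF this pencil_entry_has_derivative]
    have "(\<Sum>l\<in>UNIV. \<theta> $ l * partial l (?P j m) x) = (\<Sum>l\<in>{0..<int CARD('k)}.
      delta j (ev l) * dtoda_b \<beta> ?w ?a (\<lambda>l. \<beta> * \<theta> $ ev l) (\<lambda>l. \<theta> $ od l) (\<lambda>l. delta m (ev l)) (\<lambda>l. delta m (od l)) l
    + delta j (od l) * dtoda_a \<beta> ?w ?a (\<lambda>l. \<beta> * \<theta> $ ev l) (\<lambda>l. \<theta> $ od l) (\<lambda>l. delta m (ev l)) (\<lambda>l. delta m (od l)) l)"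
      by (rule fun_cong)
    then show ?thesis by (simp add: \<theta> jacobi_term_def gb_def ga_def) (simp add: \<theta>_def)
  qed
  \<comment> \<open>The flux at \<open>l\<close> reaches from \<open>l - 2\<close> to
    \<open>l + 1\<close>. Over one period it takes the same value at both ends, so the telescoping
    sum vanishes.\<close>
  have per: "?F i j m (int CARD('k)) = ?F i j m 0" for i j m
  proof -
    have "(ev (int CARD('k)) :: 'k bit0) = ev 0" "(od (int CARD('k)) :: 'k bit0) = od 0"
      "(ev (int CARD('k) + 1) :: 'k bit0) = ev 1" "(od (int CARD('k) + 1) :: 'k bit0) = od 1"
      "(ev (int CARD('k) - 1) :: 'k bit0) = ev (-1)" "(od (int CARD('k) - 1) :: 'k bit0) = od (-1)"
      "(od (int CARD('k) - 2) :: 'k bit0) = od (-2)"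
      by (simp_all add: ev_eq_iff od_eq_iff)
    then show ?thesis by (simp add: jacobi_flux_def gb_def ga_def)
  qed
  have "(\<Sum>l\<in>UNIV. ?P i l x * partial l (?P j m) x + ?P j l x * partial l (?P m i) x + ?P m l x * partial l (?P i j) x)
    = (\<Sum>l\<in>{0..<int CARD('k)}. ?J i j m l + ?J j m i l + ?J m i j l)"
    by (simp add: sum.distrib one)
  also have "\<dots> = (\<Sum>l\<in>{0..<int CARD('k)}. (?F i j m (l + 1) + ?F j m i (l + 1) + ?F m i j (l + 1))
     - (?F i j m l + ?F j m i l + ?F m i j l))"
    by (simp only: jacobi_divergence)
  also have "\<dots> = 0"
    by (simp only: sum_int_telescope[of "\<lambda>l. ?F i j m l + ?F j m i l + ?F m i j l"] per diff_self)
  finally show ?thesis .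
qed

lemma poisson_on_pencil: "open U \<Longrightarrow> poisson_on UNIV U (pencil \<alpha> \<beta>)"
  by (rule poisson_onI) (simp_all only: cspace_UNIV subtopology_UNIV open_openin pencil_mholomorphic_on pencil_jacobi,
    rule pencil_antisym)

lemma pencil_eq: "periodize toda1 = pencil 1 0" "periodize toda2 = pencil 0 1"
  by (simp_all add: pencil_def fun_eq_iff)

lemma bihamiltonian_periodic_toda:
  assumes "open U"
  shows "bihamiltonian (restrict_bi U (periodic_toda :: 'k::finite bit0 bistructure))"
proof -
  have "(\<lambda>i j x. a * pencil 1 0 i j x + b * pencil 0 1 i j x) = (pencil a b :: 'k bit0 \<Rightarrow> _)" for a b
    by (simp add: pencil_def fun_eq_iff)
  then show ?thesis
    using assms unfolding bihamiltonian_def restrict_bi_def periodic_toda_def pencil_eq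
    by (simp add: poisson_on_pencil open_openin[symmetric])
qed

section \<open>Continuants and the Lenard chain of the Toda lattice\<close>

text \<open>
  \<open>continuant b a i n\<close> is the determinant of the Jacobi matrix with diagonal entries
  \<open>b i, \<dots>, b (i+n-2)\<close> and off-diagonal entries \<open>a i, \<dots>, a (i+n-3)\<close>; the shift of
  the length makes the recursion start at the value \<open>0\<close>.
\<close>

fun continuant :: "(int \<Rightarrow> 'a::comm_ring_1) \<Rightarrow> (int \<Rightarrow> 'a) \<Rightarrow> int \<Rightarrow> nat \<Rightarrow> 'a" where
  "continuant b a i 0 = 0"
| "continuant b a i (Suc 0) = 1"
| "continuant b a i (Suc (Suc m)) =
     b (i + int m) * continuant b a i (Suc m) - (a (i + int m - 1))\<^sup>2 * continuant b a i m"

text \<open>The tridiagonal determinant expanded across the edge between the first \<open>m\<close>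
  and the last \<open>n\<close> sites: either the edge is absent, or it is used and both of its
  endpoints are removed.\<close>

lemma continuant_split:
  "continuant b a i (Suc (m + n)) = continuant b a i (Suc m) * continuant b a (i + int m) (Suc n)
     - (a (i + int m - 1))\<^sup>2 * continuant b a i m * continuant b a (i + int m + 1) n"
proof (induction n rule: induct_nat_012)
  case (ge2 n)
  have "continuant b a i (Suc (m + Suc (Suc n))) =
    b (i + int m + int n + 1) * continuant b a i (Suc (m + Suc n)) - (a (i + int m + int n))\<^sup>2 * continuant b a i (Suc (m + n))"
    by (simp add: add_ac)
  then show ?case
    unfolding ge2 by (simp add: algebra_simps)
qed simp_all

lemma continuant_left:
  "continuant b a i (Suc (Suc n)) = b i * continuant b a (i + 1) (Suc n) - (a i)\<^sup>2 * continuant b a (i + 2) n"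
  using continuant_split[of b a i 1 n] by (simp add: add_ac)

lemma continuant_cong:
  assumes "\<And>m. i \<le> m \<Longrightarrow> m < i + int n - 1 \<Longrightarrow> b m = b' m" "\<And>m. i \<le> m \<Longrightarrow> m < i + int n - 2 \<Longrightarrow> a m = a' m"
  shows "continuant b a i n = continuant b' a' i n"
  using assms
proof (induction b a i n rule: continuant.induct)
  case (3 b a i m)
  \<comment> \<open>For \<open>m = 0\<close> the entry \<open>a (i - 1)\<close> lies outside the
    range of agreement, but its factor is the continuant of length \<open>0\<close>, which is
    zero.\<close>
  have "(a (i + int m - 1))\<^sup>2 * continuant b a i m = (a' (i + int m - 1))\<^sup>2 * continuant b a i m"
    using 3(4)[of "i + int m - 1"] by (cases m) simp_all
  moreover have "continuant b a i (Suc m) = continuant b' a' i (Suc m)" "continuant b a i m = continuant b' a' i m"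
    using 3 by auto
  ultimately show ?case using 3(3)[of "i + int m"] by simp
qed simp_all

lemma continuant_shift:
  assumes "\<And>l. b (l + p) = b l" "\<And>l. a (l + p) = a l"
  shows "continuant b a (i + p) n = continuant b a i n"
proof (induction n rule: induct_nat_012)
  case (ge2 n)
  have "b (i + p + int n) = b (i + int n)" "a (i + p + int n - 1) = a (i + int n - 1)"
    using assms(1)[of "i + int n"] assms(2)[of "i + int n - 1"] by (simp_all add: algebra_simps)
  then show ?case using ge2 by simp
qed simp_all

locale periodic_lattice =
  fixes b a :: "int \<Rightarrow> complex" and K :: nat
  assumes b_per: "\<And>l. b (l + int (Suc K)) = b l" and a_per: "\<And>l. a (l + int (Suc K)) = a l"
begin

abbreviation "L \<equiv> continuant b a"

text \<open>The trace of the product of the transfer matrices over one period, computed by cutting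
  the cycle at the edge \<open>a l\<close>: the open chain of all \<open>Suc K\<close> sites minus
  the contribution of the closing edge.\<close>

definition R :: "int \<Rightarrow> complex" where "R l = L (l + 1) (Suc (Suc K)) - (a l)\<^sup>2 * L (l + 2) K"

lemma R_eq: "R l = b l * L (l + 1) (Suc K) - (a l)\<^sup>2 * L (l + 2) K - (a (l - 1))\<^sup>2 * L (l + 1) K"
  using b_per[of l] a_per[of "l - 1"] by (simp add: R_def algebra_simps)

lemma R_eq': "R l = b (l + 1) * L (l + 2) (Suc K) - (a (l + 1))\<^sup>2 * L (l + 3) K - (a l)\<^sup>2 * L (l + 2) K"
  unfolding R_def continuant_left by (simp add: algebra_simps)

text \<open>Cutting at two successive edges and expanding at the site between them, once as last and
  once as first site of the chain, gives the same expression.\<close>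

lemma R_step: "R (l + 1) = R l"
  unfolding R_eq[of "l + 1"] R_eq'[of l] by (simp add: algebra_simps)

lemma R_const: "R l = R 0"
proof (induction l rule: int_induct[of _ 0])
  case (step2 i)
  then show ?case using R_step[of "i - 1"] by simp
qed (simp_all add: R_step)

text \<open>\<open>gb\<close> and \<open>ga\<close> are the gradient of \<open>R\<close>. In the
  first equation both neighbouring chains have site \<open>l\<close> at an end, and expanding them
  there cancels everything; the second is the difference of the two expansions of
  \<open>R\<close>.\<close>

lemma toda_fields_trace:
  defines "gb \<equiv> \<lambda>l. L (l + 1) (Suc K)" and "ga \<equiv> \<lambda>l. - 2 * a l * L (l + 2) K"
  shows "toda_b 1 b a gb ga l = 0" "toda_a 1 b a gb ga l = 0"
proof -
  show "toda_b 1 b a gb ga l = 0"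
  proof (cases K)
    case 0
    then show ?thesis using a_per[of "l - 1"] by (simp add: toda_b_def gb_def ga_def)
  next
    case (Suc J)
    have 1: "L l (Suc K) = b l * L (l + 1) K - (a l)\<^sup>2 * L (l + 2) J"
      unfolding Suc by (rule continuant_left)
    have 2: "L (l + 2) (Suc K) = b l * L (l + 2) K - (a (l - 1))\<^sup>2 * L (l + 2) J"
      using b_per[of l] a_per[of "l - 1"] unfolding Suc by (simp add: algebra_simps)
    have idx: "l - 1 + 1 = l" "l + 1 + 1 = l + 2" "l - 1 + 2 = l + 1" by simp_all
    show ?thesis
      unfolding toda_b_def gb_def ga_def idx 1 2 by (simp add: algebra_simps power2_eq_square)
  qed
  have "b l * L (l + 1) (Suc K) - b (l + 1) * L (l + 2) (Suc K) =
      (a (l - 1))\<^sup>2 * L (l + 1) K - (a (l + 1))\<^sup>2 * L (l + 3) K"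
    using R_eq[of l] R_eq'[of l] by algebra
  then show "toda_a 1 b a gb ga l = 0"
    unfolding toda_a_def gb_def ga_def by (simp add: power2_eq_square algebra_simps)
qed

text \<open>
  The open lattice on the sites \<open>1, \<dots>, K\<close>: here \<open>Q\<close> and its gradient vanish at the
  boundary, so that its Hamiltonian vector field is supported at \<open>b 0\<close>, \<open>a 0\<close> and
  \<open>a K\<close>.
\<close>

definition Q :: complex where "Q = L 1 (Suc K)"

text \<open>Removing site \<open>l\<close> splits the open chain, so the derivative of
  \<open>Q\<close> is a product of two continuants. Length \<open>0\<close> in one factor makes it
  vanish at \<open>l = 0\<close> and \<open>l = Suc K\<close>, both of which are the removed
  site.\<close>

definition Qb :: "nat \<Rightarrow> complex" where "Qb l = L 1 l * L (int l + 1) (Suc K - l)"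

definition Qa :: "nat \<Rightarrow> complex" where "Qa l = - 2 * a (int l) * L 1 l * L (int l + 2) (K - l)"

lemma L_first: "l \<ge> 1 \<Longrightarrow> L 1 (Suc l) = b (int l) * L 1 l - (a (int l - 1))\<^sup>2 * L 1 (l - 1)"
  by (cases l) (simp_all add: algebra_simps)

lemma L_last:
  assumes "1 \<le> l" "l \<le> K"
  shows "L (int l) (Suc (Suc K - l)) = b (int l) * L (int l + 1) (Suc K - l) - (a (int l))\<^sup>2 * L (int l + 2) (K - l)"
proof -
  have "Suc K - l = Suc (K - l)" using assms by simp
  then show ?thesis by (simp only: continuant_left)
qed

lemma Q_edge:
  assumes "l \<le> K"
  shows "Q = L 1 (Suc l) * L (int l + 1) (Suc K - l) - (a (int l))\<^sup>2 * L 1 l * L (int l + 2) (K - l)"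
proof -
  have "Suc (l + (K - l)) = Suc K" "Suc K - l = Suc (K - l)" using assms by auto
  then show ?thesis
    using continuant_split[of b a 1 l "K - l"] unfolding Q_def by (simp add: algebra_simps)
qed

lemma Q_site:
  assumes "1 \<le> l" "l \<le> K"
  shows "Q = b (int l) * L 1 l * L (int l + 1) (Suc K - l) - (a (int l))\<^sup>2 * L 1 l * L (int l + 2) (K - l)
    - (a (int l - 1))\<^sup>2 * L 1 (l - 1) * L (int l + 1) (Suc K - l)"
  unfolding Q_edge[OF assms(2)] L_first[OF assms(1)] by (simp add: algebra_simps)

lemma Q_boundary [simp]: "Qb 0 = 0" "Qb (Suc K) = 0" "Qa 0 = 0" "Qa K = 0"
  by (simp_all add: Qb_def Qa_def)

text \<open>The explicit gradient is available on one period only; indices such as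
  \<open>- 1\<close> are reached through periodicity. Hence \<open>gb\<close> and \<open>ga\<close>
  are abstract periodic functions that agree with \<open>Qb\<close> and \<open>Qa\<close>
  there.\<close>

context
  fixes gb ga :: "int \<Rightarrow> complex"
  assumes gb: "\<And>l. l \<le> Suc K \<Longrightarrow> gb (int l) = Qb l" and ga: "\<And>l. l \<le> K \<Longrightarrow> ga (int l) = Qa l"
    and gb_per: "\<And>l. gb (l + int (Suc K)) = gb l" and ga_per: "\<And>l. ga (l + int (Suc K)) = ga l"
begin

lemma ga_last: "ga (- 1) = 0" "ga (int (Suc K)) = 0" "gb (- 1) = gb (int K)"
  using ga_per[of "- 1"] ga_per[of 0] ga[of K] ga[of 0] gb_per[of "-1"] by simp_all

lemma toda_b_inner:
  assumes "1 \<le> l" "l \<le> K"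
  shows "toda_b 1 b a gb ga (int l) = 0"
proof -
  have g: "gb (int l - 1) = Qb (l - 1)" "gb (int l + 1) = Qb (Suc l)" "ga (int l - 1) = Qa (l - 1)" "ga (int l) = Qa l"
    using gb[of "l - 1"] gb[of "Suc l"] ga[of "l - 1"] ga[of l] assms by (simp_all add: of_nat_diff add.commute)
  have idx: "int l - 1 + 1 = int l" "int l - 1 + 2 = int l + 1" "int (Suc l) + 1 = int l + 2" "int (l - 1) = int l - 1"
    "Suc K - (l - 1) = Suc (Suc K - l)" "K - (l - 1) = Suc K - l" "Suc K - Suc l = K - l" using assms by auto
  show ?thesis
    unfolding toda_b_def g Qb_def Qa_def idx unfolding L_last[OF assms] L_first[OF assms(1)]
    by (simp add: algebra_simps power2_eq_square)
qed

lemma toda_a_inner: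
  assumes "1 \<le> l" "l < K"
  shows "toda_a 1 b a gb ga (int l) = 0"
proof -
  have g: "gb (int l) = Qb l" "gb (int l + 1) = Qb (Suc l)" "ga (int l - 1) = Qa (l - 1)" "ga (int l + 1) = Qa (Suc l)"
    using gb[of l] gb[of "Suc l"] ga[of "l - 1"] ga[of "Suc l"] assms by (simp_all add: of_nat_diff add.commute)
  have idx: "int l - 1 + 2 = int l + 1" "int (Suc l) = int l + 1" "int l + 1 + 2 = int l + 3"
    "int l + 1 + 1 = int l + 2" "int (l - 1) = int l - 1"
    "K - (l - 1) = Suc K - l" "Suc K - Suc l = K - l" using assms by auto
  have "b (int l) * Qb l - b (int l + 1) * Qb (Suc l) =
     (a (int l - 1))\<^sup>2 * L 1 (l - 1) * L (int l + 1) (Suc K - l) - (a (int l + 1))\<^sup>2 * L 1 (Suc l) * L (int l + 3) (K - Suc l)"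
    using Q_site[of l] Q_site[of "Suc l"] assms by (simp add: Qb_def algebra_simps)
  then show ?thesis
    unfolding toda_a_def g unfolding Qa_def idx by (simp add: algebra_simps power2_eq_square)
qed

text \<open>At the removed site and its edges the inner cancellation lacks a partner. On the edges
  the surviving terms are the expansions of \<open>Q\<close> at its first and last site.\<close>

lemma toda_outer:
  assumes K: "K \<ge> 1"
  shows "toda_b 1 b a gb ga 0 = 2 * ((a K)\<^sup>2 * L 1 K - (a 0)\<^sup>2 * L 2 K)"
    and "toda_a 1 b a gb ga 0 = - a 0 * Q" and "toda_a 1 b a gb ga K = a K * Q"
proof -
  have aK: "a (- 1) = a K" using a_per[of "-1"] by simp
  have g: "gb 0 = 0" "gb 1 = Qb 1" "ga 0 = 0" "gb (int K) = Qb K" "ga (int K) = 0" "ga 1 = Qa 1"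
    "gb (int K + 1) = 0" "ga (int K - 1) = Qa (K - 1)" "ga (int K + 1) = 0"
    using ga_last(2) gb[of 0] gb[of 1] ga[of 0] gb[of K] ga[of K] ga[of 1] gb[of "Suc K"] ga[of "K - 1"] K
    by (simp_all add: algebra_simps of_nat_diff)
  show "toda_b 1 b a gb ga 0 = 2 * ((a K)\<^sup>2 * L 1 K - (a 0)\<^sup>2 * L 2 K)"
    unfolding toda_b_def by (simp add: g ga_last aK) (simp add: Qb_def)
  show "toda_a 1 b a gb ga 0 = - a 0 * Q"
    using Q_site[of 1] K unfolding toda_a_def by (simp add: g ga_last aK) (simp add: Qb_def Qa_def power2_eq_square algebra_simps)
  have "int (K - 1) + 2 = int K + 1" "int (K - 1) = int K - 1" "K - (K - 1) = 1" using K by auto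
  moreover have "b (int K) * L 1 K = Q + (a (int K - 1))\<^sup>2 * L 1 (K - 1)"
    using Q_site[of K] K by (simp add: algebra_simps)
  ultimately show "toda_a 1 b a gb ga K = a K * Q"
    unfolding toda_a_def g by (simp add: Qb_def Qa_def power2_eq_square algebra_simps)
qed

end

end

section \<open>Coefficients in the parameter, and derivatives along one coordinate\<close>

lemma poly_sum_atMost:
  fixes p :: "'a::comm_semiring_1 poly"
  assumes "degree p \<le> n"
  shows "poly p c = (\<Sum>i\<le>n. coeff p i * c ^ i)"
proof -
  have "(\<Sum>i\<le>n. coeff p i * c ^ i) = (\<Sum>i\<le>degree p. coeff p i * c ^ i)"
    using assms by (intro sum.mono_neutral_right) (auto simp: coeff_eq_0)
  then show ?thesis by (simp only: poly_altdef)
qed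

lemma bracket_linear_right:
  assumes "\<And>l. l \<in> A \<Longrightarrow> mholomorphic_on UNIV (g l)"
  shows "bracket UNIV P f (\<lambda>x. \<Sum>l\<in>A. g l x * d l) x = (\<Sum>l\<in>A. bracket UNIV P f (g l) x * d l)"
proof -
  have "partial j (\<lambda>x. \<Sum>l\<in>A. g l x * d l) x = (\<Sum>l\<in>A. partial j (g l) x * d l)" for j
  proof (subst partial_sum[OF open_UNIV UNIV_I])
    show "mholomorphic_on UNIV (\<lambda>x. g l x * d l)" if "l \<in> A" for l
      using assms that by (intro mholomorphic_on_mult) auto
    show "(\<Sum>l\<in>A. partial j (\<lambda>x. g l x * d l) x) = (\<Sum>l\<in>A. partial j (g l) x * d l)"
      by (intro sum.cong refl) (simp add: partial_mult[OF open_UNIV UNIV_I assms])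
  qed
  then have "bracket UNIV P f (\<lambda>x. \<Sum>l\<in>A. g l x * d l) x =
    (\<Sum>i\<in>UNIV. \<Sum>j\<in>UNIV. \<Sum>l\<in>A. P i j x * partial i f x * partial j (g l) x * d l)"
    by (simp add: bracket_def sum_distrib_left mult.assoc)
  also have "\<dots> = (\<Sum>i\<in>UNIV. \<Sum>l\<in>A. \<Sum>j\<in>UNIV. P i j x * partial i f x * partial j (g l) x * d l)"
    by (rule sum.cong[OF refl], rule sum.swap)
  also have "\<dots> = (\<Sum>l\<in>A. \<Sum>i\<in>UNIV. \<Sum>j\<in>UNIV. P i j x * partial i f x * partial j (g l) x * d l)"
    by (rule sum.swap)
  finally show ?thesis by (simp add: bracket_def sum_distrib_right)
qed

lemma bracket_pencil:
  "bracket UNIV (pencil \<alpha> \<beta>) f g x = \<alpha> * bracket UNIV (pencil 1 0) f g x + \<beta> * bracket UNIV (pencil 0 1) f g x"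
  by (simp add: bracket_def pencil_def sum.distrib sum_distrib_left algebra_simps)

lemma partial_affine:
  assumes "\<And>z. f (\<chi> j. if j = i then z else x $ j) = u * z + v"
  shows "partial i f x = u"
proof -
  have "((\<lambda>z. u * z + v) has_field_derivative u) (at (x $ i))" by (auto intro!: derivative_eq_intros)
  then show ?thesis unfolding partial_def assms by (rule DERIV_imp_deriv)
qed

lemma partial_square:
  assumes "\<And>z. f (\<chi> j. if j = i then z else x $ j) = u - z\<^sup>2 * v"
  shows "partial i f x = - 2 * x $ i * v"
proof -
  have "((\<lambda>z. u - z\<^sup>2 * v) has_field_derivative - 2 * x $ i * v) (at (x $ i))"
    by (auto intro!: derivative_eq_intros)
  then show ?thesis unfolding partial_def assms by (rule DERIV_imp_deriv)
qed

section \<open>Trace and truncated determinant as functions on the periodic lattice\<close>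

locale toda =
  fixes K :: nat and ty :: "'k::finite itself"
  assumes card: "CARD('k) = Suc K"
begin

lemma ev_coordinate: "(\<chi> j. if j = ev l then z else x $ j) $ ev m = (if int (Suc K) dvd m - l then z else x $ ev m)"
  for x :: "complex^('k bit0)"
  by (simp add: ev_eq_iff card)

lemma od_coordinate: "(\<chi> j. if j = od l then z else x $ j) $ od m = (if int (Suc K) dvd m - l then z else x $ od m)"
  for x :: "complex^('k bit0)"
  by (simp add: od_eq_iff card)

lemma other_coordinate:
  "(\<chi> j. if j = ev l then z else x $ j) $ od m = x $ od m" "(\<chi> j. if j = od l then z else x $ j) $ ev m = x $ ev m"
  for x :: "complex^('k bit0)"
  by (simp_all add: ev_neq_od ev_neq_od[symmetric])

lemma not_period: "l \<noteq> m \<Longrightarrow> \<bar>m - l\<bar> < int (Suc K) \<Longrightarrow> \<not> int (Suc K) dvd m - l"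
  by (metis abs_of_nat dvd_abs_iff eq_iff_diff_eq_0 zdvd_not_zless zero_less_abs_iff)

definition cont :: "complex \<Rightarrow> complex^('k bit0) \<Rightarrow> int \<Rightarrow> nat \<Rightarrow> complex" where
  "cont c x = continuant (\<lambda>l. x $ ev l + c) (\<lambda>l. x $ od l)"

lemma lattice: "periodic_lattice (\<lambda>l. x $ ev l + c) (\<lambda>l. x $ od l) K" for x :: "complex^('k bit0)"
  by unfold_locales (simp_all only: card[symmetric] ev_shift od_shift)

lemma cont_ev_cong:
  assumes "\<And>m. i \<le> m \<Longrightarrow> m < i + int n - 1 \<Longrightarrow> l \<noteq> m \<and> \<bar>m - l\<bar> < int (Suc K)"
  shows "cont c (\<chi> j. if j = ev l then z else x $ j) i n = cont c x i n"
  unfolding cont_def ev_coordinate other_coordinate using not_period assms by (intro continuant_cong) auto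

lemma cont_od_cong:
  assumes "\<And>m. i \<le> m \<Longrightarrow> m < i + int n - 2 \<Longrightarrow> l \<noteq> m \<and> \<bar>m - l\<bar> < int (Suc K)"
  shows "cont c (\<chi> j. if j = od l then z else x $ j) i n = cont c x i n"
  unfolding cont_def od_coordinate other_coordinate using not_period assms by (intro continuant_cong) auto

definition trace :: "complex \<Rightarrow> complex^('k bit0) \<Rightarrow> complex" where
  "trace c x = periodic_lattice.R (\<lambda>l. x $ ev l + c) (\<lambda>l. x $ od l) K 0"

lemma trace_edge: "trace c x = cont c x (l + 1) (Suc (Suc K)) - (x $ od l)\<^sup>2 * cont c x (l + 2) K"
proof -
  interpret periodic_lattice "\<lambda>l. x $ ev l + c" "\<lambda>l. x $ od l" K by (rule lattice)
  show ?thesis unfolding trace_def cont_def R_const[of l, symmetric] by (rule R_def)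
qed

lemma trace_site: "trace c x = (x $ ev l + c) * cont c x (l + 1) (Suc K) - (x $ od l)\<^sup>2 * cont c x (l + 2) K
    - (x $ od (l - 1))\<^sup>2 * cont c x (l + 1) K"
proof -
  interpret periodic_lattice "\<lambda>l. x $ ev l + c" "\<lambda>l. x $ od l" K by (rule lattice)
  show ?thesis unfolding trace_def cont_def R_const[of l, symmetric] by (rule R_eq)
qed

text \<open>By \<open>trace_site\<close> the trace is affine in \<open>b l\<close>, by
  \<open>trace_edge\<close> it is quadratic in \<open>a l\<close>; cutting the cycle at exactly that
  site or edge ensures that the coefficients do not contain the variable.\<close>

lemma partial_trace:
  "partial (ev l) (trace c) x = cont c x (l + 1) (Suc K)"
  "partial (od l) (trace c) x = - 2 * x $ od l * cont c x (l + 2) K"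
proof -
  show "partial (ev l) (trace c) x = cont c x (l + 1) (Suc K)"
  proof (rule partial_affine)
    fix z
    have "cont c (\<chi> j. if j = ev l then z else x $ j) (l + 1) (Suc K) = cont c x (l + 1) (Suc K)"
      "cont c (\<chi> j. if j = ev l then z else x $ j) (l + 1) K = cont c x (l + 1) K"
      "cont c (\<chi> j. if j = ev l then z else x $ j) (l + 2) K = cont c x (l + 2) K"
      by (rule cont_ev_cong; auto)+
    then show "trace c (\<chi> j. if j = ev l then z else x $ j) = cont c x (l + 1) (Suc K) * z + (c * cont c x (l + 1) (Suc K)
      - (x $ od l)\<^sup>2 * cont c x (l + 2) K - (x $ od (l - 1))\<^sup>2 * cont c x (l + 1) K)"
      unfolding trace_site[of c _ l] other_coordinate by (simp add: algebra_simps)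
  qed
  show "partial (od l) (trace c) x = - 2 * x $ od l * cont c x (l + 2) K"
  proof (rule partial_square)
    fix z
    have "cont c (\<chi> j. if j = od l then z else x $ j) (l + 1) (Suc (Suc K)) = cont c x (l + 1) (Suc (Suc K))"
      "cont c (\<chi> j. if j = od l then z else x $ j) (l + 2) K = cont c x (l + 2) K"
      by (rule cont_od_cong; auto)+
    then show "trace c (\<chi> j. if j = od l then z else x $ j) =
      cont c x (l + 1) (Suc (Suc K)) - z\<^sup>2 * cont c x (l + 2) K"
      unfolding trace_edge[of c _ l] by simp
  qed
qed

lemma bracket_by_sites:
  "bracket UNIV (pencil c 1) f g x = (\<Sum>l\<in>{0..<int (Suc K)}.
     partial (ev l) f x * toda_b 1 (\<lambda>l. x $ ev l + c) (\<lambda>l. x $ od l) (\<lambda>l. partial (ev l) g x) (\<lambda>l. partial (od l) g x) l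
   + partial (od l) f x * toda_a 1 (\<lambda>l. x $ ev l + c) (\<lambda>l. x $ od l) (\<lambda>l. partial (ev l) g x) (\<lambda>l. partial (od l) g x) l)"
  for x :: "complex^('k bit0)"
proof -
  have w: "(\<lambda>l. c + 1 * x $ ev l) = (\<lambda>l. x $ ev l + c)" by (simp add: add.commute)
  show ?thesis
    unfolding bracket_sum_left
      sum_bit0[of "\<lambda>i. partial i f x * (\<Sum>j\<in>UNIV. pencil c 1 i j x * partial j g x)"]
      card pencil_hamiltonian w ..
qed

lemma trace_casimir: "bracket UNIV (pencil c 1) f (trace c) x = 0"
proof -
  interpret periodic_lattice "\<lambda>l. x $ ev l + c" "\<lambda>l. x $ od l" K by (rule lattice)
  show ?thesis
    unfolding bracket_by_sites partial_trace cont_def using toda_fields_trace by simp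
qed

text \<open>The determinant of the Jacobi matrix plus \<open>c\<close> on the sites
  \<open>1, ..., K\<close>, with site \<open>0\<close> removed; monic in \<open>c\<close> of degree
  \<open>K\<close>.\<close>

definition disc :: "complex \<Rightarrow> complex^('k bit0) \<Rightarrow> complex" where
  "disc c x = cont c x 1 (Suc K)"

lemma partial_disc_ev:
  assumes l: "l \<le> Suc K"
  shows "partial (ev (int l)) (disc c) x = cont c x 1 l * cont c x (int l + 1) (Suc K - l)"
proof -
  consider "l = 0" | "l = Suc K" | "1 \<le> l" "l \<le> K" using l by linarith
  then show ?thesis
  proof cases
    case 1
    have "partial (ev (int l)) (disc c) x = 0"
      by (rule partial_affine[where v="disc c x"]) (simp add: disc_def, rule cont_ev_cong, use 1 in auto)
    then show ?thesis using 1 by (simp add: cont_def)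
  next
    case 2
    have "partial (ev (int l)) (disc c) x = 0"
      by (rule partial_affine[where v="disc c x"]) (simp add: disc_def, rule cont_ev_cong, use 2 in auto)
    then show ?thesis using 2 by (simp add: cont_def)
  next
    case 3
    show ?thesis
    proof (rule partial_affine)
      fix z
      let ?y = "\<chi> j. if j = ev (int l) then z else x $ j"
      have cong: "cont c ?y 1 l = cont c x 1 l" "cont c ?y 1 (l - 1) = cont c x 1 (l - 1)"
        "cont c ?y (int l + 1) (Suc K - l) = cont c x (int l + 1) (Suc K - l)"
        "cont c ?y (int l + 2) (K - l) = cont c x (int l + 2) (K - l)"
        by (rule cont_ev_cong; use 3 in auto)+
      have "disc c y = (y $ ev (int l) + c) * cont c y 1 l * cont c y (int l + 1) (Suc K - l)
         - (y $ od (int l))\<^sup>2 * cont c y 1 l * cont c y (int l + 2) (K - l)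
         - (y $ od (int l - 1))\<^sup>2 * cont c y 1 (l - 1) * cont c y (int l + 1) (Suc K - l)" for y
        using periodic_lattice.Q_site[OF lattice 3, of y c]
        unfolding disc_def cont_def periodic_lattice.Q_def[OF lattice] .
      note site = this
      show "disc c ?y = cont c x 1 l * cont c x (int l + 1) (Suc K - l) * z +
         (c * cont c x 1 l * cont c x (int l + 1) (Suc K - l)
         - (x $ od (int l))\<^sup>2 * cont c x 1 l * cont c x (int l + 2) (K - l)
         - (x $ od (int l - 1))\<^sup>2 * cont c x 1 (l - 1) * cont c x (int l + 1) (Suc K - l))"
        unfolding site[of ?y] cong other_coordinate by (simp add: algebra_simps)
    qed
  qed
qed

lemma partial_disc_od:
  assumes l: "l \<le> K"
  shows "partial (od (int l)) (disc c) x = - 2 * x $ od (int l) * cont c x 1 l * cont c x (int l + 2) (K - l)"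
  unfolding mult.assoc[of "- 2 * x $ od (int l)"]
proof (rule partial_square)
  fix z
  let ?y = "\<chi> j. if j = od (int l) then z else x $ j"
  have cong: "cont c ?y 1 l = cont c x 1 l" "cont c ?y 1 (Suc l) = cont c x 1 (Suc l)"
    "cont c ?y (int l + 1) (Suc K - l) = cont c x (int l + 1) (Suc K - l)"
    "cont c ?y (int l + 2) (K - l) = cont c x (int l + 2) (K - l)"
    by (rule cont_od_cong; use l in auto)+
  have "disc c y = cont c y 1 (Suc l) * cont c y (int l + 1) (Suc K - l)
     - (y $ od (int l))\<^sup>2 * cont c y 1 l * cont c y (int l + 2) (K - l)" for y
    using periodic_lattice.Q_edge[OF lattice l, of y c]
    unfolding disc_def cont_def periodic_lattice.Q_def[OF lattice] .
  note edge = this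
  show "disc c ?y = cont c x 1 (Suc l) * cont c x (int l + 1) (Suc K - l)
     - z\<^sup>2 * (cont c x 1 l * cont c x (int l + 2) (K - l))"
    unfolding edge[of ?y] cong by simp
qed

lemma sum_ends:
  fixes F G :: "int \<Rightarrow> complex"
  assumes K: "K \<ge> 1" and F: "\<And>l. 1 \<le> l \<Longrightarrow> l \<le> K \<Longrightarrow> F (int l) = 0" and G: "\<And>l. 1 \<le> l \<Longrightarrow> l < K \<Longrightarrow> G (int l) = 0"
  shows "(\<Sum>l\<in>{0..<int (Suc K)}. F l + G l) = F 0 + G 0 + G (int K)"
proof -
  have F': "F l = 0" if "1 \<le> l" "l \<le> int K" for l using F[of "nat l"] that by simp
  have G': "G l = 0" if "1 \<le> l" "l < int K" for l using G[of "nat l"] that by simp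
  have "(\<Sum>l\<in>{0..<int (Suc K)}. F l) = (\<Sum>l\<in>{0}. F l)"
    using F' by (intro sum.mono_neutral_right) auto
  moreover have "(\<Sum>l\<in>{0..<int (Suc K)}. G l) = (\<Sum>l\<in>{0, int K}. G l)"
    using G' K by (intro sum.mono_neutral_right) auto
  ultimately show ?thesis using K by (simp add: sum.distrib)
qed

text \<open>Used twice: its support explains why the functions \<open>disc c\<close> commute, and
  its explicit values give the brackets with the trace where the chain is cut open.\<close>

lemma disc_fields:
  assumes K: "K \<ge> 1"
  shows "bracket UNIV (pencil c 1) f (disc c) x =
    partial (ev 0) f x * (2 * ((x $ od (int K))\<^sup>2 * cont c x 1 K - (x $ od 0)\<^sup>2 * cont c x 2 K))
    - partial (od 0) f x * x $ od 0 * disc c x + partial (od (int K)) f x * x $ od (int K) * disc c x"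
proof -
  interpret periodic_lattice "\<lambda>l. x $ ev l + c" "\<lambda>l. x $ od l" K by (rule lattice)
  let ?gb = "\<lambda>l. partial (ev l) (disc c) x" and ?ga = "\<lambda>l. partial (od l) (disc c) x"
  have gb: "?gb (int l) = Qb l" if "l \<le> Suc K" for l
    unfolding Qb_def partial_disc_ev[OF that] cont_def ..
  have ga: "?ga (int l) = Qa l" if "l \<le> K" for l
    unfolding Qa_def partial_disc_od[OF that] cont_def ..
  have per: "?gb (l + int (Suc K)) = ?gb l" "?ga (l + int (Suc K)) = ?ga l" for l
    by (simp_all only: card[symmetric] ev_shift od_shift)
  note fields = toda_b_inner[where gb="?gb" and ga="?ga", OF gb ga per]
    toda_a_inner[where gb="?gb" and ga="?ga", OF gb ga per]
    toda_outer[where gb="?gb" and ga="?ga", OF gb ga per K]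
  show ?thesis
    unfolding bracket_by_sites
    by (subst sum_ends[OF K]) (simp_all add: fields cont_def disc_def Q_def mult.assoc)
qed

text \<open>The Hamiltonian field of \<open>disc c\<close> lives on \<open>ev 0\<close>,
  \<open>od 0\<close> and \<open>od (int K)\<close>, exactly where every \<open>disc c'\<close> has
  zero derivative. For \<open>K = 0\<close> these functions are constant.\<close>

lemma disc_commute_pencil: "bracket UNIV (pencil c 1) (disc c') (disc c) x = 0"
proof (cases "K = 0")
  case True
  have "disc c' = (\<lambda>x. 1)" unfolding disc_def cont_def fun_eq_iff unfolding True by simp
  then show ?thesis by simp
next
  case False
  then have K: "K \<ge> 1" by simp
  have "partial (ev 0) (disc c') x = 0" "partial (od 0) (disc c') x = 0" "partial (od (int K)) (disc c') x = 0"
    using partial_disc_ev[of 0 c' x] partial_disc_od[of 0 c' x] partial_disc_od[of K c' x] by (simp_all add: cont_def)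
  then show ?thesis unfolding disc_fields[OF K] by simp
qed

text \<open>Both \<open>c\<close> and \<open>c'\<close> give a linear relation between the two
  brackets; the determinant of the system is \<open>c - c'\<close>.\<close>

lemma disc_commute:
  assumes "c \<noteq> c'"
  shows "bracket UNIV (pencil 1 0) (disc c') (disc c) x = 0" "bracket UNIV (pencil 0 1) (disc c') (disc c) x = 0"
proof -
  let ?b1 = "bracket UNIV (pencil 1 0) (disc c') (disc c) x" and ?b2 = "bracket UNIV (pencil 0 1) (disc c') (disc c) x"
  have 1: "c * ?b1 + ?b2 = 0" using disc_commute_pencil[of c c' x] bracket_pencil[of c 1 "disc c'" "disc c" x] by simp
  have "bracket UNIV (pencil c' 1) (disc c') (disc c) x = - bracket UNIV (pencil c' 1) (disc c) (disc c') x"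
    by (rule bracket_antisym) (rule pencil_antisym)
  then have 2: "c' * ?b1 + ?b2 = 0" using disc_commute_pencil[of c' c x] bracket_pencil[of c' 1 "disc c'" "disc c" x] by simp
  from 1 2 have "(c - c') * ?b1 = 0" by algebra
  then show "?b1 = 0" using assms by simp
  with 1 show "?b2 = 0" by simp
qed


text \<open>The same recursion over the polynomial ring, with \<open>c\<close> as the indeterminate;
  this is why \<open>continuant\<close> is defined over arbitrary commutative rings.\<close>

definition contp :: "complex^('k bit0) \<Rightarrow> int \<Rightarrow> nat \<Rightarrow> complex poly" where
  "contp x = continuant (\<lambda>l. [:x $ ev l, 1:]) (\<lambda>l. [:x $ od l:])"

lemma poly_contp: "poly (contp x i n) c = cont c x i n"
proof (induction n rule: induct_nat_012)
  case (ge2 n)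
  then show ?case by (simp add: contp_def cont_def distrib_right)
qed (simp_all add: contp_def cont_def)

lemma contp_monic: "degree (contp x i n) \<le> n - 1 \<and> (n \<ge> 1 \<longrightarrow> coeff (contp x i n) (n - 1) = 1)"
proof (induction n rule: induct_nat_012)
  case (ge2 n)
  let ?p = "contp x i (Suc n)" and ?q = "contp x i n"
  have rec: "contp x i (Suc (Suc n)) = smult (x $ ev (i + int n)) ?p + pCons 0 ?p - smult ((x $ od (i + int n - 1))\<^sup>2) ?q"
    by (simp add: contp_def power2_eq_square)
  have p: "degree ?p \<le> n" "coeff ?p n = 1" and q: "degree ?q \<le> n - 1" using ge2 by simp_all
  have "degree (pCons 0 ?p) \<le> Suc n" using p degree_pCons_le[of 0 ?p] by linarith
  moreover have "degree (smult (x $ ev (i + int n)) ?p) \<le> Suc n" "degree (smult ((x $ od (i + int n - 1))\<^sup>2) ?q) \<le> Suc n"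
    using p q degree_smult_le[of _ ?p] degree_smult_le[of _ ?q] by (meson le_SucI le_trans diff_le_self)+
  ultimately have "degree (contp x i (Suc (Suc n))) \<le> Suc n"
    unfolding rec by (intro degree_diff_le degree_add_le)
  moreover have "coeff ?p (Suc n) = 0" "coeff ?q (Suc n) = 0" using p q by (intro coeff_eq_0; linarith)+
  ultimately show ?case using p by (simp add: rec)
qed (simp_all add: contp_def)

lemma contp_coeff_mholomorphic_on: "mholomorphic_on S (\<lambda>x. coeff (contp x i n) q)"
proof (induction n arbitrary: q rule: induct_nat_012)
  case (ge2 n)
  have rec: "contp x i (Suc (Suc n)) = smult (x $ ev (i + int n)) (contp x i (Suc n)) + pCons 0 (contp x i (Suc n))
      - smult ((x $ od (i + int n - 1))\<^sup>2) (contp x i n)" for x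
    by (simp add: contp_def power2_eq_square)
  have "mholomorphic_on S (\<lambda>x. coeff (pCons 0 (contp x i (Suc n))) q)"
    using ge2 by (cases q) simp_all
  then show ?case unfolding rec coeff_diff coeff_add coeff_smult
    by (intro mholomorphic_intros ge2)
qed (simp_all add: contp_def)

definition tracep :: "complex^('k bit0) \<Rightarrow> complex poly" where
  "tracep x = contp x 1 (Suc (Suc K)) - smult ((x $ od 0)\<^sup>2) (contp x 2 K)"

definition H :: "nat \<Rightarrow> complex^('k bit0) \<Rightarrow> complex" where "H l x = coeff (tracep x) l"

definition s :: "nat \<Rightarrow> complex^('k bit0) \<Rightarrow> complex" where "s q x = coeff (contp x 1 (Suc K)) q"

definition A :: "complex^('k bit0) \<Rightarrow> complex" where "A x = (\<Prod>l\<in>{0..<int (Suc K)}. x $ od l)"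

lemma H_mholomorphic_on: "mholomorphic_on S (H l)"
  unfolding H_def[abs_def] tracep_def coeff_diff coeff_smult
  by (intro mholomorphic_intros contp_coeff_mholomorphic_on)

lemma s_mholomorphic_on: "mholomorphic_on S (s q)"
  unfolding s_def[abs_def] by (rule contp_coeff_mholomorphic_on)

lemma A_mholomorphic_on: "mholomorphic_on S A"
  unfolding A_def[abs_def] by (intro mholomorphic_intros)

lemma trace_sum: "trace c = (\<lambda>x. \<Sum>l\<le>Suc K. H l x * c ^ l)"
proof
  fix x
  have "trace c x = poly (tracep x) c"
    using trace_edge[of c x 0] by (simp add: tracep_def poly_contp)
  moreover have "degree (tracep x) \<le> Suc K"
    unfolding tracep_def using contp_monic[of x 1 "Suc (Suc K)"] contp_monic[of x 2 K] degree_smult_le[of _ "contp x 2 K"]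
    by (intro degree_diff_le) (simp, meson le_SucI le_trans diff_le_self)
  ultimately show "trace c x = (\<Sum>l\<le>Suc K. H l x * c ^ l)"
    by (simp only: poly_sum_atMost H_def)
qed

text \<open>Monicity closes the chain: the coefficient above \<open>H K\<close> is constant, which
  makes \<open>H K\<close> a Casimir function of the first bracket.\<close>

lemma H_top: "H (Suc K) = (\<lambda>x. 1)"
proof
  fix x
  have "coeff (contp x 2 K) (Suc K) = 0"
    using contp_monic[of x 2 K] by (intro coeff_eq_0) linarith
  then show "H (Suc K) x = 1"
    using contp_monic[of x 1 "Suc (Suc K)"] by (simp add: H_def tracep_def)
qed

lemma disc_sum: "disc c = (\<lambda>x. \<Sum>q\<le>K. s q x * c ^ q)"
proof
  fix x
  have "degree (contp x 1 (Suc K)) \<le> K" using contp_monic[of x 1 "Suc K"] by simp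
  then show "disc c x = (\<Sum>q\<le>K. s q x * c ^ q)"
    unfolding disc_def poly_contp[symmetric] s_def by (rule poly_sum_atMost)
qed

lemma s_large: "q \<ge> K \<Longrightarrow> s q = (\<lambda>x. if q = K then 1 else 0)"
proof
  fix x assume "q \<ge> K"
  then show "s q x = (if q = K then 1 else 0)"
    using contp_monic[of x 1 "Suc K"] by (auto simp: s_def intro: coeff_eq_0)
qed

lemma bracket_trace: "bracket UNIV P f (trace c) x = (\<Sum>l\<le>Suc K. bracket UNIV P f (H l) x * c ^ l)"
  unfolding trace_sum by (rule bracket_linear_right[OF H_mholomorphic_on])

lemma bracket_disc: "bracket UNIV P f (disc c) x = (\<Sum>q\<le>K. bracket UNIV P f (s q) x * c ^ q)"
  unfolding disc_sum by (rule bracket_linear_right[OF s_mholomorphic_on])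

lemma lenard:
  "bracket UNIV (pencil 0 1) f (H 0) x = 0"
  "l \<le> K \<Longrightarrow> bracket UNIV (pencil 0 1) f (H (Suc l)) x = - bracket UNIV (pencil 1 0) f (H l) x"
  "bracket UNIV (pencil 1 0) f (H K) x = 0"
proof -
  let ?u = "\<lambda>l. bracket UNIV (pencil 1 0) f (H l) x" and ?v = "\<lambda>l. bracket UNIV (pencil 0 1) f (H l) x"
  have top: "?u (Suc K) = 0" "?v (Suc K) = 0" by (simp_all add: H_top)
  \<comment> \<open>The Casimir identity as a polynomial in \<open>c\<close>. The first bracket
    carries a factor \<open>c\<close>, which shifts its coefficients by one and leaves
    \<open>0\<close> at \<open>l = 0\<close>.\<close>
  have "(\<Sum>l\<le>Suc K. (?v l + (if l = 0 then 0 else ?u (l - 1))) * c ^ l) = 0" for c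
  proof -
    have "c * (\<Sum>l\<le>K. ?u l * c ^ l) + (\<Sum>l\<le>Suc K. ?v l * c ^ l) = 0"
      using trace_casimir[of c f x] bracket_pencil[of c 1 f "trace c" x] top by (simp add: bracket_trace)
    moreover have "c * (\<Sum>l\<le>K. ?u l * c ^ l) = (\<Sum>l\<le>Suc K. (if l = 0 then 0 else ?u (l - 1)) * c ^ l)"
      by (subst sum.atMost_Suc_shift) (simp add: sum_distrib_left mult_ac)
    ultimately show ?thesis by (simp only: distrib_right sum.distrib) (simp add: add.commute)
  qed
  then have coeffs: "\<forall>l\<le>Suc K. ?v l + (if l = 0 then 0 else ?u (l - 1)) = 0"
    by (intro iffD1[OF polyfun_eq_0] allI)
  show "?v 0 = 0" using spec[OF coeffs, of 0] by simp
  show v: "?v (Suc l) = - ?u l" if "l \<le> K" for l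
    using spec[OF coeffs, of "Suc l"] that by (simp add: eq_neg_iff_add_eq_0)
  show "?u K = 0" using v[of K] top by simp
qed

text \<open>The brackets of \<open>disc c'\<close> and \<open>disc c\<close> vanish for
  \<open>c \<noteq> c'\<close>; these infinitely many \<open>c\<close> suffice to kill all
  coefficients in \<open>c\<close>, after which \<open>c'\<close> is arbitrary and its coefficients
  vanish too.\<close>

lemma s_commute: "bracket UNIV (pencil 1 0) (s q) (s r) x = 0" "bracket UNIV (pencil 0 1) (s q) (s r) x = 0"
proof -
  have "bracket UNIV P (s q) (s r) x = 0"
    if anti: "\<And>i j x. P i j x = - P j i x" and zero: "\<And>c c'. c \<noteq> c' \<Longrightarrow> bracket UNIV P (disc c') (disc c) x = 0" for P q r
  proof (cases "q \<le> K \<and> r \<le> K")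
    case True
    have anti': "bracket UNIV P f g x = - bracket UNIV P g f x" for f g
      by (rule bracket_antisym) (rule anti)
    have 1: "bracket UNIV P (disc c') (s r) x = 0" if "r \<le> K" for c' r
    proof -
      have "UNIV - {c'} \<subseteq> {c. (\<Sum>q\<le>K. bracket UNIV P (disc c') (s q) x * c ^ q) = 0}"
        using zero[of _ c'] by (auto simp: bracket_disc)
      moreover have "infinite (UNIV - {c'})" by (simp add: infinite_UNIV_char_0)
      ultimately have "infinite {c. (\<Sum>q\<le>K. bracket UNIV P (disc c') (s q) x * c ^ q) = 0}"
        using finite_subset by blast
      then have "\<not> (\<exists>q\<le>K. bracket UNIV P (disc c') (s q) x \<noteq> 0)" by (simp only: polyfun_finite_roots[symmetric] not_False_eq_True)
      then show ?thesis using that by simp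
    qed
    have "(\<Sum>q\<le>K. bracket UNIV P (s r) (s q) x * c ^ q) = 0" for c
      using 1[of r c] True anti'[of "s r" "disc c"] by (simp add: bracket_disc)
    then have "\<forall>q\<le>K. bracket UNIV P (s r) (s q) x = 0" by (intro iffD1[OF polyfun_eq_0] allI)
    then have "bracket UNIV P (s r) (s q) x = 0" using True by simp
    then show ?thesis using anti'[of "s q" "s r"] by simp
  next
    case False
    then show ?thesis by (auto simp: s_large)
  qed
  note main = this
  show "bracket UNIV (pencil 1 0) (s q) (s r) x = 0"
    by (rule main[where P="pencil 1 0"]) (rule pencil_antisym, rule disc_commute(1))
  show "bracket UNIV (pencil 0 1) (s q) (s r) x = 0"
    by (rule main[where P="pencil 0 1"]) (rule pencil_antisym, rule disc_commute(2))
qed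

end

section \<open>Generic points\<close>

lemma unitriangular_kernel:
  fixes d :: "nat \<Rightarrow> nat \<Rightarrow> complex"
  assumes diag: "\<And>q. q < K \<Longrightarrow> d q q = 1" and upper: "\<And>q r. q < r \<Longrightarrow> d q r = 0"
    and ker: "\<And>q. q < K \<Longrightarrow> (\<Sum>r<K. d q r * \<gamma> r) = 0" and q: "q < K"
  shows "\<gamma> q = 0"
  using q
proof (induction q rule: less_induct)
  case (less q)
  have "(\<Sum>r<K. d q r * \<gamma> r) = (\<Sum>r<K. if r = q then \<gamma> q else 0)"
  proof (intro sum.cong refl)
    fix r assume "r \<in> {..<K}"
    then show "d q r * \<gamma> r = (if r = q then \<gamma> q else 0)"
      using less diag upper by (cases r q rule: linorder_cases) auto
  qed
  then show ?case using ker[OF less.prems] less.prems by simp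
qed

lemma unitriangular_cokernel:
  fixes d :: "nat \<Rightarrow> nat \<Rightarrow> complex"
  assumes diag: "\<And>q. q < K \<Longrightarrow> d q q = 1" and upper: "\<And>q r. q < r \<Longrightarrow> d q r = 0"
    and ker: "\<And>r. r < K \<Longrightarrow> (\<Sum>q<K. g q * d q r) = 0" and q: "q < K"
  shows "g q = 0"
  using q
proof (induction "K - q" arbitrary: q rule: less_induct)
  case less
  have "(\<Sum>r<K. g r * d r q) = (\<Sum>r<K. if r = q then g q else 0)"
  proof (intro sum.cong refl)
    fix r assume "r \<in> {..<K}"
    then show "g r * d r q = (if r = q then g q else 0)"
      using less diag upper by (cases r q rule: linorder_cases) auto
  qed
  then show ?case using ker[OF less.prems] less.prems by simp
qed

text \<open>If \<open>f\<close> vanished on a ball around \<open>x\<close>, its restriction to the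
  complex line through \<open>x\<close> and \<open>x0\<close> would be an entire function that
  vanishes near \<open>0\<close> but not at \<open>1\<close>.\<close>

lemma closure_nonzero_set:
  fixes f :: "complex^'n::finite \<Rightarrow> complex"
  assumes f: "mholomorphic_on UNIV f" and x0: "f x0 \<noteq> 0"
  shows "closure {x. f x \<noteq> 0} = UNIV"
proof (rule ccontr)
  assume "closure {x. f x \<noteq> 0} \<noteq> UNIV"
  then obtain x where x: "x \<notin> closure {x. f x \<noteq> 0}" by blast
  then obtain e where e: "e > 0" "ball x e \<subseteq> - closure {x. f x \<noteq> 0}"
    using openE[of "- closure {x. f x \<noteq> 0}" x] by auto
  have zero: "f y = 0" if "y \<in> ball x e" for y
    using that e(2) closure_subset[of "{x. f x \<noteq> 0}"] by blast
  define r where "r = (\<lambda>t. f (x + t *s (x0 - x)))"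
  have line: "((\<lambda>t. x + t *s (x0 - x)) has_derivative (\<lambda>h. h *s (x0 - x))) (at t)" for t
    by (rule has_derivative_vec) (auto intro!: derivative_eq_intros)
  have "(r has_field_derivative (\<Sum>i\<in>UNIV. (x0 - x) $ i * partial i f (x + t *s (x0 - x)))) (at t)" for t
  proof -
    have "(r has_derivative (\<lambda>h. \<Sum>i\<in>UNIV. (h *s (x0 - x)) $ i * partial i f (x + t *s (x0 - x)))) (at t)"
      unfolding r_def
      by (rule has_derivative_compose[OF line mholomorphic_on_has_derivative[OF open_UNIV UNIV_I f]])
    then show ?thesis
      unfolding has_field_derivative_def by (rule has_derivative_eq_rhs) (simp add: fun_eq_iff sum_distrib_left algebra_simps)
  qed
  then have hol: "r holomorphic_on UNIV" by (auto simp: holomorphic_on_def field_differentiable_def intro: has_field_derivative_at_within)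
  have "continuous_on UNIV (\<lambda>t. x + t *s (x0 - x))"
    by (intro continuous_at_imp_continuous_on ballI has_derivative_continuous[OF line])
  then have op: "open ((\<lambda>t. x + t *s (x0 - x)) -` ball x e)" by (intro open_vimage) auto
  have "0 islimpt ((\<lambda>t. x + t *s (x0 - x)) -` ball x e)"
    using e by (intro interior_limit_point, unfold interior_open[OF op]) simp
  moreover have "r t = 0" if "t \<in> (\<lambda>t. x + t *s (x0 - x)) -` ball x e" for t
    using that zero by (simp add: r_def)
  ultimately have "r 1 = 0"
    using analytic_continuation[OF hol open_UNIV connected_UNIV subset_UNIV UNIV_I] by blast
  then show False using x0 by (simp add: r_def)
qed

text \<open>The Chebyshev polynomials of the second kind, \<open>U_(n-1)(c / 2)\<close>, with the
  same index shift as \<open>continuant\<close>.\<close>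

fun cheb :: "nat \<Rightarrow> complex \<Rightarrow> complex" where
  "cheb 0 c = 0"
| "cheb (Suc 0) c = 1"
| "cheb (Suc (Suc n)) c = c * cheb (Suc n) c - cheb n c"

lemma christoffel_darboux:
  "cheb (Suc n) \<zeta> * cheb n \<mu> - cheb n \<zeta> * cheb (Suc n) \<mu> = (\<zeta> - \<mu>) * (\<Sum>q<n. cheb (Suc q) \<zeta> * cheb (Suc q) \<mu>)"
  by (induction n) (simp_all add: algebra_simps)

section \<open>The Casimir function of the edges and the chain cut open\<close>

context toda
begin

lemma partial_A_ev: "partial (ev l) A x = 0"
  by (rule partial_affine[where v="A x"]) (simp only: A_def other_coordinate, simp)

text \<open>The product form also holds where a factor is zero. Its right-hand side does not depend
  on \<open>l\<close>, so the differences of neighbouring terms in \<open>toda_b\<close> and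
  \<open>toda_a\<close> cancel and \<open>A\<close> is a Casimir function.\<close>

lemma partial_A_od: "x $ od l * partial (od l) A x = A x"
proof -
  define m where "m = l mod int (Suc K)"
  have m: "m \<in> {0..<int (Suc K)}" by (simp add: m_def)
  have od: "(od l :: 'k bit0) = od m" by (simp add: od_eq_iff card m_def mod_eq_dvd_iff[symmetric])
  have A: "A y = y $ od m * (\<Prod>n\<in>{0..<int (Suc K)} - {m}. y $ od n)" for y
    unfolding A_def using m by (subst prod.remove[of _ m]) auto
  have "partial (od l) A x = (\<Prod>n\<in>{0..<int (Suc K)} - {m}. x $ od n)"
  proof (rule partial_affine[where v=0])
    fix z
    have "\<not> int (Suc K) dvd n - m" if "n \<in> {0..<int (Suc K)} - {m}" for n
      using that m by (intro not_period) auto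
    then have "(\<Prod>n\<in>{0..<int (Suc K)} - {m}. (\<chi> j. if j = od m then z else x $ j) $ od n) = (\<Prod>n\<in>{0..<int (Suc K)} - {m}. x $ od n)"
      unfolding od_coordinate by (intro prod.cong) auto
    then show "A (\<chi> j. if j = od l then z else x $ j) = (\<Prod>n\<in>{0..<int (Suc K)} - {m}. x $ od n) * z + 0"
      unfolding A od by simp
  qed
  then show ?thesis unfolding A od by simp
qed

lemma A_casimir_pencil: "bracket UNIV (pencil c 1) f A x = 0"
proof -
  have "toda_b 1 w (\<lambda>l. x $ od l) (\<lambda>l. 0) (\<lambda>l. partial (od l) A x) l = 0"
    "toda_a 1 w (\<lambda>l. x $ od l) (\<lambda>l. 0) (\<lambda>l. partial (od l) A x) l = 0" for w l
    by (simp_all add: toda_b_def toda_a_def partial_A_od)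
  then show ?thesis unfolding bracket_by_sites partial_A_ev by simp
qed

lemma A_casimir: "bracket UNIV (pencil 1 0) f A x = 0" "bracket UNIV (pencil 0 1) f A x = 0"
  using A_casimir_pencil[of 0 f x] A_casimir_pencil[of 1 f x] bracket_pencil[of 0 1 f A x] bracket_pencil[of 1 1 f A x]
  by simp_all

text \<open>The derivative of the trace with respect to \<open>b 0\<close> is \<open>disc\<close>,
  which is monic of degree \<open>K\<close> in the parameter.\<close>

lemma partial_H_ev: "partial (ev 0) (H K) x = 1"
proof -
  have "(\<Sum>l\<le>Suc K. partial (ev 0) (H l) x * c ^ l) = (\<Sum>l\<le>Suc K. (if l = Suc K then 0 else s l x) * c ^ l)" for c
  proof -
    have "(\<Sum>l\<le>Suc K. partial (ev 0) (H l) x * c ^ l) = partial (ev 0) (trace c) x"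
      unfolding trace_sum by (subst partial_sum[OF open_UNIV UNIV_I])
        (auto intro!: mholomorphic_on_mult H_mholomorphic_on simp: partial_mult[OF open_UNIV UNIV_I H_mholomorphic_on])
    also have "\<dots> = disc c x" using partial_trace(1)[of 0 c x] by (simp add: disc_def)
    also have "\<dots> = (\<Sum>l\<le>Suc K. (if l = Suc K then 0 else s l x) * c ^ l)"
      by (simp add: disc_sum)
    finally show ?thesis .
  qed
  then have "\<forall>l\<le>Suc K. partial (ev 0) (H l) x = (if l = Suc K then 0 else s l x)"
    by (intro iffD1[OF polyfun_eq_coeffs] allI)
  then show ?thesis by (simp add: s_large)
qed

lemma casimir_independent:
  assumes "A x \<noteq> 0" "\<forall>i. \<alpha> * partial i (H K) x + \<beta> * partial i A x = 0"
  shows "\<alpha> = 0 \<and> \<beta> = 0"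
proof -
  have "\<alpha> = 0" using spec[OF assms(2), of "ev 0"] by (simp add: partial_H_ev partial_A_ev)
  moreover have "partial (od 0) A x \<noteq> 0" using partial_A_od[of x 0] assms(1) by auto
  ultimately show ?thesis using spec[OF assms(2), of "od 0"] by simp
qed

text \<open>
  At the point where the periodic chain is cut open (\<open>a 0 = 0\<close>) and all other \<open>a l\<close> are
  \<open>1\<close>, all \<open>b l\<close> are \<open>0\<close>, the matrix of the brackets of \<open>H l\<close> and
  \<open>s q\<close> is a Christoffel-Darboux kernel.
\<close>

definition cut_point :: "complex^('k bit0)" where
  "cut_point = (\<chi> i. if \<exists>l. i = od l \<and> \<not> int (Suc K) dvd l then 1 else 0)"

lemma cut_point_ev: "cut_point $ ev l = 0"
  by (simp add: cut_point_def ev_neq_od)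

lemma cut_point_od: "cut_point $ od l = (if int (Suc K) dvd l then 0 else 1)"
proof -
  have "(\<exists>m. (od l :: 'k bit0) = od m \<and> \<not> int (Suc K) dvd m) \<longleftrightarrow> \<not> int (Suc K) dvd l"
    unfolding od_eq_iff card by (metis cancel_comm_monoid_add_class.diff_cancel diff_diff_eq2 diff_add_cancel dvd_0_right dvd_add_right_iff)
  then show ?thesis by (simp add: cut_point_def)
qed

lemma cont_cut_point: "n \<le> Suc K \<Longrightarrow> cont c cut_point 1 n = cheb n c"
proof (induction n rule: induct_nat_012)
  case (ge2 n)
  \<comment> \<open>The recursion meets the edge \<open>a n\<close>. The cut edge occurs only for
    \<open>n = 0\<close>, where it is multiplied by a continuant of length \<open>0\<close>.\<close>
  have "n = 0 \<or> \<not> int (Suc K) dvd int n" using not_period[of 0 "int n"] ge2 by auto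
  then show ?case using ge2 by (auto simp: cont_def cut_point_ev cut_point_od)
qed (simp_all add: cont_def)

text \<open>The pencil members \<open>\<zeta>\<close> and \<open>\<mu>\<close> give two relations
  between the first and the second bracket: the trace is a Casimir function for
  \<open>\<zeta>\<close>, and \<open>disc_fields\<close> evaluates the other. Their difference
  carries \<open>\<zeta> - \<mu>\<close>, which Christoffel-Darboux also provides on the
  right.\<close>

lemma bracket_cut_point:
  assumes "\<zeta> \<noteq> \<mu>" and K: "K \<ge> 1"
  shows "bracket UNIV (pencil 1 0) (trace \<zeta>) (disc \<mu>) cut_point = - 2 * (\<Sum>q<K. cheb (Suc q) \<zeta> * cheb (Suc q) \<mu>)"
proof -
  let ?x = cut_point
  let ?b1 = "bracket UNIV (pencil 1 0) (trace \<zeta>) (disc \<mu>) ?x" and ?b2 = "bracket UNIV (pencil 0 1) (trace \<zeta>) (disc \<mu>) ?x"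
  have "bracket UNIV (pencil \<zeta> 1) (trace \<zeta>) (disc \<mu>) ?x = - bracket UNIV (pencil \<zeta> 1) (disc \<mu>) (trace \<zeta>) ?x"
    by (rule bracket_antisym) (rule pencil_antisym)
  then have 1: "\<zeta> * ?b1 + ?b2 = 0" using bracket_pencil[of \<zeta> 1 "trace \<zeta>" "disc \<mu>" ?x] trace_casimir by simp
  have aK: "?x $ od (int K) = 1" using not_period[of 0 "int K"] K by (simp add: cut_point_od)
  have a0: "?x $ od 0 = 0" by (simp add: cut_point_od)
  have shift: "cont \<zeta> ?x (int K + 2) K = cheb K \<zeta>"
  proof -
    have "cont \<zeta> ?x (1 + int (Suc K)) K = cont \<zeta> ?x 1 K"
      unfolding cont_def
      by (rule continuant_shift) (rule periodic_lattice.b_per[OF lattice], rule periodic_lattice.a_per[OF lattice])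
    then show ?thesis by (simp add: cont_cut_point add.commute)
  qed
  have "\<mu> * ?b1 + ?b2 = 2 * (cheb (Suc K) \<zeta> * cheb K \<mu> - cheb K \<zeta> * cheb (Suc K) \<mu>)"
    using disc_fields[OF K, of \<mu> "trace \<zeta>" ?x] partial_trace[of 0 \<zeta> ?x] partial_trace[of "int K" \<zeta> ?x]
      bracket_pencil[of \<mu> 1 "trace \<zeta>" "disc \<mu>" ?x]
    by (simp add: aK a0 shift disc_def cont_cut_point)
  also have "\<dots> = 2 * ((\<zeta> - \<mu>) * (\<Sum>q<K. cheb (Suc q) \<zeta> * cheb (Suc q) \<mu>))"
    by (simp only: christoffel_darboux)
  finally have "(\<zeta> - \<mu>) * ?b1 = (\<zeta> - \<mu>) * (- 2 * (\<Sum>q<K. cheb (Suc q) \<zeta> * cheb (Suc q) \<mu>))"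
    using 1 by algebra
  then show ?thesis using assms(1) by (simp only: mult_cancel_left right_minus_eq) simp
qed

text \<open>With \<open>d\<close> the unitriangular coefficient matrix of the Chebyshev polynomials,
  the bracket matrix is \<open>-2\<close> times the transpose of \<open>d\<close> times
  \<open>d\<close>. A kernel vector is eliminated factor by factor.\<close>

lemma cut_point_nondegenerate:
  assumes ker: "\<forall>l<K. (\<Sum>q<K. bracket UNIV (pencil 1 0) (H l) (s q) cut_point * \<gamma> q) = 0"
  shows "\<forall>q<K. \<gamma> q = 0"
proof (cases "K = 0")
  case False
  then have K: "K \<ge> 1" by simp
  let ?x = cut_point
  define d where "d = (\<lambda>q r. coeff (contp ?x 1 (Suc q)) r)"
  have d: "d q q = 1" "q < r \<Longrightarrow> d q r = 0" for q r
    using contp_monic[of ?x 1 "Suc q"] by (auto simp: d_def intro: coeff_eq_0)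
  have cheb_d: "cheb (Suc q) c = (\<Sum>r\<le>K. d q r * c ^ r)" if "q \<le> K" for q c
  proof -
    have "cheb (Suc q) c = poly (contp ?x 1 (Suc q)) c" using that by (simp only: poly_contp cont_cut_point Suc_le_mono)
    moreover have "degree (contp ?x 1 (Suc q)) \<le> K" using contp_monic[of ?x 1 "Suc q"] that by simp
    ultimately show ?thesis unfolding d_def by (simp only: poly_sum_atMost)
  qed
  have anti: "bracket UNIV (pencil 1 0) f g y = - bracket UNIV (pencil 1 0) g f y" for f g and y :: "complex^('k bit0)"
    by (rule bracket_antisym) (rule pencil_antisym)
  have coeff: "bracket UNIV (pencil 1 0) (trace \<zeta>) (s r) ?x = - 2 * (\<Sum>q<K. cheb (Suc q) \<zeta> * d q r)" if "r \<le> K" for \<zeta> r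
  proof -
    let ?c = "\<lambda>r. bracket UNIV (pencil 1 0) (trace \<zeta>) (s r) ?x + 2 * (\<Sum>q<K. cheb (Suc q) \<zeta> * d q r)"
    have "(\<Sum>r\<le>K. ?c r * \<mu> ^ r) = 0" if "\<mu> \<noteq> \<zeta>" for \<mu>
    proof -
      have "(\<Sum>r\<le>K. (\<Sum>q<K. cheb (Suc q) \<zeta> * d q r) * \<mu> ^ r) = (\<Sum>r\<le>K. \<Sum>q<K. cheb (Suc q) \<zeta> * (d q r * \<mu> ^ r))"
        by (simp add: sum_distrib_right mult.assoc)
      also have "\<dots> = (\<Sum>q<K. cheb (Suc q) \<zeta> * (\<Sum>r\<le>K. d q r * \<mu> ^ r))"
        by (subst sum.swap) (simp add: sum_distrib_left)
      also have "\<dots> = (\<Sum>q<K. cheb (Suc q) \<zeta> * cheb (Suc q) \<mu>)"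
        by (intro sum.cong refl) (simp add: cheb_d)
      finally have "(\<Sum>r\<le>K. ?c r * \<mu> ^ r) = bracket UNIV (pencil 1 0) (trace \<zeta>) (disc \<mu>) ?x
          + 2 * (\<Sum>q<K. cheb (Suc q) \<zeta> * cheb (Suc q) \<mu>)"
        by (simp add: bracket_disc distrib_right sum.distrib mult.assoc sum_distrib_left[symmetric])
      then show ?thesis using bracket_cut_point[OF _ K, of \<zeta> \<mu>] that by simp
    qed
    then have "UNIV - {\<zeta>} \<subseteq> {\<mu>. (\<Sum>r\<le>K. ?c r * \<mu> ^ r) = 0}" by blast
    moreover have "infinite (UNIV - {\<zeta>})" by (simp add: infinite_UNIV_char_0)
    ultimately have "infinite {\<mu>. (\<Sum>r\<le>K. ?c r * \<mu> ^ r) = 0}" using finite_subset by blast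
    then have "\<not> (\<exists>r\<le>K. ?c r \<noteq> 0)" by (simp only: polyfun_finite_roots[symmetric] not_False_eq_True)
    then have "?c r = 0" using that by blast
    then show ?thesis by (simp add: eq_neg_iff_add_eq_0)
  qed
  define g where "g = (\<lambda>q. \<Sum>r<K. d q r * \<gamma> r)"
  have "(\<Sum>r\<le>K. (\<Sum>q<K. g q * d q r) * \<zeta> ^ r) = 0" for \<zeta>
  proof -
    \<comment> \<open>The hypothesis covers \<open>l < K\<close>; the two remaining coefficients of
      the trace are a Casimir function and a constant, so the relation extends to the whole
      trace.\<close>
    have H0: "(\<Sum>r<K. bracket UNIV (pencil 1 0) (s r) (H l) ?x * \<gamma> r) = 0" if l: "l \<le> Suc K" for l
    proof -
      consider "l < K" | "l = K" | "l = Suc K" using l by linarith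
      then show ?thesis
      proof cases
        case 1
        then show ?thesis using ker anti[of "s _" "H l"] by (simp add: sum_negf)
      qed (simp_all add: lenard(3) H_top)
    qed
    have "(\<Sum>r<K. bracket UNIV (pencil 1 0) (trace \<zeta>) (s r) ?x * \<gamma> r) =
        - (\<Sum>r<K. \<Sum>l\<le>Suc K. bracket UNIV (pencil 1 0) (s r) (H l) ?x * \<zeta> ^ l * \<gamma> r)"
      by (subst anti) (simp only: bracket_trace sum_distrib_right sum_negf minus_mult_left[symmetric])
    also have "\<dots> = - (\<Sum>l\<le>Suc K. \<zeta> ^ l * (\<Sum>r<K. bracket UNIV (pencil 1 0) (s r) (H l) ?x * \<gamma> r))"
      by (subst sum.swap) (simp only: sum_distrib_left mult_ac)
    also have "\<dots> = 0" by (simp add: H0 del: sum.atMost_Suc)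
    also have "(\<Sum>r<K. bracket UNIV (pencil 1 0) (trace \<zeta>) (s r) ?x * \<gamma> r) =
        - 2 * (\<Sum>r<K. (\<Sum>q<K. cheb (Suc q) \<zeta> * d q r) * \<gamma> r)"
      unfolding sum_distrib_left[of "- 2" _ "{..<K}"] by (intro sum.cong refl) (simp add: coeff)
    finally have "(\<Sum>r<K. (\<Sum>q<K. cheb (Suc q) \<zeta> * d q r) * \<gamma> r) = 0"
      by simp
    moreover have "(\<Sum>r<K. (\<Sum>q<K. cheb (Suc q) \<zeta> * d q r) * \<gamma> r) = (\<Sum>q<K. cheb (Suc q) \<zeta> * g q)"
      unfolding g_def sum_distrib_right sum_distrib_left by (subst sum.swap) (simp add: mult.assoc)
    moreover have "\<dots> = (\<Sum>q<K. \<Sum>r\<le>K. g q * d q r * \<zeta> ^ r)"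
      by (intro sum.cong refl) (simp add: cheb_d sum_distrib_left mult_ac)
    moreover have "\<dots> = (\<Sum>r\<le>K. (\<Sum>q<K. g q * d q r) * \<zeta> ^ r)"
      by (subst sum.swap) (simp add: sum_distrib_right)
    ultimately show ?thesis by simp
  qed
  then have "\<forall>r\<le>K. (\<Sum>q<K. g q * d q r) = 0" by (intro iffD1[OF polyfun_eq_0] allI)
  then have "g q = 0" if "q < K" for q
    using unitriangular_cokernel[of K d g q] d that by simp
  then show ?thesis using unitriangular_kernel[of K d \<gamma>] d by (simp add: g_def)
qed simp


section \<open>The generic set and the Kronecker type\<close>

definition pos :: "'k bit0 \<Rightarrow> nat" where "pos i = nat (Rep_bit0 i)"

lemma bij_pos: "bij_betw pos UNIV {..<2 * Suc K}"
proof (rule bij_betw_byWitness[where f'="\<lambda>r. of_int (int r)"])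
  have r: "0 \<le> Rep_bit0 i" "Rep_bit0 i < 2 * int (Suc K)" for i :: "'k bit0"
    using type_definition.Rep[OF type_definition_bit0, of i] by (auto simp: card)
  then show "\<forall>i\<in>UNIV. of_int (int (pos i)) = i" "pos ` UNIV \<subseteq> {..<2 * Suc K}"
    using of_int_Rep_bit0 by (auto simp: pos_def nat_less_iff simp del: of_int_of_nat_eq)
  show "\<forall>r\<in>{..<2 * Suc K}. pos (of_int (int r)) = r"
    by (auto simp: pos_def Rep_bit0_of_int card simp del: of_int_of_nat_eq)
qed auto

definition generic :: "(complex^('k bit0)) set" where
  "generic = {x. det (padded_matrix pos K (\<lambda>l q. bracket UNIV (pencil 1 0) (H l) (s q) x)) \<noteq> 0} \<inter> {x. A x \<noteq> 0}"

lemma generic_nondegenerate: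
  "det (padded_matrix pos K (\<lambda>l q. bracket UNIV (pencil 1 0) (H l) (s q) x)) \<noteq> 0 \<longleftrightarrow>
    (\<forall>\<gamma>. (\<forall>l<K. (\<Sum>q<K. bracket UNIV (pencil 1 0) (H l) (s q) x * \<gamma> q) = 0) \<longrightarrow> (\<forall>q<K. \<gamma> q = 0))"
  by (rule det_padded_matrix[OF bij_pos]) simp

lemma generic_open_dense: "open generic" "closure generic = UNIV"
proof -
  let ?g = "\<lambda>x. det (padded_matrix pos K (\<lambda>l q. bracket UNIV (pencil 1 0) (H l) (s q) x))"
  have "mholomorphic_on UNIV (\<lambda>x. padded_matrix pos K (\<lambda>l q. bracket UNIV (pencil 1 0) (H l) (s q) x) $ i $ j)" for i j
    by (cases "pos i < K \<and> pos j < K")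
      (auto simp: padded_matrix_def intro!: bracket_mholomorphic_on pencil_mholomorphic_on H_mholomorphic_on s_mholomorphic_on)
  then have g: "mholomorphic_on UNIV ?g" by (rule mholomorphic_on_det)
  have op: "open {x. f x \<noteq> 0}" if "mholomorphic_on UNIV f" for f :: "complex^('k bit0) \<Rightarrow> complex"
    using mholomorphic_on_imp_continuous_on[OF that] by (intro open_Collect_neq continuous_on_const)
  show "open generic"
    unfolding generic_def by (intro open_Int op g A_mholomorphic_on)
  have "?g cut_point \<noteq> 0"
    unfolding generic_nondegenerate using cut_point_nondegenerate by blast
  then have dg: "closure {x. ?g x \<noteq> 0} = UNIV" by (rule closure_nonzero_set[OF g])
  \<comment> \<open>\<open>A\<close> vanishes at the cut point, so a separate witness is used; the
    generic set is the intersection of two dense open sets.\<close>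
  have "A (\<chi> i. 1) \<noteq> 0" by (simp add: A_def)
  then have dA: "closure {x. A x \<noteq> 0} = UNIV" by (rule closure_nonzero_set[OF A_mholomorphic_on])
  have "{x. ?g x \<noteq> 0} \<subseteq> closure generic"
    using open_Int_closure_subset[OF op[OF g], of "{x. A x \<noteq> 0}"] unfolding dA generic_def by simp
  then show "closure generic = UNIV"
    using closure_minimal[OF _ closed_closure, of "{x. ?g x \<noteq> 0}" generic] unfolding dg by blast
qed

lemma generic_chain: "lenard_chain (pencil 1 0) (pencil 0 1) generic H s A K pos"
proof
  have anti: "bracket UNIV (pencil \<alpha> \<beta>) f g x = - bracket UNIV (pencil \<alpha> \<beta>) g f x" for \<alpha> \<beta> f g and x :: "complex^('k bit0)"
    by (rule bracket_antisym) (rule pencil_antisym)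
  show "bij_betw pos UNIV {..<2 * Suc K}" by (rule bij_pos)
  show "bracket UNIV (pencil 0 1) (H 0) f x = 0" for f x
    by (subst anti) (simp add: lenard)
  show "bracket UNIV (pencil 0 1) (H (l + 1)) f x = - bracket UNIV (pencil 1 0) (H l) f x" if "l < K" for l f x
  proof -
    have "bracket UNIV (pencil 0 1) (H (l + 1)) f x = - bracket UNIV (pencil 0 1) f (H (l + 1)) x" by (rule anti)
    also have "\<dots> = bracket UNIV (pencil 1 0) f (H l) x" using lenard(2)[of l f x] that by simp
    finally show ?thesis using anti[of 1 0 f "H l" x] by simp
  qed
  show "bracket UNIV (pencil 1 0) (H K) f x = 0" for f x
    by (subst anti) (simp add: lenard)
  show "bracket UNIV (pencil 1 0) A f x = 0" "bracket UNIV (pencil 0 1) A f x = 0" for f x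
    by (subst anti, simp add: A_casimir)+
  show "\<forall>q<K. \<gamma> q = 0" if "x \<in> generic"
    "\<forall>l<K. (\<Sum>q<K. bracket UNIV (pencil 1 0) (H l) (s q) x * \<gamma> q) = 0" for x \<gamma>
    using that generic_nondegenerate[of x] unfolding generic_def by blast
  show "\<alpha> = 0 \<and> \<beta> = 0" if "x \<in> generic" "\<forall>i. \<alpha> * partial i (H K) x + \<beta> * partial i A x = 0" for x \<alpha> \<beta>
    using casimir_independent[OF _ that(2)] that(1) unfolding generic_def by blast
qed (simp_all add: generic_open_dense poisson_on_pencil H_mholomorphic_on s_mholomorphic_on
    A_mholomorphic_on s_commute)

lemma generically_kronecker_periodic_toda:
  "generically_kronecker [2 * Suc K - 1, 1] (periodic_toda :: 'k bit0 bistructure)"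
proof -
  let ?M = "restrict_bi generic (periodic_toda :: 'k bit0 bistructure)"
  let ?I = "{i. pos i < 2 * Suc K - 1}" and ?J = "{i. pos i = 2 * K + 1}"
  let ?Ns = "[flat_bi ?I pos, flat_bi ?J (\<lambda>_. 0)]"
  have bij: "bij_betw pos ?I {..<2 * Suc K - 1}"
  proof (rule bij_betw_subset[OF bij_pos subset_UNIV])
    show "pos ` ?I = {..<2 * Suc K - 1}"
    proof
      show "{..<2 * Suc K - 1} \<subseteq> pos ` ?I"
      proof
        fix r assume r: "r \<in> {..<2 * Suc K - 1}"
        then have "r \<in> pos ` UNIV" using bij_betw_imp_surj_on[OF bij_pos] by auto
        then show "r \<in> pos ` ?I" using r by auto
      qed
    qed auto
  qed
  have "2 * K + 1 \<in> pos ` UNIV" using bij_betw_imp_surj_on[OF bij_pos] by auto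
  then obtain i where i: "pos i = 2 * K + 1" by auto
  then have J: "?J = {i}" using bij_betw_imp_inj_on[OF bij_pos] by (auto simp: inj_on_def)
  \<comment> \<open>The remaining line is the flat block with \<open>m = 1\<close>, so its
    indecomposability comes from the same lemma as that of the large block.\<close>
  have bijJ: "bij_betw (\<lambda>_. 0) ?J {..<2 * 1 - 1 :: nat}" unfolding J by (auto simp: bij_betw_def)
  have M: "coords ?M = UNIV" "brack1 ?M = pencil 1 0" "brack2 ?M = pencil 0 1" "region ?M = generic"
    by (simp_all add: restrict_bi_def periodic_toda_def pencil_eq)
  have "isomorphic_near p ?M (prod_bi ?Ns)" if "p \<in> region ?M" for p
    using lenard_chain.straightening[OF generic_chain M(1-3), of p] that
    unfolding M(4) flat_prod_def by simp
  moreover have "disjoint_coords ?Ns"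
    by (auto simp: disjoint_coords_def less_Suc_eq)
  moreover have "bihamiltonian (?Ns ! m) \<and> translation_invariant (?Ns ! m) \<and> \<not> decomposable (?Ns ! m) \<and>
      card (coords (?Ns ! m)) = [2 * Suc K - 1, 1] ! m \<and> odd ([2 * Suc K - 1, 1] ! m)" if "m < 2" for m
  proof -
    have "m = 0 \<or> m = 1" using that by auto
    then show ?thesis
      using bihamiltonian_flat_bi[of ?I pos] bihamiltonian_flat_bi[of ?J "\<lambda>_. 0"]
        translation_invariant_flat_bi[of ?I pos] translation_invariant_flat_bi[of ?J "\<lambda>_. 0"]
        flat_bi_indecomposable[OF bij] flat_bi_indecomposable[OF bijJ]
        bij_betw_same_card[OF bij] J by auto
  qed
  ultimately have "kronecker [2 * Suc K - 1, 1] ?M"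
    unfolding kronecker_def using bihamiltonian_periodic_toda[OF generic_open_dense(1)]
    by (intro conjI ballI exI[of _ ?Ns]) auto
  then show ?thesis
    unfolding generically_kronecker_def
    using generic_open_dense by (intro exI[of _ generic]) (simp add: periodic_toda_def open_openin[symmetric])
qed

end

theorem theorem12p5:
  fixes k :: nat
  assumes "k \<ge> 1" and "CARD('k::finite) = k"
  shows "bihamiltonian (periodic_toda :: 'k bit0 bistructure) \<and>
         generically_kronecker [2 * k - 1, 1] (periodic_toda :: 'k bit0 bistructure)"
proof
  have "restrict_bi UNIV periodic_toda = (periodic_toda :: 'k bit0 bistructure)"
    by (simp add: restrict_bi_def periodic_toda_def)
  then show "bihamiltonian (periodic_toda :: 'k bit0 bistructure)"
    using bihamiltonian_periodic_toda[OF open_UNIV, where 'k='k] by simp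
  obtain K where K: "k = Suc K" using assms(1) by (cases k) auto
  interpret toda K "TYPE('k)" by unfold_locales (simp add: assms(2) K)
  show "generically_kronecker [2 * k - 1, 1] (periodic_toda :: 'k bit0 bistructure)"
    unfolding K by (rule generically_kronecker_periodic_toda)
qed

end
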